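(* Let $p\ge 1$ and $n\ge 1$ be integers and let $a,b\in\mathbb{R}$. Assume that one of the following holds: Case I: $p\geq 1$, $\max(-p/2-1,-2)<a\leq -1$ and $b>-1$; Case II: $p\geq 3$, $a=-2$ and $b\geq 0$. Let $X\sim N_p(\theta,\eta^{-1}I_p)$ and $S\sim \eta^{-1}\chi^2_n$ be independent, with $\theta\in\mathbb{R}^p$ and $\eta>0$ both unknown, and consider estimation of $\theta$ under the loss $\eta\|\delta-\theta\|^2$. Then the generalized Bayes estimator $\delta_*$ of $\theta$ with respect to the improper prior $$\pi_*(\theta,\eta)=\frac{1}{\eta}\int_0^\infty\frac{\eta^{p/2}}{(2\pi)^{p/2}g^{p/2}}\exp\left(-\frac{\eta}{2g}\|\theta\|^2\right)\pi(g)\,dg,\qquad \pi(g)=\frac{1}{(g+1)^{a+2}}\left(\frac{g}{g+1}\right)^b,$$ is admissible among all estimators.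
   Context: The observation is $(X,S)$, where $X$ and $S$ are independent with densities $f(x\mid\theta,\eta)=\frac{\eta^{p/2}}{(2\pi)^{p/2}}\exp(-\eta\|x-\theta\|^2/2)$ on $\mathbb{R}^p$ and $f(s\mid\eta)=\frac{\eta^{n/2}s^{n/2-1}}{\Gamma(n/2)2^{n/2}}\exp(-\eta s/2)$ on $(0,\infty)$. An estimator is a measurable function $\delta(x,s)\in\mathbb{R}^p$; its risk is $R(\delta;\theta,\eta)=E_{\theta,\eta}[\eta\|\delta(X,S)-\theta\|^2]\in[0,\infty]$. An estimator $\delta$ is admissible (among all estimators) if there is no estimator $\delta'$ with $R(\delta';\theta,\eta)\le R(\delta;\theta,\eta)$ for all $(\theta,\eta)\in\mathbb{R}^p\times(0,\infty)$ and strict inequality for some $(\theta,\eta)$. The generalized Bayes estimator is $$\delta_*(x,s)=\frac{\iint \eta\,\theta\,\pi_*(\theta,\eta)f(x\mid\theta,\eta)f(s\mid\eta)\,d\theta\,d\eta}{\iint \eta\,\pi_*(\theta,\eta)f(x\mid\theta,\eta)f(s\mid\eta)\,d\theta\,d\eta},$$ which is given explicitly by $$\delta_*(x,s)=\left(1-\frac{\int_0^\infty (g+1)^{-p/2-1}\bigl(1+\|x\|^2/\{s(g+1)\}\bigr)^{-p/2-n/2-1}\pi(g)\,dg}{\int_0^\infty (g+1)^{-p/2}\bigl(1+\|x\|^2/\{s(g+1)\}\bigr)^{-p/2-n/2-1}\pi(g)\,dg}\right)x.$$ In both cases $p/2+a+1>0$ and $b+1>0$, so that $\delta_*$ is well defined.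 *)

theory Defs
  imports "HOL-Probability.Probability"
begin

text \<open>
  The dimension \<open>p\<close> is \<open>CARD('p)\<close>, with \<open>\<real>\<^sup>p\<close> rendered as \<open>real ^ 'p\<close>; an observation is a pair
  \<open>(x, s)\<close> with \<open>s > 0\<close>, and a parameter is a pair \<open>(\<theta>, \<eta>)\<close> with \<open>\<eta> > 0\<close>.
\<close>

definition dens_X :: "real ^ 'p::finite \<Rightarrow> real \<Rightarrow> real ^ 'p \<Rightarrow> real" where
  "dens_X \<theta> \<eta> x =
     \<eta> powr (real CARD('p) / 2) / (2 * pi) powr (real CARD('p) / 2)
       * exp (- \<eta> * (norm (x - \<theta>))\<^sup>2 / 2)"

definition dens_S :: "nat \<Rightarrow> real \<Rightarrow> real \<Rightarrow> real" where
  "dens_S n \<eta> s =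
     \<eta> powr (real n / 2) * s powr (real n / 2 - 1) / (Gamma (real n / 2) * 2 powr (real n / 2))
       * exp (- \<eta> * s / 2)"

text \<open>
  The joint law of \<open>(X, S)\<close>: the product measure expresses independence. The second
  coordinate lives on \<open>(0, \<infinity>)\<close>, so neither risks nor measurability depend on how an
  estimator is extended to \<open>s \<le> 0\<close>.
\<close>

definition obs_law ::
  "nat \<Rightarrow> real ^ 'p::finite \<Rightarrow> real \<Rightarrow> ((real ^ 'p) \<times> real) measure" where
  "obs_law n \<theta> \<eta> =
     density lborel (\<lambda>x. ennreal (dens_X \<theta> \<eta> x))
       \<Otimes>\<^sub>M density (restrict_space lborel {0<..}) (\<lambda>s. ennreal (dens_S n \<eta> s))"

definition estimator :: "((real ^ 'p::finite) \<times> real \<Rightarrow> real ^ 'p) \<Rightarrow> bool" where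
  "estimator \<delta> \<longleftrightarrow> \<delta> \<in> borel_measurable (borel \<Otimes>\<^sub>M restrict_space borel {0<..})"

definition risk ::
  "nat \<Rightarrow> ((real ^ 'p::finite) \<times> real \<Rightarrow> real ^ 'p) \<Rightarrow> real ^ 'p \<Rightarrow> real \<Rightarrow> ennreal" where
  "risk n \<delta> \<theta> \<eta> = (\<integral>\<^sup>+ z. ennreal (\<eta> * (norm (\<delta> z - \<theta>))\<^sup>2) \<partial>obs_law n \<theta> \<eta>)"

definition admissible :: "nat \<Rightarrow> ((real ^ 'p::finite) \<times> real \<Rightarrow> real ^ 'p) \<Rightarrow> bool" where
  "admissible n \<delta> \<longleftrightarrow>
     estimator \<delta> \<and>
     \<not> (\<exists>\<delta>'. estimator \<delta>' \<and>
           (\<forall>\<theta> \<eta>. 0 < \<eta> \<longrightarrow> risk n \<delta>' \<theta> \<eta> \<le> risk n \<delta> \<theta> \<eta>) \<and>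
           (\<exists>\<theta> \<eta>. 0 < \<eta> \<and> risk n \<delta>' \<theta> \<eta> < risk n \<delta> \<theta> \<eta>))"

text \<open>
  The factor \<open>\<eta>\<close> in both integrals comes from the loss \<open>\<eta> \<parallel>\<delta> - \<theta>\<parallel>\<^sup>2\<close>. The numerator is a
  vector-valued Bochner integral.
\<close>

definition gen_Bayes ::
  "nat \<Rightarrow> (real ^ 'p::finite \<Rightarrow> real \<Rightarrow> real) \<Rightarrow> (real ^ 'p) \<times> real \<Rightarrow> real ^ 'p" where
  "gen_Bayes n prior = (\<lambda>(x, s).
     (LINT z:UNIV \<times> {0<..}|lborel.
        (case z of (\<theta>, \<eta>) \<Rightarrow> (\<eta> * prior \<theta> \<eta> * dens_X \<theta> \<eta> x * dens_S n \<eta> s) *\<^sub>R \<theta>))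
     /\<^sub>R
     (LINT z:UNIV \<times> {0<..}|lborel.
        (case z of (\<theta>, \<eta>) \<Rightarrow> \<eta> * prior \<theta> \<eta> * dens_X \<theta> \<eta> x * dens_S n \<eta> s)))"

definition mixing_dens :: "real \<Rightarrow> real \<Rightarrow> real \<Rightarrow> real" where
  "mixing_dens a b g = 1 / (g + 1) powr (a + 2) * (g / (g + 1)) powr b"

text \<open>
  At \<open>\<theta> = 0\<close> the integral over \<open>g\<close> may diverge, in which case the Bochner integral takes the
  value \<open>0\<close> instead of \<open>\<infinity>\<close>. This null set of parameters does not affect \<open>gen_Bayes\<close>.
\<close>

definition prior_star ::
  "real \<Rightarrow> real \<Rightarrow> real ^ 'p::finite \<Rightarrow> real \<Rightarrow> real" where
  "prior_star a b \<theta> \<eta> =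
     1 / \<eta> * (LINT g:{0<..}|lborel.
       \<eta> powr (real CARD('p) / 2)
         / ((2 * pi) powr (real CARD('p) / 2) * g powr (real CARD('p) / 2))
         * exp (- (\<eta> / (2 * g)) * (norm \<theta>)\<^sup>2) * mixing_dens a b g)"

definition delta_star ::
  "nat \<Rightarrow> real \<Rightarrow> real \<Rightarrow> (real ^ 'p::finite) \<times> real \<Rightarrow> real ^ 'p" where
  "delta_star n a b = gen_Bayes n (prior_star a b)"

end

theory Submission
  imports Defs
begin

text \<open>
  Blyth's argument, with the proper priors obtained by weighting the hyperparameter \<open>(g, \<eta>)\<close> of the
  hierarchical prior (\<open>\<theta>\<close> normal with covariance \<open>g / \<eta>\<close>) by \<open>\<kappa>\<^sup>2\<close>. Given \<open>(g, \<eta>)\<close>, the posterior mean of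
  \<open>\<theta>\<close> is \<open>(1 - \<nu>) x\<close> with \<open>\<nu> = 1 / (1 + g)\<close>, so at each observation the loss of \<open>\<delta>\<^sub>*\<close> against the
  proper Bayes estimator is governed by the covariance of \<open>\<nu>\<close> and \<open>\<kappa>\<^sup>2\<close>. It is bounded by the posterior
  expectation, for two independent copies, of \<open>(\<nu> - \<nu>')\<^sup>2 (\<kappa> - \<kappa>')\<^sup>2\<close>. Integrating over the observations
  leaves, up to constants, the Dirichlet energy of \<open>\<kappa>\<close> over the half-plane with coordinates \<open>ln (1 + g)\<close> and
  \<open>ln \<eta>\<close>, with weight of order \<open>(1 + g) powr (- a - 2)\<close> for large \<open>g\<close>. As \<open>a \<ge> - 2\<close> this is bounded, and
  logarithmic cutoffs make the energy tend to \<open>0\<close> because the half-plane is parabolic. In the borderline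
  case \<open>a = - 2\<close> no product of a function of \<open>g\<close> and a function of \<open>\<eta>\<close> would do.
\<close>

subsection \<open>Gaussian integrals\<close>

text \<open>The two copies share one posterior but may lie far apart, so the energy is nonlocal. To
  localize it, keep the copy with the smaller \<open>g\<close>: its shrinkage is the larger one and
  dominates \<open>(\<nu> - \<nu>')\<^sup>2\<close>. The other copy is integrated out. This works
  because in the coordinates \<open>ln (1 + g)\<close> and \<open>ln \<eta>\<close> its distance
  from the first has a small exponential moment under the posterior, up to a factor bounded in terms
  of \<open>\<eta> * s\<close> and \<open>\<eta> * (norm x)\<^sup>2 / (1 + g)\<close>. Given
  \<open>(g, \<eta>)\<close> the laws of these two are free of parameters, so averaging over the
  observations costs a constant. As a function of the distance \<open>r\<close> from the origin the
  cutoff \<open>1 - ln (1 + r) / i\<close> has slope of size \<open>1 / (i * (1 + r))\<close> up to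
  \<open>r = exp i - 1\<close>; in two dimensions the squared slope has an integral of order
  \<open>1 / i\<close>. No proper Bayes estimator is computed. The comparison is made directly with
  an estimator that dominates \<open>\<delta>\<^sub>*\<close>: a weighted squared distance between
  the two is bounded by the energy, hence is zero.\<close>

lemma nn_integral_lborel_translate:
  fixes m :: "'a::euclidean_space"
  assumes [measurable]: "f \<in> borel_measurable borel"
  shows "(\<integral>\<^sup>+y. f (m + y) \<partial>lborel) = (\<integral>\<^sup>+y. f y \<partial>lborel)"
proof -
  have "(\<integral>\<^sup>+y. f y \<partial>lborel) = (\<integral>\<^sup>+y. f y \<partial>distr lborel borel ((+) m))"
    by (simp add: lborel_distr_plus)
  then show ?thesis
    by (simp add: nn_integral_distr)
qed

lemma lborel_distr_uminus_euclidean: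
  "distr lborel borel uminus = (lborel :: 'a::euclidean_space measure)"
  by (subst lborel_affine[of "-1" 0]) (auto simp: density_1 one_ennreal_def[symmetric])

lemma nn_integral_lborel_uminus:
  fixes f :: "'a::euclidean_space \<Rightarrow> ennreal"
  assumes [measurable]: "f \<in> borel_measurable borel"
  shows "(\<integral>\<^sup>+y. f (- y) \<partial>lborel) = (\<integral>\<^sup>+y. f y \<partial>lborel)"
proof -
  have "(\<integral>\<^sup>+y. f y \<partial>lborel) = (\<integral>\<^sup>+y. f y \<partial>distr lborel borel uminus)"
    by (simp add: lborel_distr_uminus_euclidean)
  then show ?thesis
    by (simp add: nn_integral_distr)
qed

lemma dens_X_nonneg [simp]: "0 \<le> dens_X \<theta> \<eta> x"
  by (simp add: dens_X_def)

lemma dens_X_pos: "\<eta> > 0 \<Longrightarrow> 0 < dens_X \<theta> \<eta> x"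
  by (simp add: dens_X_def)

lemma dens_X_translate: "dens_X (m + \<theta>) \<eta> (m + x) = dens_X \<theta> \<eta> x"
  by (simp add: dens_X_def)

lemma dens_X_uminus: "dens_X 0 \<eta> (- x) = dens_X 0 \<eta> x"
  by (simp add: dens_X_def)

lemma measurable_dens_X [measurable (raw)]:
  assumes [measurable]: "f \<in> borel_measurable M" "g \<in> borel_measurable M" "h \<in> borel_measurable M"
  shows "(\<lambda>w. dens_X (f w) (g w) (h w)) \<in> borel_measurable M"
  unfolding dens_X_def by measurable

lemma dens_X_eq_prod_normal_density:
  fixes \<theta> :: "real ^ 'p::finite"
  assumes "\<eta> > 0"
  shows "dens_X \<theta> \<eta> x = (\<Prod>b\<in>Basis. normal_density (\<theta> \<bullet> b) (1 / sqrt \<eta>) (x \<bullet> b))"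
proof -
  have N: "normal_density \<mu> (1 / sqrt \<eta>) y
      = (\<eta> / (2 * pi)) powr (1 / 2) * exp (- \<eta> * (y - \<mu>)\<^sup>2 / 2)" for \<mu> y :: real
    using assms by (simp add: normal_density_def power_divide powr_half_sqrt real_sqrt_divide
        field_simps)
  have nsq: "(norm (x - \<theta>))\<^sup>2 = (\<Sum>b\<in>Basis. (x \<bullet> b - \<theta> \<bullet> b)\<^sup>2)"
    unfolding power2_norm_eq_inner
    by (subst euclidean_inner) (simp add: inner_diff_left power2_eq_square)
  have "(\<Prod>b\<in>(Basis :: (real ^ 'p) set). (\<eta> / (2 * pi)) powr (1 / 2))
      = (\<eta> / (2 * pi)) powr (real CARD('p) / 2)"
    using assms by (simp add: powr_powr flip: powr_realpow)
  moreover have "(\<Prod>b\<in>Basis. exp (- \<eta> * (x \<bullet> b - \<theta> \<bullet> b)\<^sup>2 / 2)) = exp (- \<eta> * (norm (x - \<theta>))\<^sup>2 / 2)"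
    by (simp add: nsq sum_distrib_left sum_divide_distrib sum_negf flip: exp_sum)
  ultimately have "(\<Prod>b\<in>Basis. normal_density (\<theta> \<bullet> b) (1 / sqrt \<eta>) (x \<bullet> b))
      = (\<eta> / (2 * pi)) powr (real CARD('p) / 2) * exp (- \<eta> * (norm (x - \<theta>))\<^sup>2 / 2)"
    by (simp only: N prod.distrib)
  then show ?thesis
    using assms by (simp add: dens_X_def powr_divide)
qed

lemma nn_integral_dens_X:
  fixes \<theta> :: "real ^ 'p::finite"
  assumes "\<eta> > 0"
  shows "(\<integral>\<^sup>+x. ennreal (dens_X \<theta> \<eta> x) \<partial>lborel) = 1"
proof -
  have 1: "(\<integral>\<^sup>+y. ennreal (normal_density \<mu> (1 / sqrt \<eta>) y) \<partial>lborel) = 1" for \<mu>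
    using prob_space.emeasure_space_1[OF prob_space_normal_density[of "1 / sqrt \<eta>" \<mu>]] assms
    by (simp add: emeasure_density)
  have "(\<integral>\<^sup>+x. ennreal (dens_X \<theta> \<eta> x) \<partial>lborel) =
      (\<integral>\<^sup>+x. (\<Prod>b\<in>Basis. ennreal (normal_density (\<theta> \<bullet> b) (1 / sqrt \<eta>) (x \<bullet> b))) \<partial>lborel)"
    using assms by (simp add: dens_X_eq_prod_normal_density prod_ennreal)
  also have "\<dots> = (\<Prod>b\<in>(Basis :: (real ^ 'p) set).
      \<integral>\<^sup>+y. ennreal (normal_density (\<theta> \<bullet> b) (1 / sqrt \<eta>) y) \<partial>lborel)"
    by (rule nn_integral_lborel_prod) auto
  finally show ?thesis
    by (simp add: 1)
qed

text \<open>Factors of moderate growth in \<open>y\<close> are absorbed by halving the precision: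
  the Gaussian gives up half of its exponent, and the normalizing constants differ by a power of
  \<open>2\<close>.\<close>

lemma dens_X_le_exp_half:
  fixes y :: "real ^ 'p::finite"
  assumes "c > 0" "0 \<le> t" "t \<le> exp (c * (norm y)\<^sup>2 / 4)"
  shows "dens_X 0 c y * t \<le> 2 powr (real CARD('p) / 2) * dens_X 0 (c / 2) y"
proof -
  have "exp (- c * (norm y)\<^sup>2 / 2) * t
      \<le> exp (- c * (norm y)\<^sup>2 / 2) * exp (c * (norm y)\<^sup>2 / 4)"
    using assms by (intro mult_left_mono) auto
  also have "\<dots> = exp (- (c / 2) * (norm y)\<^sup>2 / 2)"
    by (simp flip: exp_add)
  finally have "c powr (real CARD('p) / 2) / (2 * pi) powr (real CARD('p) / 2) *
      (exp (- c * (norm y)\<^sup>2 / 2) * t) \<le> c powr (real CARD('p) / 2) / (2 * pi) powr (real CARD('p) / 2) *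
      exp (- (c / 2) * (norm y)\<^sup>2 / 2)"
    by (intro mult_left_mono) auto
  also have "\<dots> = 2 powr (real CARD('p) / 2) * dens_X 0 (c / 2) y"
    using assms by (simp add: dens_X_def powr_divide)
  finally show ?thesis
    by (simp add: dens_X_def mult.assoc)
qed

text \<open>For \<open>c > 0\<close> the value is \<open>CARD('p) / c\<close>; only an upper bound
  of that order in \<open>c\<close> is used below. The type argument carries the dimension.\<close>

definition gauss_moment2 :: "'p::finite itself \<Rightarrow> real \<Rightarrow> ennreal" where
  "gauss_moment2 _ c = (\<integral>\<^sup>+y. ennreal (dens_X 0 c y * (norm (y :: real ^ 'p))\<^sup>2) \<partial>lborel)"

lemma gauss_moment2_le:
  assumes "c > 0"
  shows "gauss_moment2 TYPE('p::finite) c \<le> ennreal (4 / c * 2 powr (real CARD('p) / 2))"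
proof -
  have "gauss_moment2 TYPE('p) c
      \<le> (\<integral>\<^sup>+y. ennreal (4 / c * 2 powr (real CARD('p) / 2)) * ennreal (dens_X 0 (c / 2) (y :: real ^ 'p)) \<partial>lborel)"
    unfolding gauss_moment2_def
  proof (rule nn_integral_mono)
    fix y :: "real ^ 'p"
    have "c * (norm y)\<^sup>2 / 4 \<le> exp (c * (norm y)\<^sup>2 / 4)"
      using exp_ge_add_one_self[of "c * (norm y)\<^sup>2 / 4"] by linarith
    then have "dens_X 0 c y * (c * (norm y)\<^sup>2 / 4) \<le> 2 powr (real CARD('p) / 2) * dens_X 0 (c / 2) y"
      using assms by (intro dens_X_le_exp_half) auto
    then have "dens_X 0 c y * (norm y)\<^sup>2 \<le> 4 / c * 2 powr (real CARD('p) / 2) * dens_X 0 (c / 2) y"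
      using assms by (simp add: field_simps)
    then show "ennreal (dens_X 0 c y * (norm y)\<^sup>2)
        \<le> ennreal (4 / c * 2 powr (real CARD('p) / 2)) * ennreal (dens_X 0 (c / 2) y)"
      using assms by (simp add: ennreal_leI flip: ennreal_mult)
  qed
  then show ?thesis
    using assms by (simp add: nn_integral_cmult nn_integral_dens_X)
qed

text \<open>Bias and variance. The cross term is removed by averaging over \<open>y\<close> and
  \<open>- y\<close> with the parallelogram law, so the argument stays within nonnegative integrals
  and requires no integrability.\<close>

lemma nn_integral_dens_X_sq_dist:
  fixes m d :: "real ^ 'p::finite"
  assumes "c > 0"
  shows "(\<integral>\<^sup>+\<theta>. ennreal (dens_X m c \<theta> * (norm (d - \<theta>))\<^sup>2) \<partial>lborel)
    = ennreal ((norm (d - m))\<^sup>2) + gauss_moment2 TYPE('p) c"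
proof -
  define e where "e = d - m"
  let ?I = "\<integral>\<^sup>+y. ennreal (dens_X 0 c y * (norm (e - y))\<^sup>2) \<partial>lborel"
  have I: "(\<integral>\<^sup>+\<theta>. ennreal (dens_X m c \<theta> * (norm (d - \<theta>))\<^sup>2) \<partial>lborel) = ?I"
    by (subst nn_integral_lborel_translate[symmetric, of _ m])
       (use dens_X_translate[of m 0 c] in \<open>simp_all add: e_def algebra_simps\<close>)
  have "?I = (\<integral>\<^sup>+y. ennreal (dens_X 0 c y * (norm (e + y))\<^sup>2) \<partial>lborel)"
    by (subst nn_integral_lborel_uminus[symmetric]) (simp_all add: dens_X_uminus)
  then have "?I + ?I = (\<integral>\<^sup>+y. ennreal (dens_X 0 c y * (norm (e - y))\<^sup>2)
      + ennreal (dens_X 0 c y * (norm (e + y))\<^sup>2) \<partial>lborel)"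
    by (subst nn_integral_add) simp_all
  also have "\<dots> = (\<integral>\<^sup>+y. 2 * (ennreal ((norm e)\<^sup>2) * ennreal (dens_X 0 c (y :: real ^ 'p))
      + ennreal (dens_X 0 c y * (norm y)\<^sup>2)) \<partial>lborel)"
  proof (rule nn_integral_cong)
    fix y :: "real ^ 'p"
    have "(norm (e - y))\<^sup>2 + (norm (e + y))\<^sup>2 = 2 * ((norm e)\<^sup>2 + (norm y)\<^sup>2)"
      by (simp add: power2_norm_eq_inner algebra_simps inner_commute)
    then have "dens_X 0 c y * (norm (e - y))\<^sup>2 + dens_X 0 c y * (norm (e + y))\<^sup>2
        = 2 * ((norm e)\<^sup>2 * dens_X 0 c y + dens_X 0 c y * (norm y)\<^sup>2)"
      unfolding distrib_left[symmetric] by (simp add: algebra_simps)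
    then show "ennreal (dens_X 0 c y * (norm (e - y))\<^sup>2) + ennreal (dens_X 0 c y * (norm (e + y))\<^sup>2)
        = 2 * (ennreal ((norm e)\<^sup>2) * ennreal (dens_X 0 c y) + ennreal (dens_X 0 c y * (norm y)\<^sup>2))"
      by (simp flip: ennreal_plus ennreal_mult ennreal_numeral)
  qed
  also have "\<dots> = 2 * (ennreal ((norm e)\<^sup>2) + gauss_moment2 TYPE('p) c)"
    using assms
    by (simp add: nn_integral_cmult nn_integral_add nn_integral_dens_X gauss_moment2_def)
  finally have "2 * ?I = 2 * (ennreal ((norm e)\<^sup>2) + gauss_moment2 TYPE('p) c)"
    by (simp add: mult_2)
  then have "?I = ennreal ((norm e)\<^sup>2) + gauss_moment2 TYPE('p) c"
    by (subst (asm) ennreal_mult_cancel_left) simp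
  then show ?thesis
    by (simp add: I e_def)
qed

text \<open>Centering reduces this to mean \<open>0\<close>, where the integrand is odd.
  Integrability comes from \<open>norm y \<le> 1 + (norm y)\<^sup>2\<close> and the second
  moment.\<close>

lemma has_bochner_integral_dens_X_mean:
  fixes m :: "real ^ 'p::finite"
  assumes "c > 0"
  shows "has_bochner_integral lborel (\<lambda>\<theta>. dens_X m c \<theta> *\<^sub>R \<theta>) m"
proof -
  have int1: "integrable lborel (\<lambda>y :: real ^ 'p. dens_X 0 c y)"
    using nn_integral_dens_X[OF assms, of "0 :: real ^ 'p"] by (intro integrableI_nonneg) auto
  have int2: "integrable lborel (\<lambda>y :: real ^ 'p. dens_X 0 c y * (norm y)\<^sup>2)"
    using gauss_moment2_le[OF assms, where 'p='p]
    by (intro integrableI_nonneg) (auto simp: gauss_moment2_def less_top[symmetric] top_unique)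
  have int: "integrable lborel (\<lambda>y :: real ^ 'p. dens_X 0 c y *\<^sub>R y)"
  proof (rule Bochner_Integration.integrable_bound[OF Bochner_Integration.integrable_add[OF int1 int2]])
    show "AE y in lborel. norm (dens_X 0 c y *\<^sub>R y) \<le> norm (dens_X 0 c y + dens_X 0 c y * (norm (y :: real ^ 'p))\<^sup>2)"
    proof (rule AE_I2)
      fix y :: "real ^ 'p"
      have "norm y \<le> 1 + (norm y)\<^sup>2"
        using zero_le_power2[of "norm y - 1 / 2"] by (simp add: power2_eq_square algebra_simps)
      then have "dens_X 0 c y * norm y \<le> dens_X 0 c y * (1 + (norm y)\<^sup>2)"
        by (intro mult_left_mono) auto
      then show "norm (dens_X 0 c y *\<^sub>R y) \<le> norm (dens_X 0 c y + dens_X 0 c y * (norm y)\<^sup>2)"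
        by (simp add: algebra_simps)
    qed
  qed simp
  let ?J = "LINT y|lborel. dens_X 0 c (y :: real ^ 'p) *\<^sub>R y"
  have "?J = (LINT y|distr lborel borel uminus. dens_X 0 c (y :: real ^ 'p) *\<^sub>R y)"
    by (simp add: lborel_distr_uminus_euclidean)
  also have "\<dots> = - ?J"
    by (subst integral_distr) (simp_all add: dens_X_uminus)
  finally have J0: "?J = 0"
    by (simp add: eq_neg_iff_add_eq_0 flip: scaleR_2)
  have L1: "(LINT y|lborel. dens_X 0 c (y :: real ^ 'p)) = 1"
    using nn_integral_dens_X[OF assms, of "0 :: real ^ 'p"] by (simp add: integral_eq_nn_integral)
  have "has_bochner_integral lborel (\<lambda>y :: real ^ 'p. dens_X 0 c y *\<^sub>R m + dens_X 0 c y *\<^sub>R y) (1 *\<^sub>R m + 0)"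
    using int1 int J0 L1
    by (intro has_bochner_integral_add has_bochner_integral_scaleR_left)
       (simp_all add: has_bochner_integral_iff)
  then have "has_bochner_integral lborel (\<lambda>y :: real ^ 'p. dens_X m c (m + y) *\<^sub>R (m + y)) m"
    using dens_X_translate[of m 0 c] by (simp add: scaleR_add_right)
  then have "has_bochner_integral (distr lborel borel ((+) m)) (\<lambda>\<theta>. dens_X m c \<theta> *\<^sub>R \<theta>) m"
    by (intro has_bochner_integral_distr) simp_all
  then show ?thesis
    by (simp add: lborel_distr_plus)
qed

text \<open>Completing the square: marginal of \<open>x\<close> times posterior of \<open>\<theta>\<close>.\<close>

lemma dens_X_mult_dens_X:
  fixes x \<theta> :: "real ^ 'p::finite"
  assumes "g > 0" "\<eta> > 0"
  shows "dens_X 0 (\<eta> / g) \<theta> * dens_X \<theta> \<eta> x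
    = dens_X 0 (\<eta> / (1 + g)) x * dens_X ((g / (1 + g)) *\<^sub>R x) (\<eta> * (1 + g) / g) \<theta>"
proof -
  let ?k = "real CARD('p) / 2"
  have sq: "(norm \<theta>)\<^sup>2 / g + (norm (x - \<theta>))\<^sup>2
      = (norm x)\<^sup>2 / (1 + g) + (1 + g) / g * (norm (\<theta> - (g / (1 + g)) *\<^sub>R x))\<^sup>2"
  proof -
    have "1 + g \<noteq> 0" "g \<noteq> 0" using assms by auto
    then show ?thesis
      unfolding power2_norm_eq_inner inner_diff_left inner_diff_right inner_scaleR_left
        inner_scaleR_right inner_commute[of \<theta> x]
      by (simp add: divide_simps) (simp add: algebra_simps)
  qed
  have ex: "- \<eta> / 2 * (X / (1 + g) + (1 + g) / g * Y)
      = - (\<eta> / (1 + g)) * X / 2 + - (\<eta> * (1 + g) / g) * Y / 2" for X Y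
  proof -
    have "- \<eta> / 2 * (X / (1 + g)) = - (\<eta> / (1 + g)) * X / 2"
      "- \<eta> / 2 * ((1 + g) / g * Y) = - (\<eta> * (1 + g) / g) * Y / 2" by simp_all
    then show ?thesis by (simp only: distrib_left)
  qed
  have "exp (- (\<eta> / g) * (norm \<theta>)\<^sup>2 / 2) * exp (- \<eta> * (norm (x - \<theta>))\<^sup>2 / 2)
      = exp (- \<eta> / 2 * ((norm \<theta>)\<^sup>2 / g + (norm (x - \<theta>))\<^sup>2))"
    unfolding exp_add[symmetric] by (simp add: algebra_simps)
  also have "\<dots> = exp (- (\<eta> / (1 + g)) * (norm x)\<^sup>2 / 2)
      * exp (- (\<eta> * (1 + g) / g) * (norm (\<theta> - (g / (1 + g)) *\<^sub>R x))\<^sup>2 / 2)"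
    unfolding sq exp_add[symmetric] ex ..
  finally have E: "exp (- (\<eta> / g) * (norm \<theta>)\<^sup>2 / 2) * exp (- \<eta> * (norm (x - \<theta>))\<^sup>2 / 2) = \<dots>" .
  have P: "(\<eta> / g) powr ?k * \<eta> powr ?k = (\<eta> / (1 + g)) powr ?k * (\<eta> * (1 + g) / g) powr ?k"
    unfolding powr_mult[symmetric] using assms by simp
  have "dens_X 0 (\<eta> / g) \<theta> * dens_X \<theta> \<eta> x = ((\<eta> / g) powr ?k * \<eta> powr ?k) / ((2 * pi) powr ?k * (2 * pi) powr ?k)
     * (exp (- (\<eta> / g) * (norm \<theta>)\<^sup>2 / 2) * exp (- \<eta> * (norm (x - \<theta>))\<^sup>2 / 2))"
    unfolding dens_X_def by (simp only: diff_zero) (simp add: mult_ac)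
  also have "\<dots> = dens_X 0 (\<eta> / (1 + g)) x * dens_X ((g / (1 + g)) *\<^sub>R x) (\<eta> * (1 + g) / g) \<theta>"
    unfolding E P dens_X_def by (simp only: diff_zero) (simp add: mult_ac)
  finally show ?thesis .
qed

subsection \<open>One-dimensional integrals\<close>

text \<open>The coordinates \<open>s\<close>, \<open>g\<close> and \<open>\<eta>\<close> all live on
  the half-line. As a measure of its own it can enter product measures, and positivity becomes
  membership in the space.\<close>

abbreviation lpos :: "real measure" where
  "lpos \<equiv> restrict_space lborel {0<..}"

lemma space_lpos [simp]: "space lpos = {0<..}"
  by (simp add: space_restrict_space)

lemma sets_lpos_cong [measurable_cong]: "sets lpos = sets (restrict_space borel {0<..})"
  by (intro sets_restrict_space_cong) simp

lemma measurable_lpos_borel [measurable (raw)]: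
  "f \<in> borel_measurable borel \<Longrightarrow> f \<in> borel_measurable lpos"
  by (intro measurable_restrict_space1) simp

lemma measurable_ident_lpos [measurable]: "(\<lambda>x. x) \<in> borel_measurable lpos"
  by (rule measurable_lpos_borel) simp

lemma nn_integral_lpos:
  "(\<integral>\<^sup>+x. f x \<partial>lpos) = (\<integral>\<^sup>+x. f x * indicator {0<..} x \<partial>lborel)"
  by (simp add: nn_integral_restrict_space)

lemma sigma_finite_lpos: "sigma_finite_measure lpos"
  by (intro sigma_finite_measure_restrict_space sigma_finite_lborel) simp

interpretation lpos: sigma_finite_measure lpos
  by (rule sigma_finite_lpos)

lemma nn_integral_gamma:
  assumes "\<alpha> > 0" "\<rho> > 0"
  shows "(\<integral>\<^sup>+t. ennreal (t powr (\<alpha> - 1) * exp (- \<rho> * t)) \<partial>lpos) = ennreal (Gamma \<alpha> * \<rho> powr (- \<alpha>))"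
proof -
  have "ennreal (Gamma \<alpha>) = (\<integral>\<^sup>+t. ennreal (t powr (\<alpha> - 1) / exp t) * indicator {0<..} t \<partial>lborel)"
    unfolding Gamma_conv_nn_integral_real[OF assms(1)]
    by (intro nn_integral_cong) (auto simp: indicator_def)
  also have "\<dots> = ennreal \<rho> * (\<integral>\<^sup>+t. ennreal ((\<rho> * t) powr (\<alpha> - 1) / exp (\<rho> * t)) * indicator {0<..} (\<rho> * t) \<partial>lborel)"
    using assms by (subst nn_integral_real_affine[where c=\<rho> and t=0]) auto
  also have "\<dots> = ennreal \<rho> * (\<integral>\<^sup>+t. ennreal (\<rho> powr (\<alpha> - 1)) *
      (ennreal (t powr (\<alpha> - 1) * exp (- \<rho> * t)) * indicator {0<..} t) \<partial>lborel)"
  proof (rule arg_cong2[where f="(*)", OF refl], rule nn_integral_cong)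
    fix t :: real
    have "(\<rho> * t) powr (\<alpha> - 1) / exp (\<rho> * t) = \<rho> powr (\<alpha> - 1) * (t powr (\<alpha> - 1) * exp (- \<rho> * t))"
      by (simp add: powr_mult exp_minus divide_inverse)
    moreover have "indicator {0<..} (\<rho> * t) = (indicator {0<..} t :: ennreal)"
      using assms by (simp add: indicator_def zero_less_mult_iff)
    ultimately show "ennreal ((\<rho> * t) powr (\<alpha> - 1) / exp (\<rho> * t)) * indicator {0<..} (\<rho> * t)
        = ennreal (\<rho> powr (\<alpha> - 1)) * (ennreal (t powr (\<alpha> - 1) * exp (- \<rho> * t)) * indicator {0<..} t)"
      by (simp add: ennreal_mult mult.assoc)
  qed
  also have "\<dots> = ennreal (\<rho> powr \<alpha>) * (\<integral>\<^sup>+t. ennreal (t powr (\<alpha> - 1) * exp (- \<rho> * t)) \<partial>lpos)"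
    using assms by (subst nn_integral_cmult)
      (auto simp: nn_integral_lpos powr_diff simp flip: mult.assoc ennreal_mult)
  finally have "ennreal (\<rho> powr (- \<alpha>)) * ennreal (Gamma \<alpha>)
      = ennreal (\<rho> powr (- \<alpha>)) * ennreal (\<rho> powr \<alpha>) * (\<integral>\<^sup>+t. ennreal (t powr (\<alpha> - 1) * exp (- \<rho> * t)) \<partial>lpos)"
    by (simp add: mult.assoc)
  also have "ennreal (\<rho> powr (- \<alpha>)) * ennreal (\<rho> powr \<alpha>) = 1"
    using assms by (simp flip: ennreal_mult powr_add)
  finally show ?thesis
    using assms by (simp add: mult.commute flip: ennreal_mult)
qed

lemma nn_integral_powr_tail:
  assumes "e > 0" "A \<ge> 0"
  shows "(\<integral>\<^sup>+g. ennreal ((1 + g) powr (- e - 1)) * indicator {A..} g \<partial>lborel)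
    = ennreal ((1 + A) powr (- e) / e)"
proof -
  have "((\<lambda>g. - ((1 + g) powr (- e)) / e) \<longlongrightarrow> - 0 / e) at_top"
    using assms by (intro tendsto_intros tendsto_neg_powr) (auto intro: filterlim_tendsto_add_at_top filterlim_ident)
  then have "(\<integral>\<^sup>+g. ennreal ((1 + g) powr (- e - 1)) * indicator {A..} g \<partial>lborel)
      = ennreal (0 - (- ((1 + A) powr (- e)) / e))"
    using assms by (intro nn_integral_FTC_atLeast) (auto intro!: derivative_eq_intros)
  then show ?thesis
    by simp
qed

lemma nn_integral_ln_tail:
  assumes "c > 0" "A \<ge> 1"
  shows "(\<integral>\<^sup>+\<eta>. ennreal (1 / \<eta> * (A + ln \<eta>) powr (- c - 1)) * indicator {1..} \<eta> \<partial>lborel)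
    = ennreal (A powr (- c) / c)"
proof -
  have "filterlim (\<lambda>\<eta>. A + ln \<eta>) at_top at_top"
    by (intro filterlim_tendsto_add_at_top[OF tendsto_const] ln_at_top)
  then have "((\<lambda>\<eta>. - ((A + ln \<eta>) powr (- c)) / c) \<longlongrightarrow> - 0 / c) at_top"
    using assms by (intro tendsto_intros tendsto_neg_powr) auto
  then have "(\<integral>\<^sup>+\<eta>. ennreal (1 / \<eta> * (A + ln \<eta>) powr (- c - 1)) * indicator {1..} \<eta> \<partial>lborel)
      = ennreal (0 - (- ((A + ln 1) powr (- c)) / c))"
    using assms
    by (intro nn_integral_FTC_atLeast) (auto intro!: derivative_eq_intros add_pos_nonneg simp: field_simps)
  then show ?thesis
    by simp
qed

text \<open>The reflection \<open>\<eta> \<mapsto> 1 / \<eta>\<close> of the integral over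
  \<open>{1..}\<close>. The integrand is improper at \<open>0\<close>, so the fundamental theorem is
  applied on the open interval with one-sided limits.\<close>

lemma nn_integral_ln_head:
  assumes "c > 0" "A \<ge> 1"
  shows "(\<integral>\<^sup>+\<eta>. ennreal (1 / \<eta> * (A - ln \<eta>) powr (- c - 1)) * indicator {0<..<1} \<eta> \<partial>lborel)
    = ennreal (A powr (- c) / c)"
proof -
  let ?f = "\<lambda>\<eta>. 1 / \<eta> * (A - ln \<eta>) powr (- c - 1)"
  let ?F = "\<lambda>\<eta>. (A - ln \<eta>) powr (- c) / c"
  have pos: "A - ln \<eta> > 0" if "0 < \<eta>" "\<eta> < 1" for \<eta>
    using ln_less_zero[OF that] assms(2) by linarith
  have der: "DERIV ?F \<eta> :> ?f \<eta>" if "0 < \<eta>" "\<eta> < 1" for \<eta>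
    using that pos[OF that] assms by (auto intro!: derivative_eq_intros simp: field_simps)
  have cont: "isCont ?f \<eta>" if "0 < \<eta>" "\<eta> < 1" for \<eta>
    using that pos[OF that] by (intro continuous_intros) auto
  have "filterlim (\<lambda>\<eta>::real. - ln \<eta>) at_top (at_right 0)"
    using ln_at_0 by (simp add: filterlim_uminus_at_bot)
  then have "filterlim (\<lambda>\<eta>::real. A - ln \<eta>) at_top (at_right 0)"
    using filterlim_tendsto_add_at_top[OF tendsto_const, of "\<lambda>\<eta>::real. - ln \<eta>" "at_right 0" A] by simp
  then have "(?F \<longlongrightarrow> 0 / c) (at_right 0)"
    using assms by (intro tendsto_intros tendsto_neg_powr) auto
  then have lim0: "((?F \<circ> real_of_ereal) \<longlongrightarrow> 0) (at_right (ereal 0))"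
    by (simp add: ereal_tendsto_simps)
  have "(?F \<longlongrightarrow> (A - ln 1) powr (- c) / c) (at_left 1)"
    using assms by (intro tendsto_intros) auto
  then have lim1: "((?F \<circ> real_of_ereal) \<longlongrightarrow> A powr (- c) / c) (at_left (ereal 1))"
    by (simp add: ereal_tendsto_simps)
  have "set_integrable lborel (einterval (ereal 0) (ereal 1)) ?f"
    "(LBINT x=ereal 0..ereal 1. ?f x) = A powr (- c) / c - 0"
    using der cont lim0 lim1
    by (intro interval_integral_FTC_nonneg[where F="?F"]; force intro!: AE_I2)+
  then have "set_integrable lborel {0<..<1} ?f" "(LINT x:{0<..<1}|lborel. ?f x) = A powr (- c) / c"
    by (simp_all add: interval_lebesgue_integral_def)
  then have "(\<integral>\<^sup>+x. ennreal (indicator {0<..<1} x *\<^sub>R ?f x) \<partial>lborel) = ennreal (A powr (- c) / c)"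
    unfolding set_integrable_def set_lebesgue_integral_def
    by (subst nn_integral_eq_integral) (auto simp: indicator_def)
  moreover have "(\<integral>\<^sup>+x. ennreal (indicator {0<..<1} x *\<^sub>R ?f x) \<partial>lborel)
      = (\<integral>\<^sup>+x. ennreal (?f x) * indicator {0<..<1} x \<partial>lborel)"
    by (intro nn_integral_cong) (auto simp: indicator_def)
  ultimately show ?thesis
    by simp
qed

text \<open>In the coordinate \<open>v = ln \<eta>\<close> this is the integral of
  \<open>(A + \<bar>v\<bar>) powr (- c - 1)\<close> over the line. It serves to integrate the cutoff
  energy over \<open>\<eta>\<close> for fixed \<open>g\<close>.\<close>

lemma nn_integral_abs_ln:
  assumes "c > 0" "A \<ge> 1"
  shows "(\<integral>\<^sup>+\<eta>. ennreal (1 / \<eta> * (A + \<bar>ln \<eta>\<bar>) powr (- c - 1)) \<partial>lpos) = ennreal (2 * A powr (- c) / c)"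
proof -
  have "(\<integral>\<^sup>+\<eta>. ennreal (1 / \<eta> * (A + \<bar>ln \<eta>\<bar>) powr (- c - 1)) \<partial>lpos)
      = (\<integral>\<^sup>+\<eta>. ennreal (1 / \<eta> * (A - ln \<eta>) powr (- c - 1)) * indicator {0<..<1} \<eta>
          + ennreal (1 / \<eta> * (A + ln \<eta>) powr (- c - 1)) * indicator {1..} \<eta> \<partial>lborel)"
    unfolding nn_integral_lpos
    by (intro nn_integral_cong) (auto simp: indicator_def not_less abs_of_neg)
  also have "\<dots> = (\<integral>\<^sup>+\<eta>. ennreal (1 / \<eta> * (A - ln \<eta>) powr (- c - 1)) * indicator {0<..<1} \<eta> \<partial>lborel)
      + (\<integral>\<^sup>+\<eta>. ennreal (1 / \<eta> * (A + ln \<eta>) powr (- c - 1)) * indicator {1..} \<eta> \<partial>lborel)"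
    by (intro nn_integral_add) simp_all
  also have "\<dots> = ennreal (A powr (- c) / c) + ennreal (A powr (- c) / c)"
    unfolding nn_integral_ln_head[OF assms] nn_integral_ln_tail[OF assms] ..
  also have "\<dots> = ennreal (2 * A powr (- c) / c)"
    using assms by (simp flip: ennreal_plus)
  finally show ?thesis .
qed

lemma nn_integral_powr_unit:
  assumes "b > - 1"
  shows "(\<integral>\<^sup>+g. ennreal (g powr b) * indicator {0<..<1} g \<partial>lborel) \<le> ennreal (1 / (b + 1))"
proof -
  have "((\<lambda>g. g powr b) has_integral 1 powr (b + 1) / (b + 1)) {0..1::real}"
    using assms by (intro has_integral_powr_from_0) auto
  then have "(\<integral>\<^sup>+g. indicator {0..1} g * ennreal (g powr b) \<partial>lborel) = ennreal (1 / (b + 1))"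
    using nn_integral_has_integral_lebesgue[of "{0..1}" "\<lambda>g. g powr b" "1 / (b + 1)"]
    by (simp add: ennreal_mult' indicator_mult_ennreal)
  moreover have "(\<integral>\<^sup>+g. ennreal (g powr b) * indicator {0<..<1} g \<partial>lborel)
      \<le> (\<integral>\<^sup>+g. indicator {0..1} g * ennreal (g powr b) \<partial>lborel)"
    by (intro nn_integral_mono) (auto simp: indicator_def)
  ultimately show ?thesis by simp
qed

section \<open>Size of the mixing density and moments of \<open>g\<close> given the
  observation\<close>

lemma powr_le_two_powr_abs:
  fixes t e :: real
  assumes "1 / 2 \<le> t" "t \<le> 2"
  shows "t powr e \<le> 2 powr \<bar>e\<bar>" "2 powr (- \<bar>e\<bar>) \<le> t powr e"
proof -
  have "\<bar>ln t\<bar> \<le> ln 2"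
    using assms ln_mono[of "1/2" t] ln_mono[of t 2] by (auto simp: ln_div abs_le_iff)
  then have "\<bar>e * ln t\<bar> \<le> \<bar>e\<bar> * ln 2"
    by (simp add: abs_mult mult_left_mono)
  then show "t powr e \<le> 2 powr \<bar>e\<bar>" "2 powr (- \<bar>e\<bar>) \<le> t powr e"
    using assms by (auto simp: powr_def)
qed

lemma mixing_dens_nonneg [simp]: "0 \<le> mixing_dens a b g"
  by (simp add: mixing_dens_def)

lemma mixing_dens_pos: "g > 0 \<Longrightarrow> 0 < mixing_dens a b g"
  by (simp add: mixing_dens_def)

lemma measurable_mixing_dens [measurable (raw)]:
  assumes [measurable]: "f \<in> borel_measurable M"
  shows "(\<lambda>x. mixing_dens a b (f x)) \<in> borel_measurable M"
  unfolding mixing_dens_def by measurable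

text \<open>On this range \<open>1 + g\<close> stays between \<open>1\<close> and \<open>2\<close>,
  so every power of it is bounded by a constant.\<close>

lemma mixing_dens_le_near_0:
  assumes "0 < g" "g \<le> 1"
  shows "mixing_dens a b g \<le> 2 powr (\<bar>a + 2\<bar> + \<bar>b\<bar>) * g powr b"
proof -
  have "mixing_dens a b g = (1 + g) powr (- (a + 2)) * (1 + g) powr (- b) * g powr b"
    unfolding mixing_dens_def powr_divide powr_minus_divide by (simp add: add.commute)
  also have "\<dots> \<le> 2 powr \<bar>- (a + 2)\<bar> * 2 powr \<bar>- b\<bar> * g powr b"
    using assms by (intro mult_right_mono mult_mono powr_le_two_powr_abs) auto
  finally show ?thesis
    unfolding abs_minus_cancel by (simp add: powr_add)
qed

text \<open>On this range \<open>g / (1 + g)\<close> stays between \<open>1 / 2\<close> and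
  \<open>1\<close>, so only the polynomial tail matters. The lower bound is what later keeps the
  posterior normalization from being too small.\<close>

lemma mixing_dens_bounds_away_0:
  assumes "1 \<le> g"
  shows "mixing_dens a b g \<le> 2 powr \<bar>b\<bar> * (1 + g) powr (- a - 2)"
    "2 powr (- \<bar>b\<bar>) * (1 + g) powr (- a - 2) \<le> mixing_dens a b g"
proof -
  have "- a - 2 = - (a + 2)" by simp
  then have "mixing_dens a b g = (g / (1 + g)) powr b * (1 + g) powr (- a - 2)"
    using assms by (simp only: mixing_dens_def powr_minus) (simp add: add.commute field_simps)
  moreover have "(g / (1 + g)) powr b \<le> 2 powr \<bar>b\<bar>" "2 powr (- \<bar>b\<bar>) \<le> (g / (1 + g)) powr b"
    using assms by (auto intro!: powr_le_two_powr_abs simp: field_simps)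
  ultimately show "mixing_dens a b g \<le> 2 powr \<bar>b\<bar> * (1 + g) powr (- a - 2)"
    "2 powr (- \<bar>b\<bar>) * (1 + g) powr (- a - 2) \<le> mixing_dens a b g"
    by (auto intro: mult_right_mono)
qed

lemma powr_nonpos_le_one:
  fixes x e :: real
  assumes "1 \<le> x" "e \<le> 0"
  shows "x powr e \<le> 1"
  using powr_mono[of e 0 x] assms by simp

lemma nn_integral_mixing_dens_head_le:
  assumes "b > - 1"
  shows "(\<integral>\<^sup>+g. ennreal (mixing_dens a b g) * indicator {0<..<1} g \<partial>lborel)
    \<le> ennreal (2 powr (\<bar>a + 2\<bar> + \<bar>b\<bar>) / (b + 1))"
proof -
  have "(\<integral>\<^sup>+g. ennreal (mixing_dens a b g) * indicator {0<..<1} g \<partial>lborel)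
      \<le> (\<integral>\<^sup>+g. ennreal (2 powr (\<bar>a + 2\<bar> + \<bar>b\<bar>)) * (ennreal (g powr b) * indicator {0<..<1} g) \<partial>lborel)"
    by (intro nn_integral_mono)
       (auto simp: indicator_def mixing_dens_le_near_0 intro!: ennreal_leI simp flip: ennreal_mult)
  also have "\<dots> \<le> ennreal (2 powr (\<bar>a + 2\<bar> + \<bar>b\<bar>)) * ennreal (1 / (b + 1))"
    by (subst nn_integral_cmult) (auto intro!: mult_left_mono nn_integral_powr_unit assms)
  finally show ?thesis
    using assms by (simp flip: ennreal_mult)
qed

lemma nn_integral_mixing_dens_tail_le:
  assumes "e < a + 1" "A \<ge> 1"
  shows "(\<integral>\<^sup>+g. ennreal ((1 + g) powr e * mixing_dens a b g) * indicator {A..} g \<partial>lborel)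
    \<le> ennreal (2 powr \<bar>b\<bar> * ((1 + A) powr (e - a - 1) / (a + 1 - e)))"
proof -
  have "(\<integral>\<^sup>+g. ennreal ((1 + g) powr e * mixing_dens a b g) * indicator {A..} g \<partial>lborel)
      \<le> (\<integral>\<^sup>+g. ennreal (2 powr \<bar>b\<bar>) * (ennreal ((1 + g) powr (- (a + 1 - e) - 1)) * indicator {A..} g) \<partial>lborel)"
  proof (rule nn_integral_mono)
    fix g :: real
    have "(1 + g) powr e * mixing_dens a b g \<le> 2 powr \<bar>b\<bar> * (1 + g) powr (- (a + 1 - e) - 1)" if "g \<ge> A"
    proof -
      have "(1 + g) powr e * mixing_dens a b g \<le> (1 + g) powr e * (2 powr \<bar>b\<bar> * (1 + g) powr (- a - 2))"
        using that assms by (intro mult_left_mono mixing_dens_bounds_away_0) auto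
      also have "\<dots> = 2 powr \<bar>b\<bar> * (1 + g) powr (- (a + 1 - e) - 1)"
        by (simp add: algebra_simps flip: powr_add)
      finally show ?thesis .
    qed
    then show "ennreal ((1 + g) powr e * mixing_dens a b g) * indicator {A..} g
       \<le> ennreal (2 powr \<bar>b\<bar>) * (ennreal ((1 + g) powr (- (a + 1 - e) - 1)) * indicator {A..} g)"
      by (auto simp: indicator_def intro!: ennreal_leI simp flip: ennreal_mult)
  qed
  also have "\<dots> = ennreal (2 powr \<bar>b\<bar>) * ennreal ((1 + A) powr (- (a + 1 - e)) / (a + 1 - e))"
    using assms by (subst nn_integral_cmult) (simp_all add: nn_integral_powr_tail del: minus_diff_eq)
  finally show ?thesis
    using assms by (simp add: algebra_simps flip: ennreal_mult)
qed

lemma nn_integral_lpos_split: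
  assumes "f \<in> borel_measurable borel" "A > 0"
  shows "(\<integral>\<^sup>+g. f g \<partial>lpos) = (\<integral>\<^sup>+g. f g * indicator {0<..<A} g \<partial>lborel) + (\<integral>\<^sup>+g. f g * indicator {A..} g \<partial>lborel)"
proof -
  have "(\<integral>\<^sup>+g. f g \<partial>lpos) = (\<integral>\<^sup>+g. f g * indicator {0<..<A} g + f g * indicator {A..} g \<partial>lborel)"
    unfolding nn_integral_lpos using assms by (intro nn_integral_cong) (auto simp: indicator_def)
  also have "\<dots> = (\<integral>\<^sup>+g. f g * indicator {0<..<A} g \<partial>lborel) + (\<integral>\<^sup>+g. f g * indicator {A..} g \<partial>lborel)"
    using assms by (intro nn_integral_add) simp_all
  finally show ?thesis .
qed

text \<open>The \<open>g\<close>-density given \<open>w = \<parallel>x\<parallel>\<^sup>2 / s\<close>, up to normalization, where \<open>k = p / 2\<close>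
  and \<open>N = p / 2 + n / 2 + 1\<close>.\<close>

definition mix_post :: "real \<Rightarrow> real \<Rightarrow> real \<Rightarrow> real \<Rightarrow> real \<Rightarrow> real \<Rightarrow> real" where
  "mix_post k N a b w g = (1 + g) powr (- k) * mixing_dens a b g * (1 + w / (1 + g)) powr (- N)"

lemma mix_post_nonneg [simp]: "0 \<le> mix_post k N a b w g"
  by (simp add: mix_post_def)

lemma measurable_mix_post [measurable (raw)]:
  assumes [measurable]: "f \<in> borel_measurable M" "h \<in> borel_measurable M"
  shows "(\<lambda>x. mix_post k N a b (f x) (h x)) \<in> borel_measurable M"
  unfolding mix_post_def by measurable

lemma mix_post_le:
  assumes "N \<ge> 0" "w \<ge> 0" "g > 0"
  shows "mix_post k N a b w g \<le> (1 + g) powr (- k) * mixing_dens a b g"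
proof -
  have "(1 + w / (1 + g)) powr (- N) \<le> 1"
    using assms by (intro powr_nonpos_le_one) auto
  then show ?thesis
    by (simp add: mix_post_def mult_left_le)
qed

text \<open>Convergence at \<open>0\<close> comes from \<open>b > - 1\<close>. At infinity the
  integrand is of order at most \<open>(1 + g) powr (- k - a - 2)\<close>, which is integrable by
  \<open>k + a + 1 > 0\<close>.\<close>

lemma nn_integral_mix_post_finite:
  assumes "k \<ge> 0" "N \<ge> 0" "b > - 1" "k + a + 1 > 0" "w \<ge> 0"
  shows "(\<integral>\<^sup>+g. ennreal (mix_post k N a b w g) \<partial>lpos) < \<infinity>"
proof -
  have "(\<integral>\<^sup>+g. ennreal (mix_post k N a b w g) \<partial>lpos) \<le> (\<integral>\<^sup>+g. ennreal ((1 + g) powr (- k) * mixing_dens a b g) \<partial>lpos)"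
    using assms by (intro nn_integral_mono ennreal_leI mix_post_le) auto
  also have "\<dots> = (\<integral>\<^sup>+g. ennreal ((1 + g) powr (- k) * mixing_dens a b g) * indicator {0<..<1} g \<partial>lborel)
     + (\<integral>\<^sup>+g. ennreal ((1 + g) powr (- k) * mixing_dens a b g) * indicator {1..} g \<partial>lborel)"
    by (intro nn_integral_lpos_split) auto
  also have "\<dots> \<le> (\<integral>\<^sup>+g. ennreal (mixing_dens a b g) * indicator {0<..<1} g \<partial>lborel)
     + (\<integral>\<^sup>+g. ennreal ((1 + g) powr (- k) * mixing_dens a b g) * indicator {1..} g \<partial>lborel)"
  proof (intro add_right_mono nn_integral_mono)
    fix g :: real
    have "(1 + g) powr (- k) \<le> 1" if "g > 0"
      using that assms by (intro powr_nonpos_le_one) auto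
    then show "ennreal ((1 + g) powr (- k) * mixing_dens a b g) * indicator {0<..<1} g
        \<le> ennreal (mixing_dens a b g) * indicator {0<..<1} g"
      by (auto simp: indicator_def mult_left_le_one_le intro!: ennreal_leI)
  qed
  also have "\<dots> \<le> ennreal (2 powr (\<bar>a + 2\<bar> + \<bar>b\<bar>) / (b + 1))
     + ennreal (2 powr \<bar>b\<bar> * ((1 + 1) powr (- k - a - 1) / (a + 1 - - k)))"
    using assms by (intro add_mono nn_integral_mixing_dens_head_le nn_integral_mixing_dens_tail_le) auto
  also have "\<dots> < \<infinity>"
    by (simp flip: less_top)
  finally show ?thesis .
qed

text \<open>Only the window from \<open>1 + w\<close> to \<open>2 * (1 + w)\<close> is kept. It has
  length \<open>1 + w\<close>, and on it \<open>1 + w / (1 + g) \<le> 2\<close> and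
  \<open>1 + g \<le> 3 * (1 + w)\<close>.\<close>

lemma nn_integral_mix_post_ge:
  assumes "k \<ge> 0" "N \<ge> 0" "k + a + 1 > 0" "w \<ge> 0"
  shows "ennreal (2 powr (- \<bar>b\<bar> - N) * 3 powr (- k - a - 2) * (1 + w) powr (- k - a - 1))
    \<le> (\<integral>\<^sup>+g. ennreal (mix_post k N a b w g) \<partial>lpos)"
proof -
  define c where "c = 2 powr (- \<bar>b\<bar> - N) * (3 * (1 + w)) powr (- k - a - 2)"
  have "ennreal c * ennreal (1 + w) = (\<integral>\<^sup>+g. ennreal c * indicator {1 + w..2 * (1 + w)} g \<partial>lborel)"
    using assms by (simp add: nn_integral_cmult_indicator)
  also have "\<dots> \<le> (\<integral>\<^sup>+g. ennreal (mix_post k N a b w g) * indicator {0<..} g \<partial>lborel)"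
  proof (rule nn_integral_mono)
    fix g :: real
    have "c \<le> mix_post k N a b w g" if g: "1 + w \<le> g" "g \<le> 2 * (1 + w)"
    proof -
      have "c = (3 * (1 + w)) powr (- k - a - 2) * 2 powr (- \<bar>b\<bar>) * 2 powr (- N)"
        by (simp add: c_def powr_diff powr_minus field_simps)
      also have "\<dots> \<le> (1 + g) powr (- k - a - 2) * 2 powr (- \<bar>b\<bar>) * (1 + w / (1 + g)) powr (- N)"
        using assms g by (intro mult_mono powr_mono2') (auto simp: field_simps)
      also have "\<dots> = (1 + g) powr (- k) * (2 powr (- \<bar>b\<bar>) * (1 + g) powr (- a - 2)) * (1 + w / (1 + g)) powr (- N)"
      proof -
        have "- k - a - 2 = - k + (- a - 2)" by simp
        then have "(1 + g) powr (- k - a - 2) = (1 + g) powr (- k) * (1 + g) powr (- a - 2)"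
          by (simp only: powr_add)
        then show ?thesis by simp
      qed
      also have "\<dots> \<le> mix_post k N a b w g"
        unfolding mix_post_def using assms g
        by (intro mult_right_mono mult_left_mono mixing_dens_bounds_away_0) auto
      finally show ?thesis .
    qed
    then show "ennreal c * indicator {1 + w..2 * (1 + w)} g \<le> ennreal (mix_post k N a b w g) * indicator {0<..} g"
      using assms by (auto simp: indicator_def intro!: ennreal_leI)
  qed
  finally have "ennreal c * ennreal (1 + w) \<le> (\<integral>\<^sup>+g. ennreal (mix_post k N a b w g) \<partial>lpos)"
    by (simp add: nn_integral_lpos)
  moreover have "c * (1 + w) = 2 powr (- \<bar>b\<bar> - N) * 3 powr (- k - a - 2) * (1 + w) powr (- k - a - 1)"
  proof -
    have "- k - a - 1 = (- k - a - 2) + 1" by simp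
    then have "(1 + w) powr (- k - a - 1) = (1 + w) powr (- k - a - 2) * (1 + w)"
      using assms by (simp only: powr_add) simp
    then show ?thesis
      unfolding c_def powr_mult by simp
  qed
  moreover have "ennreal c * ennreal (1 + w) = ennreal (c * (1 + w))"
    using assms by (subst ennreal_mult) (auto simp: c_def)
  ultimately show ?thesis
    by (simp only:)
qed

text \<open>Given the observation, \<open>g\<close> exceeds the scale \<open>1 + w\<close> only with
  a small tail. Below \<open>1 + w\<close> the moment factor is at most
  \<open>(2 * (1 + w)) powr \<epsilon>\<close>. Above it the integral has order
  \<open>(1 + w) powr (\<epsilon> - k - a - 1)\<close>, convergent because
  \<open>\<epsilon> < k + a + 1\<close>, and the lower bound on the normalization absorbs
  it.\<close>

lemma mix_post_moment_le:
  assumes "k \<ge> 0" "N \<ge> 0" "b > - 1" "0 < \<epsilon>" "\<epsilon> < k + a + 1"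
  obtains C where "C \<ge> 0" "\<And>w. w \<ge> 0 \<Longrightarrow>
    (\<integral>\<^sup>+g. ennreal ((1 + g) powr \<epsilon> * mix_post k N a b w g) \<partial>lpos)
      \<le> ennreal (C * (1 + w) powr \<epsilon>) * (\<integral>\<^sup>+g. ennreal (mix_post k N a b w g) \<partial>lpos)"
proof
  define \<beta> where "\<beta> = k + a + 1"
  define c where "c = 2 powr (- \<bar>b\<bar> - N) * 3 powr (- k - a - 2)"
  have c: "c > 0" and \<beta>: "\<epsilon> < \<beta>"
    using assms by (simp_all add: c_def \<beta>_def)
  define D where "D = 2 powr \<bar>b\<bar> / (\<beta> - \<epsilon>)"
  have D: "D \<ge> 0"
    using \<beta> by (simp add: D_def)
  define C where "C = 2 powr \<epsilon> + D / c"
  show "C \<ge> 0"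
    using c D by (simp add: C_def)
  fix w :: real assume w: "w \<ge> 0"
  let ?I = "\<integral>\<^sup>+g. ennreal (mix_post k N a b w g) \<partial>lpos"
  have "(\<integral>\<^sup>+g. ennreal ((1 + g) powr \<epsilon> * mix_post k N a b w g) \<partial>lpos)
     = (\<integral>\<^sup>+g. ennreal ((1 + g) powr \<epsilon> * mix_post k N a b w g) * indicator {0<..<1 + w} g \<partial>lborel)
     + (\<integral>\<^sup>+g. ennreal ((1 + g) powr \<epsilon> * mix_post k N a b w g) * indicator {1 + w..} g \<partial>lborel)"
    using w by (intro nn_integral_lpos_split) auto
  also have "\<dots> \<le> (\<integral>\<^sup>+g. ennreal ((2 * (1 + w)) powr \<epsilon>) * (ennreal (mix_post k N a b w g) * indicator {0<..} g) \<partial>lborel)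
     + (\<integral>\<^sup>+g. ennreal ((1 + g) powr (\<epsilon> - k) * mixing_dens a b g) * indicator {1 + w..} g \<partial>lborel)"
  proof (intro add_mono nn_integral_mono)
    fix g :: real
    have "(1 + g) powr \<epsilon> * mix_post k N a b w g \<le> (2 * (1 + w)) powr \<epsilon> * mix_post k N a b w g"
      if "0 < g" "g < 1 + w"
      using that assms w by (intro mult_right_mono powr_mono2) auto
    then show "ennreal ((1 + g) powr \<epsilon> * mix_post k N a b w g) * indicator {0<..<1 + w} g
      \<le> ennreal ((2 * (1 + w)) powr \<epsilon>) * (ennreal (mix_post k N a b w g) * indicator {0<..} g)"
      by (auto simp: indicator_def intro!: ennreal_leI simp flip: ennreal_mult)
    have "(1 + g) powr \<epsilon> * mix_post k N a b w g \<le> (1 + g) powr (\<epsilon> - k) * mixing_dens a b g" if "g \<ge> 1 + w"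
    proof -
      have "(1 + g) powr \<epsilon> * mix_post k N a b w g \<le> (1 + g) powr \<epsilon> * ((1 + g) powr (- k) * mixing_dens a b g)"
        using that assms w by (intro mult_left_mono mix_post_le) auto
      then show ?thesis
        by (simp flip: mult.assoc powr_add)
    qed
    then show "ennreal ((1 + g) powr \<epsilon> * mix_post k N a b w g) * indicator {1 + w..} g
      \<le> ennreal ((1 + g) powr (\<epsilon> - k) * mixing_dens a b g) * indicator {1 + w..} g"
      by (auto simp: indicator_def intro!: ennreal_leI)
  qed
  also have "\<dots> \<le> ennreal ((2 * (1 + w)) powr \<epsilon>) * ?I
      + ennreal (2 powr \<bar>b\<bar> * ((1 + (1 + w)) powr (\<epsilon> - k - a - 1) / (a + 1 - (\<epsilon> - k))))"
    using assms w by (intro add_mono nn_integral_mixing_dens_tail_le) (auto simp: nn_integral_cmult nn_integral_lpos)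
  also have "2 powr \<bar>b\<bar> * ((1 + (1 + w)) powr (\<epsilon> - k - a - 1) / (a + 1 - (\<epsilon> - k)))
      \<le> D / c * (1 + w) powr \<epsilon> * (c * (1 + w) powr (- k - a - 1))"
  proof -
    have "2 powr \<bar>b\<bar> * ((1 + (1 + w)) powr (\<epsilon> - k - a - 1) / (a + 1 - (\<epsilon> - k)))
        = D * (1 + (1 + w)) powr (\<epsilon> - k - a - 1)"
      by (simp add: D_def \<beta>_def algebra_simps)
    also have "\<dots> \<le> D * (1 + w) powr (\<epsilon> - k - a - 1)"
      using assms w D by (intro mult_left_mono powr_mono2') auto
    also have "\<dots> = D / c * (1 + w) powr \<epsilon> * (c * (1 + w) powr (- k - a - 1))"
    proof -
      have "\<epsilon> - k - a - 1 = \<epsilon> + (- k - a - 1)" by simp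
      then have "(1 + w) powr (\<epsilon> - k - a - 1) = (1 + w) powr \<epsilon> * (1 + w) powr (- k - a - 1)"
        by (simp only: powr_add)
      then show ?thesis using c by simp
    qed
    finally show ?thesis .
  qed
  also have "ennreal (D / c * (1 + w) powr \<epsilon> * (c * (1 + w) powr (- k - a - 1))) \<le> ennreal (D / c * (1 + w) powr \<epsilon>) * ?I"
    unfolding c_def[symmetric] using D c assms w nn_integral_mix_post_ge[of k N a w b]
    by (subst ennreal_mult) (auto intro!: mult_left_mono simp: c_def)
  also have "ennreal ((2 * (1 + w)) powr \<epsilon>) * ?I + ennreal (D / c * (1 + w) powr \<epsilon>) * ?I = ennreal (C * (1 + w) powr \<epsilon>) * ?I"
  proof -
    have "(2 * (1 + w)) powr \<epsilon> + D / c * (1 + w) powr \<epsilon> = C * (1 + w) powr \<epsilon>"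
      unfolding C_def powr_mult by (simp add: distrib_right)
    then show ?thesis
      using D c by (simp only: flip: distrib_right ennreal_plus) (simp flip: distrib_right ennreal_plus)
  qed
  finally show "(\<integral>\<^sup>+g. ennreal ((1 + g) powr \<epsilon> * mix_post k N a b w g) \<partial>lpos) \<le> ennreal (C * (1 + w) powr \<epsilon>) * ?I"
    by (simp add: ennreal_leI add_left_mono)
qed

lemma nn_integral_ln1_tail:
  assumes "c > 0"
  shows "(\<integral>\<^sup>+g. ennreal (1 / (1 + g) * (1 + ln (1 + g)) powr (- c - 1)) * indicator {1..} g \<partial>lborel)
    \<le> ennreal (1 / c)"
proof -
  have "filterlim (\<lambda>g::real. 1 + g) at_top at_top"
    by (intro filterlim_tendsto_add_at_top[OF tendsto_const] filterlim_ident)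
  from filterlim_tendsto_add_at_top[OF tendsto_const filterlim_compose[OF ln_at_top this]]
  have "filterlim (\<lambda>g::real. 1 + ln (1 + g)) at_top at_top" .
  then have "((\<lambda>g. - ((1 + ln (1 + g)) powr (- c)) / c) \<longlongrightarrow> - 0 / c) at_top"
    using assms by (intro tendsto_intros tendsto_neg_powr) auto
  then have "(\<integral>\<^sup>+g. ennreal (1 / (1 + g) * (1 + ln (1 + g)) powr (- c - 1)) * indicator {1..} g \<partial>lborel)
      = ennreal (0 - (- ((1 + ln (1 + 1)) powr (- c)) / c))"
    using assms
    by (intro nn_integral_FTC_atLeast[where F="\<lambda>g. - ((1 + ln (1 + g)) powr (- c)) / c" and a=1 and T=0])
       (auto intro!: derivative_eq_intros add_pos_nonneg)
  moreover have "(1 + ln 2) powr (- c) \<le> 1"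
    using assms by (intro powr_nonpos_le_one) auto
  ultimately show ?thesis
    using assms by (simp add: divide_right_mono ennreal_leI)
qed

text \<open>The condition \<open>a \<ge> - 2\<close> makes the mixing density bounded for
  \<open>g \<ge> 1\<close>; what remains there is a tail integral in the coordinate
  \<open>ln (1 + g)\<close>, of order \<open>1 / c\<close>. The application takes
  \<open>c = 1 / i\<close>, so the bound grows linearly in \<open>i\<close>.\<close>

lemma nn_integral_mixing_dens_ln_le:
  assumes "a \<ge> - 2" "b > - 1"
  obtains C where "C \<ge> 0" "\<And>c. c > 0 \<Longrightarrow>
    (\<integral>\<^sup>+g. ennreal (mixing_dens a b g / (1 + g) * (1 + ln (1 + g)) powr (- c - 1)) \<partial>lpos)
      \<le> ennreal (C * (1 + 1 / c))"
proof
  define C1 where "C1 = 2 powr (\<bar>a + 2\<bar> + \<bar>b\<bar>) / (b + 1)"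
  define C2 where "C2 = 2 powr \<bar>b\<bar>"
  have C: "C1 \<ge> 0" "C2 \<ge> 0"
    using assms by (auto simp: C1_def C2_def)
  then show "C1 + C2 \<ge> 0" by simp
  fix c :: real assume c: "c > 0"
  let ?f = "\<lambda>g. mixing_dens a b g / (1 + g) * (1 + ln (1 + g)) powr (- c - 1)"
  have "(\<integral>\<^sup>+g. ennreal (?f g) \<partial>lpos)
      = (\<integral>\<^sup>+g. ennreal (?f g) * indicator {0<..<1} g \<partial>lborel) + (\<integral>\<^sup>+g. ennreal (?f g) * indicator {1..} g \<partial>lborel)"
    by (intro nn_integral_lpos_split) auto
  also have "\<dots> \<le> (\<integral>\<^sup>+g. ennreal (mixing_dens a b g) * indicator {0<..<1} g \<partial>lborel)
     + (\<integral>\<^sup>+g. ennreal C2 * (ennreal (1 / (1 + g) * (1 + ln (1 + g)) powr (- c - 1)) * indicator {1..} g) \<partial>lborel)"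
  proof (intro add_mono nn_integral_mono)
    fix g :: real
    have "?f g \<le> mixing_dens a b g" if "g > 0"
    proof -
      have "(1 + ln (1 + g)) powr (- c - 1) \<le> 1"
        using that c by (intro powr_nonpos_le_one) auto
      then have "?f g \<le> mixing_dens a b g / (1 + g) * 1"
        using that by (intro mult_left_mono) auto
      also have "\<dots> \<le> mixing_dens a b g"
        using that by (simp add: field_simps)
      finally show ?thesis .
    qed
    then show "ennreal (?f g) * indicator {0<..<1} g \<le> ennreal (mixing_dens a b g) * indicator {0<..<1} g"
      by (auto simp: indicator_def intro!: ennreal_leI)
    have "?f g \<le> C2 * (1 / (1 + g) * (1 + ln (1 + g)) powr (- c - 1))" if "g \<ge> 1"
    proof -
      have "mixing_dens a b g \<le> C2 * (1 + g) powr (- a - 2)"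
        unfolding C2_def using that by (rule mixing_dens_bounds_away_0)
      also have "\<dots> \<le> C2 * 1"
        using that assms C by (intro mult_left_mono powr_nonpos_le_one) auto
      finally have "mixing_dens a b g * (1 / (1 + g) * (1 + ln (1 + g)) powr (- c - 1))
          \<le> C2 * (1 / (1 + g) * (1 + ln (1 + g)) powr (- c - 1))"
        using that by (intro mult_right_mono) auto
      then show ?thesis by simp
    qed
    then show "ennreal (?f g) * indicator {1..} g
       \<le> ennreal C2 * (ennreal (1 / (1 + g) * (1 + ln (1 + g)) powr (- c - 1)) * indicator {1..} g)"
      using C by (auto simp: indicator_def intro!: ennreal_leI simp flip: ennreal_mult)
  qed
  also have "\<dots> \<le> ennreal C1 + ennreal C2 * ennreal (1 / c)"
    using nn_integral_mixing_dens_head_le[OF assms(2), of a] nn_integral_ln1_tail[OF c]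
    by (subst nn_integral_cmult) (auto intro!: add_mono mult_left_mono simp: C1_def)
  also have "\<dots> = ennreal (C1 + C2 * (1 / c))"
    using C c by (simp flip: ennreal_mult ennreal_plus)
  also have "\<dots> \<le> ennreal ((C1 + C2) * (1 + 1 / c))"
    using C c by (intro ennreal_leI) (simp add: algebra_simps add_divide_distrib)
  finally show "(\<integral>\<^sup>+g. ennreal (?f g) \<partial>lpos) \<le> ennreal ((C1 + C2) * (1 + 1 / c))" .
qed

text \<open>A logarithmic cutoff: in the plane its Dirichlet energy has order \<open>1 / i\<close>,
  whereas cutoffs that are linear in \<open>r\<close> have energy bounded away from
  \<open>0\<close>. Here \<open>r\<close> is itself logarithmic in \<open>g\<close> and
  \<open>\<eta>\<close>.\<close>

definition cutoff :: "real \<Rightarrow> real \<Rightarrow> real" where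
  "cutoff i r = max 0 (1 - ln (1 + r) / i)"

lemma cutoff_nonneg: "0 \<le> cutoff i r"
  by (simp add: cutoff_def)

lemma cutoff_le_1: "r \<ge> 0 \<Longrightarrow> i > 0 \<Longrightarrow> cutoff i r \<le> 1"
  by (simp add: cutoff_def)

lemma cutoff_mono: "0 < i \<Longrightarrow> i \<le> j \<Longrightarrow> r \<ge> 0 \<Longrightarrow> cutoff i r \<le> cutoff j r"
  by (simp add: cutoff_def max.coboundedI2 frac_le)

lemma cutoff_eq_0: "i > 0 \<Longrightarrow> r \<ge> exp i \<Longrightarrow> cutoff i r = 0"
proof -
  assume i: "i > 0" and r: "r \<ge> exp i"
  have "1 + r > 0"
    using r exp_gt_zero[of i] by linarith
  then have "i \<le> ln (1 + r)"
    using r by (subst ln_ge_iff) auto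
  then show ?thesis
    using i by (simp add: cutoff_def)
qed

lemma measurable_cutoff [measurable (raw)]:
  assumes [measurable]: "f \<in> borel_measurable M"
  shows "(\<lambda>x. cutoff i (f x)) \<in> borel_measurable M"
  unfolding cutoff_def by measurable

text \<open>The factor \<open>(1 + r) powr (- 2 - 1 / i)\<close> makes the right-hand side integrable over the plane
  with an integral of order \<open>1 / i\<close> for fixed \<open>d\<close>.\<close>

lemma cutoff_diff_sq_le:
  assumes "i \<ge> 1" "r \<ge> 0" "r' \<ge> 0"
  defines "d \<equiv> \<bar>r - r'\<bar>"
  shows "(cutoff i r - cutoff i r')\<^sup>2 \<le> exp 1 / i\<^sup>2 * (1 + d) ^ 5 * (1 + r) powr (- 2 - 1 / i)"
proof -
  have d: "d \<ge> 0" by (simp add: d_def)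
  \<comment> \<open>Two bounds on the same difference: this one limits how far outside the support
    \<open>r\<close> can lie, while \<open>D\<close> supplies the decay
    \<open>1 / (1 + r)\<close>.\<close>
  have lnd: "\<bar>ln (1 + r) - ln (1 + r')\<bar> \<le> ln (1 + d)"
  proof -
    have "1 + r \<le> (1 + r') * (1 + d)" "1 + r' \<le> (1 + r) * (1 + d)"
    proof -
      have "0 \<le> r' * d" "0 \<le> r * d" "r \<le> r' + d" "r' \<le> r + d"
        using assms(2,3) by (auto simp: d_def)
      then show "1 + r \<le> (1 + r') * (1 + d)" "1 + r' \<le> (1 + r) * (1 + d)"
        by (simp_all add: algebra_simps)
    qed
    then have "ln (1 + r) \<le> ln ((1 + r') * (1 + d))" "ln (1 + r') \<le> ln ((1 + r) * (1 + d))"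
      using assms d by (auto intro!: ln_mono)
    then show ?thesis
      using assms(2,3) d by (auto simp: ln_mult abs_le_iff)
  qed
  have D: "\<bar>ln (1 + r) - ln (1 + r')\<bar> \<le> (1 + d)\<^sup>2 / (1 + r)"
  proof (cases "r \<le> r'")
    case True
    then have "\<bar>ln (1 + r) - ln (1 + r')\<bar> = ln ((1 + r') / (1 + r))"
      using assms by (simp add: ln_div)
    also have "\<dots> \<le> (1 + r') / (1 + r) - 1"
      using assms by (intro ln_le_minus_one) auto
    also have "\<dots> = d / (1 + r)"
      using assms True by (simp add: d_def field_simps)
    also have "\<dots> \<le> (1 + d)\<^sup>2 / (1 + r)"
    proof -
      have "d \<le> (1 + d)\<^sup>2"
        using d by (simp add: power2_eq_square algebra_simps)
      then show ?thesis
        using assms(2) by (intro divide_right_mono) auto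
    qed
    finally show ?thesis .
  next
    case False
    then have "\<bar>ln (1 + r) - ln (1 + r')\<bar> = ln ((1 + r) / (1 + r'))"
      using assms by (simp add: ln_div)
    also have "\<dots> \<le> (1 + r) / (1 + r') - 1"
      using assms by (intro ln_le_minus_one) auto
    also have "\<dots> = d / (1 + r')"
      using assms False by (simp add: d_def field_simps)
    \<comment> \<open>Since \<open>r = r' + d\<close>, moving the denominator from
      \<open>1 + r'\<close> to \<open>1 + r\<close> costs a factor \<open>1 + d\<close>.\<close>
    also have "\<dots> \<le> (1 + d)\<^sup>2 / (1 + r)"
    proof -
      have "d * (1 + r) = d * (1 + d) + d * r'"
        using False by (simp add: d_def algebra_simps)
      also have "\<dots> \<le> (1 + d)\<^sup>2 * (1 + r')"
        using d assms(3) by (simp add: power2_eq_square algebra_simps add_nonneg_nonneg)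
      finally show ?thesis
        using assms by (simp add: field_simps)
    qed
    finally show ?thesis .
  qed
  have lip: "\<bar>cutoff i r - cutoff i r'\<bar> \<le> (1 + d)\<^sup>2 / (1 + r) / i"
  proof -
    have "\<bar>cutoff i r - cutoff i r'\<bar> \<le> \<bar>(ln (1 + r) - ln (1 + r')) / i\<bar>"
      unfolding cutoff_def diff_divide_distrib by linarith
    also have "\<dots> = \<bar>ln (1 + r) - ln (1 + r')\<bar> / i"
      using assms by simp
    also have "\<dots> \<le> (1 + d)\<^sup>2 / (1 + r) / i"
      using assms D by (intro divide_right_mono) auto
    finally show ?thesis .
  qed
  show ?thesis
  proof (cases "cutoff i r = 0 \<and> cutoff i r' = 0")
    case True
    then show ?thesis using d by simp
  next
    case False
    have "ln (1 + r) \<le> i + ln (1 + d)"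
    proof -
      have "ln (1 + r) \<le> i \<or> ln (1 + r') \<le> i"
        using False assms by (auto simp: cutoff_def max_def field_simps split: if_splits)
      moreover have "0 \<le> ln (1 + d)" using d by simp
      ultimately show ?thesis using lnd by linarith
    qed
    also have "\<dots> \<le> i * (1 + ln (1 + d))"
      using assms d mult_right_mono[of 1 i "ln (1 + d)"] by (simp add: algebra_simps)
    finally have "ln (1 + r) / i \<le> 1 + ln (1 + d)"
      using assms by (simp add: divide_le_eq mult.commute)
    then have "exp (ln (1 + r) / i) \<le> exp (1 + ln (1 + d))"
      by simp
    \<comment> \<open>If one of the two cutoffs is nonzero, \<open>(1 + r) powr (1 / i)\<close> is
      at most \<open>exp 1 * (1 + d)\<close>. Multiplying the squared Lipschitz bound by this
      quantity, which is at least \<open>1\<close>, produces the extra decay of exponent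
      \<open>- 1 / i\<close>, the factor \<open>exp 1\<close> and the fifth power of
      \<open>1 + d\<close>.\<close>
    then have P: "1 \<le> exp 1 * (1 + d) * (1 + r) powr (- (1 / i))"
      using assms d by (simp add: exp_add powr_def exp_minus field_simps)
    have "(cutoff i r - cutoff i r')\<^sup>2 \<le> ((1 + d)\<^sup>2 / (1 + r) / i)\<^sup>2"
      using lip by (metis abs_ge_zero power2_abs power_mono)
    also have "\<dots> = (1 + d) ^ 4 * (1 + r) powr (- 2) / i\<^sup>2 * 1"
      using assms by (simp add: power_divide powr_minus powr_realpow divide_inverse power_mult_distrib power_inverse flip: power_mult)
    also have "\<dots> \<le> (1 + d) ^ 4 * (1 + r) powr (- 2) / i\<^sup>2 * (exp 1 * (1 + d) * (1 + r) powr (- (1 / i)))"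
      using P assms by (intro mult_left_mono) auto
    also have "\<dots> = exp 1 / i\<^sup>2 * (1 + d) ^ 5 * ((1 + r) powr (- 2) * (1 + r) powr (- (1 / i)))"
      by (simp add: eval_nat_numeral)
    also have "(1 + r) powr (- 2) * (1 + r) powr (- (1 / i)) = (1 + r) powr (- 2 - 1 / i)"
      by (simp flip: powr_add)
    finally show ?thesis .
  qed
qed

text \<open>The inequality \<open>t \<le> exp t\<close> at
  \<open>t = \<epsilon> * (1 + d) / 5\<close>, raised to the fifth power. The rate
  \<open>\<epsilon>\<close> may be arbitrarily small, as it must be: only small exponential moments
  of the distance are available.\<close>

lemma power5_le_exp:
  fixes \<epsilon> d :: real
  assumes "\<epsilon> > 0" "d \<ge> 0"
  shows "(1 + d) ^ 5 \<le> (5 / \<epsilon>) ^ 5 * exp \<epsilon> * exp (\<epsilon> * d)"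
proof -
  have "\<epsilon> * (1 + d) / 5 \<le> exp (\<epsilon> * (1 + d) / 5)"
    using exp_ge_add_one_self[of "\<epsilon> * (1 + d) / 5"] by linarith
  then have "(\<epsilon> * (1 + d) / 5) ^ 5 \<le> exp (\<epsilon> * (1 + d) / 5) ^ 5"
    using assms by (intro power_mono) auto
  also have "\<dots> = exp \<epsilon> * exp (\<epsilon> * d)"
    by (simp add: distrib_left flip: exp_of_nat_mult exp_add)
  finally have "(5 / \<epsilon>) ^ 5 * (\<epsilon> * (1 + d) / 5) ^ 5 \<le> (5 / \<epsilon>) ^ 5 * (exp \<epsilon> * exp (\<epsilon> * d))"
    using assms by (intro mult_left_mono) auto
  moreover have "(5 / \<epsilon>) ^ 5 * (\<epsilon> * (1 + d) / 5) ^ 5 = (1 + d) ^ 5"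
  proof -
    have "5 / \<epsilon> * (\<epsilon> * (1 + d) / 5) = 1 + d"
      using assms by simp
    then show ?thesis
      by (simp only: flip: power_mult_distrib)
  qed
  ultimately show ?thesis
    by (simp add: mult.assoc)
qed

subsection \<open>Comparison of quadratic risks\<close>

text \<open>Replacing the weights \<open>\<kappa>\<^sup>2\<close> by \<open>1\<close> moves the mean of \<open>\<nu>\<close> to \<open>E\<close>; a quadratic risk then
  pays at most the last term, a Dirichlet form. This integrates, over two independent copies \<open>p\<close> and
  \<open>q\<close>, the square of \<open>((\<kappa> p + \<kappa> q) / 2) *\<^sub>R A + (2 * (\<nu> p - \<nu> q) * (\<kappa> p - \<kappa> q)) *\<^sub>R x\<close>.\<close>

lemma (in finite_measure) weighted_risk_comparison:
  fixes \<nu> \<kappa> :: "'a \<Rightarrow> real" and A x :: "'v::real_inner"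
  assumes [measurable]: "\<nu> \<in> borel_measurable M" "\<kappa> \<in> borel_measurable M"
    and \<nu>: "\<And>p. p \<in> space M \<Longrightarrow> 0 \<le> \<nu> p \<and> \<nu> p \<le> 1"
    and \<kappa>: "\<And>p. p \<in> space M \<Longrightarrow> 0 \<le> \<kappa> p \<and> \<kappa> p \<le> 1"
    and m: "m = measure M (space M)" "m > 0"
    and E: "E = (LINT p|M. \<nu> p) / m"
  shows "ennreal ((norm A)\<^sup>2 / 2) * (\<integral>\<^sup>+p. ennreal ((\<kappa> p)\<^sup>2) \<partial>M)
      + (\<integral>\<^sup>+p. ennreal ((norm ((\<nu> p - E) *\<^sub>R x))\<^sup>2 * (\<kappa> p)\<^sup>2) \<partial>M)
    \<le> (\<integral>\<^sup>+p. ennreal ((norm (A + (\<nu> p - E) *\<^sub>R x))\<^sup>2 * (\<kappa> p)\<^sup>2) \<partial>M)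
      + ennreal (2 * (norm x)\<^sup>2 / m)
        * (\<integral>\<^sup>+q. \<integral>\<^sup>+p. ennreal ((\<nu> p - \<nu> q)\<^sup>2 * (\<kappa> p - \<kappa> q)\<^sup>2) \<partial>M \<partial>M)"
proof -
  have bnd: "integrable M f" if "f \<in> borel_measurable M" "\<And>p. p \<in> space M \<Longrightarrow> \<bar>f p\<bar> \<le> B"
    for f :: "'a \<Rightarrow> real" and B
    using that by (intro integrable_const_bound[of f B] AE_I2) auto
  have \<kappa>2: "0 \<le> (\<kappa> p)\<^sup>2 \<and> (\<kappa> p)\<^sup>2 \<le> 1" if "p \<in> space M" for p
    using \<kappa>[OF that] by (simp add: power_le_one)
  have i1: "integrable M \<nu>"
    using \<nu> by (intro bnd[of _ 1]) auto
  have i2: "integrable M (\<lambda>p. (\<kappa> p)\<^sup>2)"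
    using \<kappa>2 by (intro bnd[of _ 1]) auto
  have i3: "integrable M (\<lambda>p. \<nu> p * (\<kappa> p)\<^sup>2)"
    using \<kappa>2 \<nu> by (intro bnd[of _ 1]) (auto simp: abs_mult intro: mult_le_one)
  have i4: "integrable M (\<lambda>p. (\<nu> p - E)\<^sup>2 * (\<kappa> p)\<^sup>2)"
  proof (rule bnd[of _ "(1 + \<bar>E\<bar>)\<^sup>2"])
    fix p assume p: "p \<in> space M"
    have "(\<nu> p - E)\<^sup>2 \<le> (1 + \<bar>E\<bar>)\<^sup>2"
      using \<nu>[OF p] by (intro power2_le_iff_abs_le[THEN iffD2]) auto
    then have "(\<nu> p - E)\<^sup>2 * (\<kappa> p)\<^sup>2 \<le> (1 + \<bar>E\<bar>)\<^sup>2 * 1"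
      using \<kappa>2[OF p] by (intro mult_mono) auto
    then show "\<bar>(\<nu> p - E)\<^sup>2 * (\<kappa> p)\<^sup>2\<bar> \<le> (1 + \<bar>E\<bar>)\<^sup>2"
      by simp
  qed simp
  define D where "D p q = (\<nu> p - \<nu> q)\<^sup>2 * (\<kappa> p - \<kappa> q)\<^sup>2" for p q
  have D01: "0 \<le> D p q \<and> D p q \<le> 1" if "p \<in> space M" "q \<in> space M" for p q
  proof -
    have "\<bar>\<nu> p - \<nu> q\<bar> \<le> 1" "\<bar>\<kappa> p - \<kappa> q\<bar> \<le> 1"
      using \<nu>[OF that(1)] \<nu>[OF that(2)] \<kappa>[OF that(1)] \<kappa>[OF that(2)] by auto
    then have "(\<nu> p - \<nu> q)\<^sup>2 \<le> 1" "(\<kappa> p - \<kappa> q)\<^sup>2 \<le> 1"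
      by (simp_all add: abs_square_le_1)
    then show ?thesis
      by (auto simp: D_def intro: mult_le_one)
  qed
  have D_meas [measurable]: "(\<lambda>(q, p). D p q) \<in> borel_measurable (M \<Otimes>\<^sub>M M)"
    unfolding D_def by measurable
  have iD: "integrable M (\<lambda>p. D p q)" if "q \<in> space M" for q
    using D01 that by (intro bnd[of _ 1]) (auto simp: D_def)
  define Z1 where "Z1 q = (LINT p|M. D p q)" for q
  have Z1_meas [measurable]: "Z1 \<in> borel_measurable M"
    unfolding Z1_def by measurable
  have Z1_nonneg: "0 \<le> Z1 q" for q
    unfolding Z1_def D_def by (intro integral_nonneg_AE) auto
  have iZ: "integrable M Z1"
  proof (rule bnd[of _ m])
    fix q assume q: "q \<in> space M"
    have "Z1 q \<le> (LINT p|M. 1)"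
      unfolding Z1_def using D01 q iD[OF q] by (intro integral_mono) auto
    then show "\<bar>Z1 q\<bar> \<le> m"
      using Z1_nonneg[of q] m by simp
  qed simp
  define K where "K = (LINT p|M. (\<kappa> p)\<^sup>2)"
  define I where "I = (LINT p|M. \<nu> p)"
  define J where "J = (LINT p|M. \<nu> p * (\<kappa> p)\<^sup>2)"
  define L where "L = (LINT p|M. (\<nu> p - E)\<^sup>2 * (\<kappa> p)\<^sup>2)"
  define Z where "Z = (LINT q|M. Z1 q)"
  have norm_lin: "(norm (c *\<^sub>R A + d *\<^sub>R x))\<^sup>2 = c\<^sup>2 * (norm A)\<^sup>2 + 2 * (c * d) * (A \<bullet> x) + d\<^sup>2 * (norm x)\<^sup>2" for c d
    unfolding power2_norm_eq_inner
    by (simp add: inner_add_left inner_add_right inner_commute[of x A] power2_eq_square algebra_simps)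
  \<comment> \<open>The cross term is written out as a sum of products of a function of
    \<open>p\<close> and a function of \<open>q\<close>, so that both integrations are termwise and
    produce \<open>m\<close>, \<open>K\<close>, \<open>I\<close> and \<open>J\<close>.\<close>
  have pq: "0 \<le> ((\<kappa> p)\<^sup>2 + (\<kappa> q)\<^sup>2) * ((norm A)\<^sup>2 / 2)
      + (\<nu> p * (\<kappa> p)\<^sup>2 - \<kappa> q ^ 2 * \<nu> p - \<nu> q * (\<kappa> p)\<^sup>2 + \<nu> q * (\<kappa> q)\<^sup>2) * (2 * (A \<bullet> x)) + D p q * (4 * (norm x)\<^sup>2)" for p q
  proof -
    have "0 \<le> (norm (((\<kappa> p + \<kappa> q) / 2) *\<^sub>R A + (2 * (\<nu> p - \<nu> q) * (\<kappa> p - \<kappa> q)) *\<^sub>R x))\<^sup>2"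
      by simp
    also have "\<dots> = ((\<kappa> p + \<kappa> q) / 2)\<^sup>2 * (norm A)\<^sup>2
      + 2 * (((\<kappa> p + \<kappa> q) / 2) * (2 * (\<nu> p - \<nu> q) * (\<kappa> p - \<kappa> q))) * (A \<bullet> x)
      + (2 * (\<nu> p - \<nu> q) * (\<kappa> p - \<kappa> q))\<^sup>2 * (norm x)\<^sup>2"
      by (rule norm_lin)
    \<comment> \<open>Convexity. After integration this pays for the cross term with half of
      \<open>(norm A)\<^sup>2 * K\<close>; the other half remains in the conclusion.\<close>
    also have "((\<kappa> p + \<kappa> q) / 2)\<^sup>2 * (norm A)\<^sup>2 \<le> ((\<kappa> p)\<^sup>2 + (\<kappa> q)\<^sup>2) * ((norm A)\<^sup>2 / 2)"
    proof -
      have "((\<kappa> p + \<kappa> q) / 2)\<^sup>2 \<le> ((\<kappa> p)\<^sup>2 + (\<kappa> q)\<^sup>2) / 2"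
        using zero_le_power2[of "\<kappa> p - \<kappa> q"] by (simp add: power2_eq_square algebra_simps)
      from mult_right_mono[OF this, of "(norm A)\<^sup>2"] show ?thesis by simp
    qed
    also have "2 * (((\<kappa> p + \<kappa> q) / 2) * (2 * (\<nu> p - \<nu> q) * (\<kappa> p - \<kappa> q))) * (A \<bullet> x)
        = (\<nu> p * (\<kappa> p)\<^sup>2 - \<kappa> q ^ 2 * \<nu> p - \<nu> q * (\<kappa> p)\<^sup>2 + \<nu> q * (\<kappa> q)\<^sup>2) * (2 * (A \<bullet> x))"
    proof -
      have "((\<kappa> p + \<kappa> q) / 2) * (2 * (\<nu> p - \<nu> q) * (\<kappa> p - \<kappa> q))
          = (\<nu> p - \<nu> q) * ((\<kappa> p + \<kappa> q) * (\<kappa> p - \<kappa> q))"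
        by (simp add: field_simps)
      also have "\<dots> = \<nu> p * (\<kappa> p)\<^sup>2 - \<kappa> q ^ 2 * \<nu> p - \<nu> q * (\<kappa> p)\<^sup>2 + \<nu> q * (\<kappa> q)\<^sup>2"
        by (simp add: power2_eq_square algebra_simps)
      finally show ?thesis by simp
    qed
    also have "(2 * (\<nu> p - \<nu> q) * (\<kappa> p - \<kappa> q))\<^sup>2 * (norm x)\<^sup>2 = D p q * (4 * (norm x)\<^sup>2)"
      unfolding D_def power_mult_distrib by simp
    finally show ?thesis by this simp
  qed
  have q: "0 \<le> (K + m * (\<kappa> q)\<^sup>2) * ((norm A)\<^sup>2 / 2)
      + (J - \<kappa> q ^ 2 * I - \<nu> q * K + m * (\<nu> q * (\<kappa> q)\<^sup>2)) * (2 * (A \<bullet> x)) + Z1 q * (4 * (norm x)\<^sup>2)"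
    if "q \<in> space M" for q
  proof -
    have "0 \<le> (LINT p|M. ((\<kappa> p)\<^sup>2 + (\<kappa> q)\<^sup>2) * ((norm A)\<^sup>2 / 2)
      + (\<nu> p * (\<kappa> p)\<^sup>2 - \<kappa> q ^ 2 * \<nu> p - \<nu> q * (\<kappa> p)\<^sup>2 + \<nu> q * (\<kappa> q)\<^sup>2) * (2 * (A \<bullet> x)) + D p q * (4 * (norm x)\<^sup>2))"
      by (intro integral_nonneg_AE AE_I2 pq)
    also have "\<dots> = (K + m * (\<kappa> q)\<^sup>2) * ((norm A)\<^sup>2 / 2)
      + (J - \<kappa> q ^ 2 * I - \<nu> q * K + m * (\<nu> q * (\<kappa> q)\<^sup>2)) * (2 * (A \<bullet> x)) + Z1 q * (4 * (norm x)\<^sup>2)"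
      using i1 i2 i3 iD[OF that] by (simp add: K_def J_def I_def Z1_def m)
    finally show ?thesis .
  qed
  have "0 \<le> (LINT q|M. (K + m * (\<kappa> q)\<^sup>2) * ((norm A)\<^sup>2 / 2)
      + (J - \<kappa> q ^ 2 * I - \<nu> q * K + m * (\<nu> q * (\<kappa> q)\<^sup>2)) * (2 * (A \<bullet> x)) + Z1 q * (4 * (norm x)\<^sup>2))"
    by (intro integral_nonneg_AE AE_I2 q)
  also have "\<dots> = (m * K + m * K) * ((norm A)\<^sup>2 / 2)
      + (m * J - K * I - I * K + m * J) * (2 * (A \<bullet> x)) + Z * (4 * (norm x)\<^sup>2)"
    using i1 i2 i3 iZ by (simp add: K_def[symmetric] J_def[symmetric] I_def[symmetric] Z_def m(1)[symmetric])
  \<comment> \<open>Since \<open>I = E * m\<close>, the coefficient of the cross term is a multiple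
    of \<open>J - E * K\<close>, the unnormalized covariance of \<open>\<nu>\<close> and
    \<open>\<kappa>\<^sup>2\<close>.\<close>
  also have "\<dots> = 2 * m * ((norm A)\<^sup>2 / 2 * K + 2 * (J - E * K) * (A \<bullet> x) + 2 * (norm x)\<^sup>2 / m * Z)"
  proof -
    have "I = E * m"
      using m by (simp add: E I_def)
    then show ?thesis
      using m(2) by (simp add: field_simps)
  qed
  finally have main: "0 \<le> (norm A)\<^sup>2 / 2 * K + 2 * (J - E * K) * (A \<bullet> x) + 2 * (norm x)\<^sup>2 / m * Z"
    using m(2) by (simp add: zero_le_mult_iff)
  have expand: "(norm (A + (\<nu> p - E) *\<^sub>R x))\<^sup>2 * (\<kappa> p)\<^sup>2
      = (norm A)\<^sup>2 * (\<kappa> p)\<^sup>2 + 2 * (A \<bullet> x) * (\<nu> p * (\<kappa> p)\<^sup>2 - E * (\<kappa> p)\<^sup>2) + (norm x)\<^sup>2 * ((\<nu> p - E)\<^sup>2 * (\<kappa> p)\<^sup>2)" for p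
    unfolding power2_norm_eq_inner
    by (simp add: inner_add_left inner_add_right inner_commute[of x A] power2_eq_square algebra_simps)
  have iE: "integrable M (\<lambda>p. (norm (A + (\<nu> p - E) *\<^sub>R x))\<^sup>2 * (\<kappa> p)\<^sup>2)"
    unfolding expand using i2 i3 i4 by simp
  have r1: "(\<integral>\<^sup>+p. ennreal ((\<kappa> p)\<^sup>2) \<partial>M) = ennreal K"
    unfolding K_def using i2 by (intro nn_integral_eq_integral) auto
  have r2: "(\<integral>\<^sup>+p. ennreal ((norm ((\<nu> p - E) *\<^sub>R x))\<^sup>2 * (\<kappa> p)\<^sup>2) \<partial>M) = ennreal ((norm x)\<^sup>2 * L)"
  proof -
    have "(\<integral>\<^sup>+p. ennreal ((norm ((\<nu> p - E) *\<^sub>R x))\<^sup>2 * (\<kappa> p)\<^sup>2) \<partial>M)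
        = (\<integral>\<^sup>+p. ennreal ((norm x)\<^sup>2 * ((\<nu> p - E)\<^sup>2 * (\<kappa> p)\<^sup>2)) \<partial>M)"
      by (simp add: power_mult_distrib mult_ac)
    also have "\<dots> = ennreal (LINT p|M. (norm x)\<^sup>2 * ((\<nu> p - E)\<^sup>2 * (\<kappa> p)\<^sup>2))"
      using i4 by (intro nn_integral_eq_integral) auto
    finally show ?thesis
      using i4 by (simp add: L_def)
  qed
  have r3: "(\<integral>\<^sup>+p. ennreal ((norm (A + (\<nu> p - E) *\<^sub>R x))\<^sup>2 * (\<kappa> p)\<^sup>2) \<partial>M)
      = ennreal ((norm A)\<^sup>2 * K + 2 * (A \<bullet> x) * (J - E * K) + (norm x)\<^sup>2 * L)"
  proof -
    have "(\<integral>\<^sup>+p. ennreal ((norm (A + (\<nu> p - E) *\<^sub>R x))\<^sup>2 * (\<kappa> p)\<^sup>2) \<partial>M)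
        = ennreal (LINT p|M. (norm (A + (\<nu> p - E) *\<^sub>R x))\<^sup>2 * (\<kappa> p)\<^sup>2)"
      using iE by (intro nn_integral_eq_integral) auto
    then show ?thesis
      unfolding expand using i2 i3 i4 by (simp add: K_def J_def L_def)
  qed
  have r4: "(\<integral>\<^sup>+q. \<integral>\<^sup>+p. ennreal (D p q) \<partial>M \<partial>M) = ennreal Z"
  proof -
    have "(\<integral>\<^sup>+q. \<integral>\<^sup>+p. ennreal (D p q) \<partial>M \<partial>M) = (\<integral>\<^sup>+q. ennreal (Z1 q) \<partial>M)"
      unfolding Z1_def by (intro nn_integral_cong nn_integral_eq_integral iD AE_I2) (simp_all add: D_def)
    then show ?thesis
      unfolding Z_def using iZ Z1_nonneg by (subst (asm) nn_integral_eq_integral) auto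
  qed
  have nonneg: "0 \<le> K" "0 \<le> L" "0 \<le> Z"
    unfolding K_def L_def Z_def using Z1_nonneg by (auto intro!: integral_nonneg_AE)
  have r3_nonneg: "0 \<le> (norm A)\<^sup>2 * K + 2 * (A \<bullet> x) * (J - E * K) + (norm x)\<^sup>2 * L"
  proof -
    have "0 \<le> (LINT p|M. (norm (A + (\<nu> p - E) *\<^sub>R x))\<^sup>2 * (\<kappa> p)\<^sup>2)"
      by (intro integral_nonneg_AE) auto
    then show ?thesis
      unfolding expand using i2 i3 i4 by (simp add: K_def J_def L_def)
  qed
  have "(norm A)\<^sup>2 / 2 * K + (norm x)\<^sup>2 * L
      \<le> ((norm A)\<^sup>2 * K + 2 * (A \<bullet> x) * (J - E * K) + (norm x)\<^sup>2 * L) + 2 * (norm x)\<^sup>2 / m * Z"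
    using main by (simp add: algebra_simps)
  then have "ennreal ((norm A)\<^sup>2 / 2 * K + (norm x)\<^sup>2 * L)
      \<le> ennreal (((norm A)\<^sup>2 * K + 2 * (A \<bullet> x) * (J - E * K) + (norm x)\<^sup>2 * L) + 2 * (norm x)\<^sup>2 / m * Z)"
    by (rule ennreal_leI)
  also have "\<dots> = ennreal ((norm A)\<^sup>2 * K + 2 * (A \<bullet> x) * (J - E * K) + (norm x)\<^sup>2 * L) + ennreal (2 * (norm x)\<^sup>2 / m) * ennreal Z"
    using r3_nonneg nonneg m(2) by (subst ennreal_plus) (auto simp: ennreal_mult[symmetric])
  also have "ennreal ((norm A)\<^sup>2 / 2 * K + (norm x)\<^sup>2 * L) = ennreal ((norm A)\<^sup>2 / 2) * ennreal K + ennreal ((norm x)\<^sup>2 * L)"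
  proof -
    have "ennreal ((norm A)\<^sup>2 / 2 * K) = ennreal ((norm A)\<^sup>2 / 2) * ennreal K"
      using nonneg by (intro ennreal_mult) auto
    then show ?thesis
      using nonneg by (subst ennreal_plus) simp_all
  qed
  finally show ?thesis
    unfolding r1 r2 r3 r4[unfolded D_def] .
qed

subsection \<open>Posterior given an observation\<close>

lemma measurable_dens_S [measurable (raw)]:
  assumes [measurable]: "f \<in> borel_measurable M" "h \<in> borel_measurable M"
  shows "(\<lambda>w. dens_S n (f w) (h w)) \<in> borel_measurable M"
  unfolding dens_S_def by measurable

lemma dens_S_nonneg: "n \<ge> 1 \<Longrightarrow> 0 \<le> dens_S n \<eta> s"
  by (simp add: dens_S_def Gamma_real_pos less_imp_le)

lemma dens_S_pos: "n \<ge> 1 \<Longrightarrow> \<eta> > 0 \<Longrightarrow> s > 0 \<Longrightarrow> 0 < dens_S n \<eta> s"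
  by (simp add: dens_S_def Gamma_real_pos)

text \<open>A hyperparameter is a pair \<open>(g, \<eta>)\<close>; given it, \<open>\<theta>\<close> is normal with covariance \<open>g / \<eta>\<close>.
  The factor \<open>1 / \<eta>\<close> of the prior cancels against the factor \<open>\<eta>\<close> of the loss.\<close>

locale shrinkage_prior =
  fixes n :: nat and a b :: real and dim :: "'p::finite itself"
  assumes n: "n \<ge> 1" and a: "a \<ge> - 2" and b: "b > - 1"
    and pa: "real CARD('p) / 2 + a + 1 > 0"
begin

definition half_p :: real where "half_p = real CARD('p) / 2"

definition shape :: real where "shape = real CARD('p) / 2 + real n / 2 + 1"

text \<open>The parameter \<open>\<theta>\<close> is already integrated out: given
  \<open>(g, \<eta>)\<close> the marginal precision of \<open>x\<close> is
  \<open>\<eta> / (1 + g)\<close>. At a fixed observation this is the unnormalized posterior density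
  of the hyperparameter.\<close>

definition joint :: "real ^ 'p \<Rightarrow> real \<Rightarrow> real \<Rightarrow> real \<Rightarrow> real" where
  "joint x s g \<eta> = mixing_dens a b g * dens_X 0 (\<eta> / (1 + g)) x * dens_S n \<eta> s"

text \<open>The \<open>l1\<close> distance from the origin in the half-plane with coordinates
  \<open>ln (1 + g)\<close> and \<open>ln \<eta>\<close>. With this norm the integral over
  \<open>\<eta>\<close> for fixed \<open>g\<close> is a one-dimensional power integral.\<close>

definition radius :: "real \<Rightarrow> real \<Rightarrow> real" where
  "radius g \<eta> = ln (1 + g) + \<bar>ln \<eta>\<bar>"

abbreviation decay :: "real \<Rightarrow> real \<Rightarrow> real \<Rightarrow> real" where
  "decay i g \<eta> \<equiv> (1 + radius g \<eta>) powr (- 2 - 1 / i)"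

definition hyper_cutoff :: "real \<Rightarrow> real \<Rightarrow> real \<Rightarrow> real" where
  "hyper_cutoff i g \<eta> = cutoff i (radius g \<eta>)"

definition mass :: "real ^ 'p \<Rightarrow> real \<Rightarrow> ennreal" where
  "mass x s = (\<integral>\<^sup>+g. \<integral>\<^sup>+\<eta>. ennreal (joint x s g \<eta>) \<partial>lpos \<partial>lpos)"

text \<open>Given \<open>g\<close> and the observation, \<open>\<eta>\<close> has under
  \<open>joint\<close> a Gamma distribution with shape \<open>shape\<close> and rate
  \<open>rate x s g / 2\<close>.\<close>

definition rate :: "real ^ 'p \<Rightarrow> real \<Rightarrow> real \<Rightarrow> real" where
  "rate x s g = s + (norm x)\<^sup>2 / (1 + g)"

abbreviation post_g :: "real ^ 'p \<Rightarrow> real \<Rightarrow> real \<Rightarrow> real" where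
  "post_g x s g \<equiv> mix_post half_p shape a b ((norm x)\<^sup>2 / s) g"

lemma half_p_nonneg: "half_p \<ge> 0" and shape_ge: "shape \<ge> 3 / 2"
  using n by (auto simp: half_p_def shape_def)

lemma joint_nonneg [simp]: "0 \<le> joint x s g \<eta>"
  using dens_S_nonneg[OF n] by (simp add: joint_def)

lemma joint_pos: "s > 0 \<Longrightarrow> g > 0 \<Longrightarrow> \<eta> > 0 \<Longrightarrow> 0 < joint x s g \<eta>"
  by (simp add: joint_def mixing_dens_pos dens_X_pos dens_S_pos[OF n])

lemma radius_nonneg: "g > 0 \<Longrightarrow> radius g \<eta> \<ge> 0"
  by (simp add: radius_def)

lemma measurable_joint [measurable (raw)]:
  assumes [measurable]: "f1 \<in> borel_measurable M" "f2 \<in> borel_measurable M"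
    "f3 \<in> borel_measurable M" "f4 \<in> borel_measurable M"
  shows "(\<lambda>w. joint (f1 w) (f2 w) (f3 w) (f4 w)) \<in> borel_measurable M"
  unfolding joint_def by measurable

lemma measurable_radius [measurable (raw)]:
  assumes [measurable]: "f1 \<in> borel_measurable M" "f2 \<in> borel_measurable M"
  shows "(\<lambda>w. radius (f1 w) (f2 w)) \<in> borel_measurable M"
  unfolding radius_def by measurable

lemma measurable_hyper_cutoff [measurable (raw)]:
  assumes [measurable]: "f1 \<in> borel_measurable M" "f2 \<in> borel_measurable M"
  shows "(\<lambda>w. hyper_cutoff i (f1 w) (f2 w)) \<in> borel_measurable M"
  unfolding hyper_cutoff_def by measurable

lemma measurable_rate [measurable (raw)]:
  assumes [measurable]: "f1 \<in> borel_measurable M" "f2 \<in> borel_measurable M" "f3 \<in> borel_measurable M"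
  shows "(\<lambda>w. rate (f1 w) (f2 w) (f3 w)) \<in> borel_measurable M"
  unfolding rate_def by measurable

lemma rate_pos: "s > 0 \<Longrightarrow> g > 0 \<Longrightarrow> rate x s g > 0"
  by (simp add: rate_def add_pos_nonneg)

text \<open>What the integral over \<open>\<eta>\<close> leaves besides \<open>post_g\<close>. It
  depends on \<open>s\<close> alone and therefore cancels in posterior expectations.\<close>

definition scale_const :: "real \<Rightarrow> real" where
  "scale_const s = s powr (real n / 2 - 1) / (Gamma (real n / 2) * 2 powr (real n / 2))
     / (2 * pi) powr half_p * (s / 2) powr (- shape) * Gamma shape"

lemma scale_const_pos: "s > 0 \<Longrightarrow> scale_const s > 0"
  using n shape_ge by (simp add: scale_const_def Gamma_real_pos)

text \<open>In \<open>\<eta>\<close> the two densities amount to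
  \<open>\<eta> powr (shape - 1)\<close> times an exponential, so this is a moment of a Gamma
  distribution. Writing the rate as \<open>s / 2\<close> times
  \<open>1 + (norm x)\<^sup>2 / s / (1 + g)\<close> yields the last factor of
  \<open>mix_post\<close>.\<close>

lemma nn_integral_joint_powr:
  assumes "s > 0" "g > 0" "shape + \<delta> > 0"
  shows "(\<integral>\<^sup>+\<eta>. ennreal (joint x s g \<eta> * \<eta> powr \<delta>) \<partial>lpos)
    = ennreal (scale_const s * (Gamma (shape + \<delta>) / Gamma shape) * (rate x s g / 2) powr (- \<delta>)
        * post_g x s g)"
proof -
  define c where "c = s powr (real n / 2 - 1) / (Gamma (real n / 2) * 2 powr (real n / 2))
      / (2 * pi) powr half_p"
  have c: "c \<ge> 0"
    using n by (simp add: c_def Gamma_real_pos less_imp_le)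
  have G: "Gamma shape > 0" "Gamma (shape + \<delta>) > 0"
    using shape_ge assms by (auto intro!: Gamma_real_pos)
  let ?\<rho> = "rate x s g / 2"
  have \<rho>: "?\<rho> > 0" using rate_pos assms by simp
  have eq: "joint x s g \<eta> * \<eta> powr \<delta> = (c * ((1 + g) powr (- half_p) * mixing_dens a b g))
      * (\<eta> powr (shape + \<delta> - 1) * exp (- ?\<rho> * \<eta>))" if "\<eta> > 0" for \<eta>
  proof -
    have e: "shape + \<delta> - 1 = half_p + real n / 2 + \<delta>"
      by (simp add: shape_def half_p_def)
    have "exp (- (\<eta> / (1 + g)) * (norm x)\<^sup>2 / 2) * exp (- \<eta> * s / 2) = exp (- ?\<rho> * \<eta>)"
      unfolding exp_add[symmetric] rate_def by (simp add: algebra_simps add_divide_distrib)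
    then show ?thesis
      unfolding e powr_add joint_def dens_X_def dens_S_def c_def half_p_def[symmetric] powr_divide powr_minus_divide
      by (simp add: mult_ac)
  qed
  have "(\<integral>\<^sup>+\<eta>. ennreal (joint x s g \<eta> * \<eta> powr \<delta>) \<partial>lpos)
      = (\<integral>\<^sup>+\<eta>. ennreal (c * ((1 + g) powr (- half_p) * mixing_dens a b g))
          * ennreal (\<eta> powr (shape + \<delta> - 1) * exp (- ?\<rho> * \<eta>)) \<partial>lpos)"
    using c by (intro nn_integral_cong) (simp add: eq ennreal_mult'[symmetric])
  also have "\<dots> = ennreal (c * ((1 + g) powr (- half_p) * mixing_dens a b g))
      * ennreal (Gamma (shape + \<delta>) * ?\<rho> powr (- (shape + \<delta>)))"
    unfolding nn_integral_gamma[OF assms(3) \<rho>, symmetric] by (rule nn_integral_cmult) simp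
  also have "\<dots> = ennreal (c * ((1 + g) powr (- half_p) * mixing_dens a b g)
      * (Gamma (shape + \<delta>) * ?\<rho> powr (- (shape + \<delta>))))"
    using c G by (subst ennreal_mult) auto
  also have "c * ((1 + g) powr (- half_p) * mixing_dens a b g) * (Gamma (shape + \<delta>) * ?\<rho> powr (- (shape + \<delta>)))
      = scale_const s * (Gamma (shape + \<delta>) / Gamma shape) * ?\<rho> powr (- \<delta>)
        * post_g x s g"
  proof -
    have e: "- (shape + \<delta>) = - shape + - \<delta>" by simp
    have "?\<rho> = s / 2 * (1 + (norm x)\<^sup>2 / s / (1 + g))"
    proof -
      have "(s + N / G) / 2 = s / 2 * (1 + N / s / G)" if "G \<noteq> 0" for N G
        using that assms(1) by (simp add: field_simps)
      then show ?thesis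
        using assms by (simp add: rate_def)
    qed
    then have "?\<rho> powr (- shape) = (s / 2) powr (- shape) * (1 + (norm x)\<^sup>2 / s / (1 + g)) powr (- shape)"
      by (simp only: powr_mult)
    then show ?thesis
      unfolding e powr_add scale_const_def mix_post_def c_def[symmetric] using G by simp
  qed
  finally show ?thesis .
qed

lemma nn_integral_joint:
  assumes "s > 0" "g > 0"
  shows "(\<integral>\<^sup>+\<eta>. ennreal (joint x s g \<eta>) \<partial>lpos)
    = ennreal (scale_const s * post_g x s g)"
proof -
  have "Gamma shape \<noteq> 0"
  proof -
    have "0 < shape" using shape_ge by linarith
    from Gamma_real_pos[OF this] show ?thesis by simp
  qed
  have "(\<integral>\<^sup>+\<eta>. ennreal (joint x s g \<eta>) \<partial>lpos) = (\<integral>\<^sup>+\<eta>. ennreal (joint x s g \<eta> * \<eta> powr 0) \<partial>lpos)"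
    by (intro nn_integral_cong) simp
  then show ?thesis
    using nn_integral_joint_powr[OF assms, of 0 x] assms shape_ge rate_pos[OF assms, of x]
      \<open>Gamma shape \<noteq> 0\<close> by simp
qed

text \<open>The shape of the posterior of \<open>g\<close> involves the observation only through
  \<open>(norm x)\<^sup>2 / s\<close>.\<close>

lemma mass_eq:
  assumes "s > 0"
  shows "mass x s = ennreal (scale_const s) * (\<integral>\<^sup>+g. ennreal (post_g x s g) \<partial>lpos)"
proof -
  have "mass x s = (\<integral>\<^sup>+g. ennreal (scale_const s) * ennreal (post_g x s g) \<partial>lpos)"
    unfolding mass_def using assms scale_const_pos[OF assms]
    by (intro nn_integral_cong) (simp add: nn_integral_joint ennreal_mult')
  then show ?thesis
    by (simp add: nn_integral_cmult)
qed

lemma mass_finite: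
  assumes "s > 0"
  shows "mass x s < \<infinity>"
  unfolding mass_eq[OF assms]
  using nn_integral_mix_post_finite[of half_p shape b a "(norm x)\<^sup>2 / s"] half_p_nonneg shape_ge b pa assms
  by (simp add: ennreal_mult_less_top half_p_def)

lemma mass_pos:
  assumes "s > 0"
  shows "mass x s > 0"
proof -
  let ?w = "(norm x)\<^sup>2 / s"
  have w: "?w \<ge> 0" using assms by simp
  have "0 < ennreal (2 powr (- \<bar>b\<bar> - shape) * 3 powr (- half_p - a - 2) * (1 + ?w) powr (- half_p - a - 1))"
    using w by (subst ennreal_less_zero_iff) (auto intro!: mult_pos_pos)
  also have "\<dots> \<le> (\<integral>\<^sup>+g. ennreal (mix_post half_p shape a b ?w g) \<partial>lpos)"
    using half_p_nonneg shape_ge pa w by (intro nn_integral_mix_post_ge) (auto simp: half_p_def)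
  finally show ?thesis
    unfolding mass_eq[OF assms] using scale_const_pos[OF assms] by (simp add: ennreal_zero_less_mult_iff)
qed

text \<open>Below \<open>half_p + a + 1\<close>, the posterior moment of \<open>1 + g\<close> of
  this order exists. At most \<open>1 / 8\<close>, the exponent \<open>- 2 * eps\<close> with which
  \<open>\<eta> * s\<close> will occur is no worse than \<open>- 1 / 4\<close>, and that power is
  integrable against the density of \<open>s\<close> even for \<open>n = 1\<close>.\<close>

definition eps :: real where "eps = min (1 / 8) ((half_p + a + 1) / 2)"

lemma eps: "0 < eps" "eps \<le> 1 / 8" "eps < half_p + a + 1"
  using pa by (auto simp: eps_def half_p_def min_def)

text \<open>Up to a constant, a bound on the posterior expectation of \<open>exp (eps * d)\<close>
  over the second hyperparameters \<open>(g', \<eta>')\<close> with \<open>g' \<ge> g\<close>, where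
  \<open>d\<close> is the change of \<open>radius\<close>. The first factor comes from the moment of
  \<open>1 + g'\<close>, the second from the moments of \<open>\<eta>'\<close> of orders
  \<open>eps\<close> and \<open>- eps\<close>.\<close>

definition growth :: "real ^ 'p \<Rightarrow> real \<Rightarrow> real \<Rightarrow> real \<Rightarrow> real" where
  "growth x s g \<eta> = ((1 + (norm x)\<^sup>2 / s) / (1 + g)) powr eps
     * ((s * \<eta>) powr (- eps) + (rate x s g * \<eta>) powr eps)"

text \<open>The change of \<open>radius\<close> is at most the sum of the changes of the two
  coordinates. The first has a known sign because \<open>g \<le> g'\<close>; for the second,
  \<open>exp \<bar>t\<bar> \<le> exp t + exp (- t)\<close> replaces the absolute value by two
  powers.\<close>

lemma exp_radius_diff_le:
  assumes "0 < g" "g \<le> g'" "0 < \<eta>" "0 < \<eta>'"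
  shows "exp (eps * \<bar>radius g \<eta> - radius g' \<eta>'\<bar>)
    \<le> ((1 + g') / (1 + g)) powr eps * ((\<eta>' / \<eta>) powr eps + (\<eta>' / \<eta>) powr (- eps))"
proof -
  have "ln (1 + g) \<le> ln (1 + g')"
    using assms by (intro ln_mono) auto
  have "\<bar>radius g \<eta> - radius g' \<eta>'\<bar> \<le> ln ((1 + g') / (1 + g)) + \<bar>ln (\<eta>' / \<eta>)\<bar>"
  proof -
    have "ln ((1 + g') / (1 + g)) = ln (1 + g') - ln (1 + g)" "ln (\<eta>' / \<eta>) = ln \<eta>' - ln \<eta>"
      using assms by (simp_all add: ln_div)
    with \<open>ln (1 + g) \<le> ln (1 + g')\<close> show ?thesis
      unfolding radius_def by linarith
  qed
  then have "eps * \<bar>radius g \<eta> - radius g' \<eta>'\<bar> \<le> eps * (ln ((1 + g') / (1 + g)) + \<bar>ln (\<eta>' / \<eta>)\<bar>)"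
    using eps by (intro mult_left_mono) auto
  then have "exp (eps * \<bar>radius g \<eta> - radius g' \<eta>'\<bar>) \<le> exp (eps * (ln ((1 + g') / (1 + g)) + \<bar>ln (\<eta>' / \<eta>)\<bar>))"
    by simp
  also have "\<dots> = exp (eps * ln ((1 + g') / (1 + g))) * exp (eps * \<bar>ln (\<eta>' / \<eta>)\<bar>)"
    by (simp only: distrib_left exp_add)
  also have "exp (eps * ln ((1 + g') / (1 + g))) = ((1 + g') / (1 + g)) powr eps"
    using assms by (simp add: powr_def)
  also have "exp (eps * \<bar>ln (\<eta>' / \<eta>)\<bar>) \<le> (\<eta>' / \<eta>) powr eps + (\<eta>' / \<eta>) powr (- eps)"
    using assms by (simp add: powr_def abs_if add_increasing add_increasing2)
  finally show ?thesis
    by (simp add: mult_left_mono)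
qed

text \<open>Polynomial growth in the distance is traded for \<open>exp (eps * d)\<close>, which
  splits into powers of \<open>1 + g'\<close> and of \<open>\<eta>'\<close>. The powers of
  \<open>\<eta>'\<close> are integrated by the Gamma distribution, the power of
  \<open>1 + g'\<close> by the posterior moment bound for \<open>g\<close>, and \<open>mass\<close>
  collects the normalization.\<close>

lemma nn_integral_joint_cut_diff:
  obtains C where "C \<ge> 0" "\<And>i x s g \<eta>. i \<ge> 1 \<Longrightarrow> s > 0 \<Longrightarrow> g > 0 \<Longrightarrow> \<eta> > 0 \<Longrightarrow>
    (\<integral>\<^sup>+g'. \<integral>\<^sup>+\<eta>'. ennreal (joint x s g' \<eta>' * (hyper_cutoff i g \<eta> - hyper_cutoff i g' \<eta>')\<^sup>2) * indicator {g..} g' \<partial>lpos \<partial>lpos)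
      \<le> ennreal (C / i\<^sup>2 * decay i g \<eta> * growth x s g \<eta>) * mass x s"
proof -
  obtain C1 where C1: "C1 \<ge> 0" "\<And>w. w \<ge> 0 \<Longrightarrow>
    (\<integral>\<^sup>+g. ennreal ((1 + g) powr eps * mix_post half_p shape a b w g) \<partial>lpos)
      \<le> ennreal (C1 * (1 + w) powr eps) * (\<integral>\<^sup>+g. ennreal (mix_post half_p shape a b w g) \<partial>lpos)"
    using half_p_nonneg shape_ge b eps by (auto intro: mix_post_moment_le[of half_p shape b eps a])
  define C2 where "C2 = exp 1 * ((5 / eps) ^ 5 * exp eps)"
  have C2: "C2 \<ge> 0" using eps by (simp add: C2_def)
  \<comment> \<open>The Gamma ratios belong to the moments of \<open>\<eta>'\<close> of orders
    \<open>eps\<close> and \<open>- eps\<close>. The factor \<open>2 powr eps\<close> appears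
    because the conditional rate is half of \<open>rate\<close>.\<close>
  define C3 where "C3 = Gamma (shape + eps) / Gamma shape * 2 powr eps + Gamma (shape - eps) / Gamma shape"
  have G: "Gamma shape > 0" "Gamma (shape + eps) > 0" "Gamma (shape - eps) > 0"
    using shape_ge eps by (auto intro!: Gamma_real_pos)
  then have C3: "C3 \<ge> 0" by (simp add: C3_def)
  show thesis
  proof (rule that)
    show "C2 * C3 * C1 \<ge> 0" using C1 C2 C3 by simp
    fix i s g \<eta> :: real and x :: "real ^ 'p"
    assume i: "i \<ge> 1" and s: "s > 0" and g: "g > 0" and \<eta>: "\<eta> > 0"
    define w where "w = (norm x)\<^sup>2 / s"
    have w: "w \<ge> 0" using s by (simp add: w_def)
    define K where "K = C2 / i\<^sup>2 * decay i g \<eta>"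
    have K: "K \<ge> 0" using C2 by (simp add: K_def)
    define P where "P = (s * \<eta>) powr (- eps) + (rate x s g * \<eta>) powr eps"
    have P: "P \<ge> 0" by (simp add: P_def)
    have inner: "(\<integral>\<^sup>+\<eta>'. ennreal (joint x s g' \<eta>' * (hyper_cutoff i g \<eta> - hyper_cutoff i g' \<eta>')\<^sup>2) * indicator {g..} g' \<partial>lpos)
        \<le> ennreal (K * (1 + g) powr (- eps) * C3 * P * scale_const s) * ennreal ((1 + g') powr eps * mix_post half_p shape a b w g')"
      if g': "g' > 0" for g'
    proof (cases "g \<le> g'")
      case False
      then show ?thesis by simp
    next
      case True
      define B where "B = K * ((1 + g') / (1 + g)) powr eps"
      have B: "B \<ge> 0" using K by (simp add: B_def)
      have pw: "joint x s g' \<eta>' * (hyper_cutoff i g \<eta> - hyper_cutoff i g' \<eta>')\<^sup>2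
          \<le> B * (\<eta> powr (- eps) * (joint x s g' \<eta>' * \<eta>' powr eps) + \<eta> powr eps * (joint x s g' \<eta>' * \<eta>' powr (- eps)))"
        if \<eta>': "\<eta>' > 0" for \<eta>'
      proof -
        let ?d = "\<bar>radius g \<eta> - radius g' \<eta>'\<bar>"
        let ?R = "decay i g \<eta>"
        have "(hyper_cutoff i g \<eta> - hyper_cutoff i g' \<eta>')\<^sup>2 \<le> exp 1 / i\<^sup>2 * (1 + ?d) ^ 5 * ?R"
          unfolding hyper_cutoff_def using i g g' by (intro cutoff_diff_sq_le radius_nonneg) auto
        also have "\<dots> \<le> exp 1 / i\<^sup>2 * ((5 / eps) ^ 5 * exp eps * exp (eps * ?d)) * ?R"
          using eps by (intro mult_right_mono mult_left_mono power5_le_exp) auto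
        also have "\<dots> = K * exp (eps * ?d)"
          by (simp add: K_def C2_def)
        also have "\<dots> \<le> K * (((1 + g') / (1 + g)) powr eps * ((\<eta>' / \<eta>) powr eps + (\<eta>' / \<eta>) powr (- eps)))"
          using K g True \<eta> \<eta>' by (intro mult_left_mono exp_radius_diff_le) auto
        also have "\<dots> = B * (\<eta> powr (- eps) * \<eta>' powr eps + \<eta> powr eps * \<eta>' powr (- eps))"
          using \<eta> \<eta>' by (simp add: B_def powr_divide powr_minus_divide mult.assoc)
        finally have "joint x s g' \<eta>' * (hyper_cutoff i g \<eta> - hyper_cutoff i g' \<eta>')\<^sup>2
            \<le> joint x s g' \<eta>' * (B * (\<eta> powr (- eps) * \<eta>' powr eps + \<eta> powr eps * \<eta>' powr (- eps)))"
          by (intro mult_left_mono) auto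
        then show ?thesis
          by (simp add: algebra_simps)
      qed
      have "(\<integral>\<^sup>+\<eta>'. ennreal (joint x s g' \<eta>' * (hyper_cutoff i g \<eta> - hyper_cutoff i g' \<eta>')\<^sup>2) * indicator {g..} g' \<partial>lpos)
          \<le> (\<integral>\<^sup>+\<eta>'. ennreal B * (ennreal (\<eta> powr (- eps)) * ennreal (joint x s g' \<eta>' * \<eta>' powr eps)
              + ennreal (\<eta> powr eps) * ennreal (joint x s g' \<eta>' * \<eta>' powr (- eps))) \<partial>lpos)"
        using True B pw
        by (intro nn_integral_mono) (auto intro!: ennreal_leI simp flip: ennreal_mult ennreal_plus)
      also have "\<dots> = ennreal B * (ennreal (\<eta> powr (- eps)) * (\<integral>\<^sup>+\<eta>'. ennreal (joint x s g' \<eta>' * \<eta>' powr eps) \<partial>lpos)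
              + ennreal (\<eta> powr eps) * (\<integral>\<^sup>+\<eta>'. ennreal (joint x s g' \<eta>' * \<eta>' powr (- eps)) \<partial>lpos))"
        by (simp add: nn_integral_cmult nn_integral_add)
      also have "\<dots> = ennreal (B * (\<eta> powr (- eps) * (scale_const s * (Gamma (shape + eps) / Gamma shape) * (rate x s g' / 2) powr (- eps)
             * mix_post half_p shape a b w g')
           + \<eta> powr eps * (scale_const s * (Gamma (shape - eps) / Gamma shape) * (rate x s g' / 2) powr eps
             * mix_post half_p shape a b w g')))"
        using s g' G B shape_ge eps scale_const_pos[OF s]
        by (simp add: nn_integral_joint_powr w_def flip: ennreal_mult ennreal_plus)
      also have "\<dots> \<le> ennreal (B * (C3 * P * scale_const s * mix_post half_p shape a b w g'))"
      proof (intro ennreal_leI mult_left_mono B)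
        \<comment> \<open>The conditional rate of \<open>\<eta>'\<close> decreases in
          \<open>g'\<close> and never falls below \<open>s\<close>. Hence its negative powers are
          bounded through \<open>s\<close> and its positive powers through the value at
          \<open>g\<close>, both free of \<open>g'\<close>.\<close>
        have rs: "s \<le> rate x s g'" "rate x s g' \<le> rate x s g"
          using g g' True by (auto simp: rate_def frac_le)
        have r1: "\<eta> powr (- eps) * (rate x s g' / 2) powr (- eps) \<le> 2 powr eps * (s * \<eta>) powr (- eps)"
        proof -
          have "(rate x s g' / 2) powr (- eps) \<le> (s / 2) powr (- eps)"
            using rs s eps by (intro powr_mono2') auto
          also have "\<dots> = 2 powr eps * s powr (- eps)"
            using s by (simp add: powr_divide powr_minus_divide)
          finally have "\<eta> powr (- eps) * (rate x s g' / 2) powr (- eps) \<le> \<eta> powr (- eps) * (2 powr eps * s powr (- eps))"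
            by (intro mult_left_mono) auto
          then show ?thesis
            by (simp add: powr_mult mult_ac)
        qed
        have r2: "\<eta> powr eps * (rate x s g' / 2) powr eps \<le> (rate x s g * \<eta>) powr eps"
        proof -
          have "(\<eta> * (rate x s g' / 2)) powr eps \<le> (\<eta> * rate x s g) powr eps"
            using rs s eps \<eta> by (intro powr_mono2 mult_left_mono) auto
          then show ?thesis
            unfolding powr_mult by (simp add: mult.commute)
        qed
        let ?S = "scale_const s * mix_post half_p shape a b w g'"
        have S: "?S \<ge> 0" using scale_const_pos[OF s] by simp
        have "Gamma (shape + eps) / Gamma shape * (\<eta> powr (- eps) * (rate x s g' / 2) powr (- eps))
            + Gamma (shape - eps) / Gamma shape * (\<eta> powr eps * (rate x s g' / 2) powr eps)
          \<le> Gamma (shape + eps) / Gamma shape * (2 powr eps * (s * \<eta>) powr (- eps))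
            + Gamma (shape - eps) / Gamma shape * (rate x s g * \<eta>) powr eps"
          using G by (intro add_mono mult_left_mono r1 r2) auto
        also have "\<dots> \<le> C3 * P"
        proof -
          have prod: "u * p + v * r \<le> (u + v) * (p + r)" if "0 \<le> u" "0 \<le> v" "0 \<le> p" "0 \<le> r" for u v p r :: real
            using that by (simp add: algebra_simps)
          show ?thesis
            unfolding C3_def P_def mult.assoc[symmetric] using G by (intro prod) auto
        qed
        finally have "(Gamma (shape + eps) / Gamma shape * (\<eta> powr (- eps) * (rate x s g' / 2) powr (- eps))
            + Gamma (shape - eps) / Gamma shape * (\<eta> powr eps * (rate x s g' / 2) powr eps)) * ?S \<le> C3 * P * ?S"
          using S by (intro mult_right_mono)
        then show "\<eta> powr (- eps) * (scale_const s * (Gamma (shape + eps) / Gamma shape) * (rate x s g' / 2) powr (- eps)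
             * mix_post half_p shape a b w g')
           + \<eta> powr eps * (scale_const s * (Gamma (shape - eps) / Gamma shape) * (rate x s g' / 2) powr eps
             * mix_post half_p shape a b w g') \<le> C3 * P * scale_const s * mix_post half_p shape a b w g'"
          by (simp only: distrib_right distrib_left mult_ac)
      qed
      also have "B * (C3 * P * scale_const s * mix_post half_p shape a b w g')
          = (K * (1 + g) powr (- eps) * C3 * P * scale_const s) * ((1 + g') powr eps * mix_post half_p shape a b w g')"
        by (simp add: B_def powr_divide powr_minus_divide)
      also have "ennreal \<dots> = ennreal (K * (1 + g) powr (- eps) * C3 * P * scale_const s) * ennreal ((1 + g') powr eps * mix_post half_p shape a b w g')"
        using K C3 P scale_const_pos[OF s] by (intro ennreal_mult) auto
      finally show ?thesis .
    qed
    have "(\<integral>\<^sup>+g'. \<integral>\<^sup>+\<eta>'. ennreal (joint x s g' \<eta>' * (hyper_cutoff i g \<eta> - hyper_cutoff i g' \<eta>')\<^sup>2) * indicator {g..} g' \<partial>lpos \<partial>lpos)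
        \<le> (\<integral>\<^sup>+g'. ennreal (K * (1 + g) powr (- eps) * C3 * P * scale_const s) * ennreal ((1 + g') powr eps * mix_post half_p shape a b w g') \<partial>lpos)"
      by (intro nn_integral_mono inner) auto
    also have "\<dots> = ennreal (K * (1 + g) powr (- eps) * C3 * P * scale_const s) * (\<integral>\<^sup>+g'. ennreal ((1 + g') powr eps * mix_post half_p shape a b w g') \<partial>lpos)"
      by (simp add: nn_integral_cmult)
    also have "\<dots> \<le> ennreal (K * (1 + g) powr (- eps) * C3 * P * scale_const s)
        * (ennreal (C1 * (1 + w) powr eps) * (\<integral>\<^sup>+g. ennreal (mix_post half_p shape a b w g) \<partial>lpos))"
      by (intro mult_left_mono C1 w) simp
    also have "\<dots> = ennreal (K * (1 + g) powr (- eps) * C3 * P * (C1 * (1 + w) powr eps)) * mass x s"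
      using K C3 P C1(1) scale_const_pos[OF s] unfolding mass_eq[OF s] w_def[symmetric]
      by (simp add: mult_ac ennreal_mult)
    also have "K * (1 + g) powr (- eps) * C3 * P * (C1 * (1 + w) powr eps)
        = C2 * C3 * C1 / i\<^sup>2 * decay i g \<eta> * growth x s g \<eta>"
    proof -
      have "(1 + g) powr (- eps) = 1 / (1 + g) powr eps"
        by (rule powr_minus_divide)
      then show ?thesis
        unfolding growth_def w_def[symmetric] P_def[symmetric] K_def powr_divide by simp
    qed
    finally show "(\<integral>\<^sup>+g'. \<integral>\<^sup>+\<eta>'. ennreal (joint x s g' \<eta>' * (hyper_cutoff i g \<eta> - hyper_cutoff i g' \<eta>')\<^sup>2) * indicator {g..} g' \<partial>lpos \<partial>lpos)
      \<le> ennreal (C2 * C3 * C1 / i\<^sup>2 * decay i g \<eta> * growth x s g \<eta>) * mass x s" .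
  qed
qed

end

section \<open>Averaging over the observations and over the hyperparameters\<close>

lemma powr_le_1_plus:
  fixes t e :: real
  assumes "t > 0" "0 \<le> e" "e \<le> 1"
  shows "t powr e \<le> 1 + t"
proof (cases "t \<le> 1")
  case True
  then have "t powr e \<le> 1 powr e"
    using assms by (intro powr_mono2) auto
  then show ?thesis using assms by simp
next
  case False
  then have "t powr e \<le> t powr 1"
    using assms by (intro powr_mono) auto
  then show ?thesis using assms by simp
qed

lemma powr_uminus_le:
  fixes t e :: real
  assumes "t > 0" "0 \<le> e" "e \<le> 1 / 4"
  shows "t powr (- e) \<le> 1 + t powr (- 1 / 4)"
proof (cases "t \<le> 1")
  case True
  then have "t powr (- e) \<le> t powr (- 1 / 4)"
    using assms by (intro powr_mono') auto
  then show ?thesis by simp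
next
  case False
  then have "t powr (- e) \<le> 1"
    using assms by (intro powr_nonpos_le_one) auto
  then show ?thesis by (simp add: add_increasing2)
qed

text \<open>The law of \<open>\<eta> * s\<close> does not depend on \<open>\<eta>\<close>, hence one
  constant for all \<open>\<eta>\<close>. Half of the exponential absorbs
  \<open>1 + \<eta> * s\<close>, and the negative power shifts the Gamma parameter from
  \<open>n / 2\<close> to \<open>n / 2 - 1 / 4\<close>, still positive for
  \<open>n = 1\<close>.\<close>

lemma nn_integral_dens_S_moment:
  assumes n: "n \<ge> 1"
  obtains C where "C \<ge> 0" "\<And>\<eta>. \<eta> > 0 \<Longrightarrow>
    (\<integral>\<^sup>+s. ennreal (dens_S n \<eta> s * ((1 + \<eta> * s) * (1 + (\<eta> * s) powr (- 1 / 4)))) \<partial>lpos) \<le> ennreal C"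
proof -
  define k where "k = real n / 2"
  have k: "k \<ge> 1 / 2" using n by (simp add: k_def)
  define c where "c = 4 / (Gamma k * 2 powr k)"
  have c: "c \<ge> 0" using k by (simp add: c_def Gamma_real_pos less_imp_le)
  define C where "C = c * (Gamma k * (1 / 4) powr (- k) + Gamma (k - 1 / 4) * (1 / 4) powr (- (k - 1 / 4)))"
  have G: "Gamma k > 0" "Gamma (k - 1 / 4) > 0" using k by (auto intro!: Gamma_real_pos)
  have C: "C \<ge> 0" using c G by (simp add: C_def)
  have main: "(\<integral>\<^sup>+s. ennreal (dens_S n \<eta> s * ((1 + \<eta> * s) * (1 + (\<eta> * s) powr (- 1 / 4)))) \<partial>lpos) \<le> ennreal C"
    if \<eta>: "\<eta> > 0" for \<eta>
  proof -
    have pw: "dens_S n \<eta> s * ((1 + \<eta> * s) * (1 + (\<eta> * s) powr (- 1 / 4)))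
        \<le> c * \<eta> powr k * (s powr (k - 1) * exp (- (\<eta> / 4) * s))
          + c * \<eta> powr (k - 1 / 4) * (s powr ((k - 1 / 4) - 1) * exp (- (\<eta> / 4) * s))" if s: "s > 0" for s
    proof -
      have "1 + \<eta> * s \<le> 4 * (1 + \<eta> * s / 4)" using \<eta> s by simp
      also have "\<dots> \<le> 4 * exp (\<eta> * s / 4)" by (intro mult_left_mono exp_ge_add_one_self) simp
      finally have "exp (- \<eta> * s / 2) * (1 + \<eta> * s) \<le> exp (- \<eta> * s / 2) * (4 * exp (\<eta> * s / 4))"
        by (intro mult_left_mono) auto
      also have "\<dots> = 4 * exp (- (\<eta> / 4) * s)"
        by (simp add: mult.left_commute flip: exp_add)
      finally have e: "exp (- \<eta> * s / 2) * (1 + \<eta> * s) \<le> 4 * exp (- (\<eta> / 4) * s)" .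
      have "dens_S n \<eta> s * ((1 + \<eta> * s) * (1 + (\<eta> * s) powr (- 1 / 4)))
          = c / 4 * (\<eta> powr k * s powr (k - 1) * (1 + (\<eta> * s) powr (- 1 / 4))) * (exp (- \<eta> * s / 2) * (1 + \<eta> * s))"
        unfolding dens_S_def k_def[symmetric] c_def by simp
      also have "\<dots> \<le> c / 4 * (\<eta> powr k * s powr (k - 1) * (1 + (\<eta> * s) powr (- 1 / 4))) * (4 * exp (- (\<eta> / 4) * s))"
        using c by (intro mult_left_mono e) (auto intro!: mult_nonneg_nonneg)
      also have "\<dots> = c * \<eta> powr k * (s powr (k - 1) * exp (- (\<eta> / 4) * s))
          + c * (\<eta> powr k * \<eta> powr (- 1 / 4)) * (s powr (k - 1) * s powr (- 1 / 4) * exp (- (\<eta> / 4) * s))"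
        unfolding powr_mult by (simp add: algebra_simps)
      also have "\<eta> powr k * \<eta> powr (- 1 / 4) = \<eta> powr (k - 1 / 4)"
        by (simp flip: powr_add)
      also have "s powr (k - 1) * s powr (- 1 / 4) = s powr ((k - 1 / 4) - 1)"
        by (simp add: algebra_simps flip: powr_add)
      finally show ?thesis .
    qed
    have "(\<integral>\<^sup>+s. ennreal (dens_S n \<eta> s * ((1 + \<eta> * s) * (1 + (\<eta> * s) powr (- 1 / 4)))) \<partial>lpos)
        \<le> (\<integral>\<^sup>+s. ennreal (c * \<eta> powr k) * ennreal (s powr (k - 1) * exp (- (\<eta> / 4) * s))
          + ennreal (c * \<eta> powr (k - 1 / 4)) * ennreal (s powr ((k - 1 / 4) - 1) * exp (- (\<eta> / 4) * s)) \<partial>lpos)"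
    proof (rule nn_integral_mono)
      fix s assume "s \<in> space lpos"
      then have s: "s > 0" by simp
      show "ennreal (dens_S n \<eta> s * ((1 + \<eta> * s) * (1 + (\<eta> * s) powr (- 1 / 4))))
        \<le> ennreal (c * \<eta> powr k) * ennreal (s powr (k - 1) * exp (- (\<eta> / 4) * s))
          + ennreal (c * \<eta> powr (k - 1 / 4)) * ennreal (s powr ((k - 1 / 4) - 1) * exp (- (\<eta> / 4) * s))"
        using ennreal_leI[OF pw[OF s]] c by (simp add: ennreal_mult ennreal_plus)
    qed
    also have "\<dots> = ennreal (c * \<eta> powr k) * ennreal (Gamma k * (\<eta> / 4) powr (- k))
        + ennreal (c * \<eta> powr (k - 1 / 4)) * ennreal (Gamma (k - 1 / 4) * (\<eta> / 4) powr (- (k - 1 / 4)))"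
    proof -
      have "\<eta> / 4 > 0" "k > 0" "k - 1 / 4 > 0" using k \<eta> by auto
      note nn_integral_gamma[OF this(2,1)] nn_integral_gamma[OF this(3,1)]
      then show ?thesis
        by (subst nn_integral_add, simp, simp, subst nn_integral_cmult, simp, subst nn_integral_cmult, simp, simp only:)
    qed
    also have "\<dots> = ennreal (c * \<eta> powr k * (Gamma k * (\<eta> / 4) powr (- k))
        + c * \<eta> powr (k - 1 / 4) * (Gamma (k - 1 / 4) * (\<eta> / 4) powr (- (k - 1 / 4))))"
      using c G by (simp flip: ennreal_mult ennreal_plus)
    also have "c * \<eta> powr k * (Gamma k * (\<eta> / 4) powr (- k))
        + c * \<eta> powr (k - 1 / 4) * (Gamma (k - 1 / 4) * (\<eta> / 4) powr (- (k - 1 / 4))) = C"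
    proof -
      have cancel: "\<eta> powr e * (\<eta> / 4) powr (- e) = (1 / 4) powr (- e)" for e
      proof -
        have "(\<eta> / 4) powr (- e) = \<eta> powr (- e) * (1 / 4) powr (- e)"
          unfolding powr_mult[symmetric] by simp
        then show ?thesis using \<eta> by (simp add: powr_minus)
      qed
      have "c * \<eta> powr k * (Gamma k * (\<eta> / 4) powr (- k))
        + c * \<eta> powr (k - 1 / 4) * (Gamma (k - 1 / 4) * (\<eta> / 4) powr (- (k - 1 / 4)))
        = c * (Gamma k * (\<eta> powr k * (\<eta> / 4) powr (- k))
         + Gamma (k - 1 / 4) * (\<eta> powr (k - 1 / 4) * (\<eta> / 4) powr (- (k - 1 / 4))))"
        by (simp only: distrib_left mult_ac)
      then show ?thesis
        unfolding cancel C_def .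
    qed
    finally show ?thesis .
  qed
  show thesis by (rule that[OF C main])
qed

context shrinkage_prior
begin

text \<open>Put \<open>q = \<eta> / (1 + g) * (norm x)\<^sup>2\<close> and
  \<open>z = \<eta> * s\<close>. Then \<open>rate x s g * \<eta>\<close> is \<open>q + z\<close>,
  and the base of the first power in \<open>growth\<close> is at most \<open>(q + z) / z\<close>.
  The resulting bound is a product of a function of \<open>q\<close> and a function of
  \<open>z\<close>, which are independent given \<open>(g, \<eta>)\<close> and have parameter-free
  laws.\<close>

lemma growth_le:
  assumes "s > 0" "g > 0" "\<eta> > 0"
  shows "growth x s g \<eta>
    \<le> 2 * (1 + \<eta> / (1 + g) * (norm x)\<^sup>2) * ((1 + \<eta> * s) * (1 + (\<eta> * s) powr (- 1 / 4)))"
proof -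
  define q where "q = \<eta> / (1 + g) * (norm x)\<^sup>2"
  define z where "z = \<eta> * s"
  define y where "y = q + z"
  have q: "q \<ge> 0" and z: "z > 0" using assms by (simp_all add: q_def z_def)
  then have y: "y > 0" by (simp add: y_def)
  have ry: "rate x s g * \<eta> = y"
    using assms by (simp add: rate_def y_def q_def z_def field_simps)
  have "(1 + (norm x)\<^sup>2 / s) / (1 + g) \<le> y / z"
  proof -
    have "y / z = 1 + (norm x)\<^sup>2 / s / (1 + g)"
    proof -
      have "(\<eta> / G * N + \<eta> * s) / (\<eta> * s) = 1 + N / s / G" if "G \<noteq> 0" for N G
        using that assms by (simp add: field_simps)
      then show ?thesis
        using assms by (simp add: y_def q_def z_def)
    qed
    then show ?thesis
      using assms by (simp add: add_divide_distrib)
  qed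
  then have "((1 + (norm x)\<^sup>2 / s) / (1 + g)) powr eps \<le> (y / z) powr eps"
    using eps assms by (intro powr_mono2) auto
  then have "growth x s g \<eta> \<le> (y / z) powr eps * (z powr (- eps) + y powr eps)"
    unfolding growth_def ry by (intro mult_mono) (auto simp: z_def mult.commute)
  also have "\<dots> = y powr eps * z powr (- (2 * eps)) + y powr (2 * eps) * z powr (- eps)"
  proof -
    have e: "z powr (- (2 * eps)) = z powr (- eps) * z powr (- eps)" "y powr (2 * eps) = y powr eps * y powr eps"
      by (simp_all flip: powr_add)
    have "(y / z) powr eps = y powr eps * z powr (- eps)"
      by (simp add: powr_divide powr_minus_divide)
    then show ?thesis
      unfolding e by (simp add: algebra_simps)
  qed
  also have "\<dots> \<le> (1 + y) * (1 + z powr (- 1 / 4)) + (1 + y) * (1 + z powr (- 1 / 4))"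
    using eps y z by (intro add_mono mult_mono powr_le_1_plus powr_uminus_le) auto
  also have "\<dots> = 2 * (1 + y) * (1 + z powr (- 1 / 4))"
    by simp
  also have "\<dots> \<le> 2 * ((1 + q) * (1 + z)) * (1 + z powr (- 1 / 4))"
    using q z by (intro mult_right_mono mult_left_mono) (auto simp: y_def algebra_simps)
  finally show ?thesis
    unfolding q_def z_def by (simp only: mult.assoc)
qed

text \<open>The squared shrinkage times \<open>(norm x)\<^sup>2\<close> equals
  \<open>q / ((1 + g) * \<eta>)\<close> with \<open>q = \<eta> / (1 + g) * (norm x)\<^sup>2\<close>;
  the expectations of the remaining functions of \<open>q\<close> and \<open>\<eta> * s\<close> are
  bounded. The factors \<open>1 / (1 + g)\<close> and \<open>1 / \<eta>\<close> turn
  \<open>dg d\<eta>\<close> into area in the logarithmic coordinates, with weight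
  \<open>mixing_dens\<close>.\<close>

lemma nn_integral_joint_growth:
  obtains C where "C \<ge> 0" "\<And>g \<eta>. g > 0 \<Longrightarrow> \<eta> > 0 \<Longrightarrow>
    (\<integral>\<^sup>+x. \<integral>\<^sup>+s. ennreal ((norm x)\<^sup>2 * (1 / (1 + g))\<^sup>2 * joint x s g \<eta> * growth x s g \<eta>) \<partial>lpos \<partial>lborel)
      \<le> ennreal (C * (mixing_dens a b g / (1 + g)) * (1 / \<eta>))"
proof -
  obtain C1 where C1: "C1 \<ge> 0" "\<And>\<eta>. \<eta> > 0 \<Longrightarrow>
    (\<integral>\<^sup>+s. ennreal (dens_S n \<eta> s * ((1 + \<eta> * s) * (1 + (\<eta> * s) powr (- 1 / 4)))) \<partial>lpos) \<le> ennreal C1"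
    using nn_integral_dens_S_moment[OF n] by blast
  \<comment> \<open>\<open>64 = 2 * 32\<close>: the \<open>2\<close> is the constant in
    \<open>growth_le\<close>, the \<open>32\<close> comes from comparing \<open>q * (1 + q)\<close>
    with the quadratic Taylor polynomial of \<open>exp (q / 4)\<close>.\<close>
  define C2 where "C2 = 64 * 2 powr half_p"
  have C2: "C2 \<ge> 0" by (simp add: C2_def)
  show thesis
  proof (rule that)
    show "C2 * C1 \<ge> 0" using C1 C2 by simp
    fix g \<eta> :: real assume g: "g > 0" and \<eta>: "\<eta> > 0"
    let ?S = "\<lambda>s. dens_S n \<eta> s * ((1 + \<eta> * s) * (1 + (\<eta> * s) powr (- 1 / 4)))"
    define B where "B = C2 * (mixing_dens a b g / (1 + g)) * (1 / \<eta>)"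
    have B: "B \<ge> 0" using g \<eta> C2 by (simp add: B_def)
    let ?D = "\<lambda>x :: real ^ 'p. dens_X 0 (\<eta> / (1 + g) / 2) x"
    have pw: "(norm x)\<^sup>2 * (1 / (1 + g))\<^sup>2 * joint x s g \<eta> * growth x s g \<eta> \<le> B * ?D x * ?S s"
      if s: "s > 0" for x :: "real ^ 'p" and s
    proof -
      define q where "q = \<eta> / (1 + g) * (norm x)\<^sup>2"
      have q: "q \<ge> 0" using g \<eta> by (simp add: q_def)
      have "q * (1 + q) / 32 \<le> 1 + q / 4 + (q / 4)\<^sup>2 / 2"
        using q by (simp add: power2_eq_square field_simps)
      also have "\<dots> \<le> exp (q / 4)"
        using q exp_lower_Taylor_quadratic[of "q / 4"] by simp
      finally have "dens_X 0 (\<eta> / (1 + g)) x * (q * (1 + q) / 32) \<le> 2 powr (real CARD('p) / 2) * ?D x"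
        using q g \<eta> by (intro dens_X_le_exp_half) (auto simp: q_def)
      then have D: "dens_X 0 (\<eta> / (1 + g)) x * (q * (1 + q)) * 2 \<le> C2 * ?D x"
        by (simp add: C2_def half_p_def mult_ac)
      have "(norm x)\<^sup>2 * (1 / (1 + g))\<^sup>2 * joint x s g \<eta> * growth x s g \<eta>
          \<le> (norm x)\<^sup>2 * (1 / (1 + g))\<^sup>2 * joint x s g \<eta> * (2 * (1 + q) * ((1 + \<eta> * s) * (1 + (\<eta> * s) powr (- 1 / 4))))"
        unfolding q_def using growth_le[OF s g \<eta>] by (intro mult_left_mono) auto
      also have "\<dots> = (mixing_dens a b g / (1 + g)) * (1 / \<eta>) * (dens_X 0 (\<eta> / (1 + g)) x * (q * (1 + q)) * 2) * ?S s"
        using g \<eta> by (simp add: joint_def q_def power2_eq_square)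
      also have "\<dots> \<le> (mixing_dens a b g / (1 + g)) * (1 / \<eta>) * (C2 * ?D x) * ?S s"
        using g \<eta> s dens_S_nonneg[OF n] by (intro mult_right_mono mult_left_mono D) auto
      also have "\<dots> = B * ?D x * ?S s"
        by (simp add: B_def)
      finally show ?thesis .
    qed
    have "(\<integral>\<^sup>+x. \<integral>\<^sup>+s. ennreal ((norm x)\<^sup>2 * (1 / (1 + g))\<^sup>2 * joint x s g \<eta> * growth x s g \<eta>) \<partial>lpos \<partial>lborel)
        \<le> (\<integral>\<^sup>+x. \<integral>\<^sup>+s. ennreal (B * ?D x) * ennreal (?S s) \<partial>lpos \<partial>lborel)"
    proof (intro nn_integral_mono)
      fix x :: "real ^ 'p" and s assume "s \<in> space lpos"
      then have s: "s > 0" by simp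
      have "ennreal ((norm x)\<^sup>2 * (1 / (1 + g))\<^sup>2 * joint x s g \<eta> * growth x s g \<eta>) \<le> ennreal (B * ?D x * ?S s)"
        by (intro ennreal_leI pw s)
      also have "\<dots> = ennreal (B * ?D x) * ennreal (?S s)"
        using B dens_S_nonneg[OF n] \<eta> s by (intro ennreal_mult) auto
      finally show "ennreal ((norm x)\<^sup>2 * (1 / (1 + g))\<^sup>2 * joint x s g \<eta> * growth x s g \<eta>)
        \<le> ennreal (B * ?D x) * ennreal (?S s)" .
    qed
    also have "\<dots> = (\<integral>\<^sup>+x. ennreal B * ennreal (?D x) \<partial>lborel) * (\<integral>\<^sup>+s. ennreal (?S s) \<partial>lpos)"
      using B by (simp add: nn_integral_cmult nn_integral_multc ennreal_mult)
    also have "\<dots> = ennreal B * (\<integral>\<^sup>+s. ennreal (?S s) \<partial>lpos)"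
      using g \<eta> by (simp add: nn_integral_cmult nn_integral_dens_X)
    also have "\<dots> \<le> ennreal B * ennreal C1"
      by (intro mult_left_mono C1 \<eta>) simp
    also have "\<dots> = ennreal (C2 * C1 * (mixing_dens a b g / (1 + g)) * (1 / \<eta>))"
      using B C1 by (simp add: B_def mult_ac flip: ennreal_mult)
    finally show "(\<integral>\<^sup>+x. \<integral>\<^sup>+s. ennreal ((norm x)\<^sup>2 * (1 / (1 + g))\<^sup>2 * joint x s g \<eta> * growth x s g \<eta>) \<partial>lpos \<partial>lborel)
      \<le> ennreal (C2 * C1 * (mixing_dens a b g / (1 + g)) * (1 / \<eta>))" .
  qed
qed

text \<open>A weighted area integral of \<open>(1 + r) powr (- 2 - 1 / i)\<close> over the
  half-plane. Integrating over \<open>\<eta>\<close> raises the exponent to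
  \<open>- 1 - 1 / i\<close>, now with base \<open>1 + ln (1 + g)\<close>, and the integral over
  \<open>g\<close> then has order \<open>i\<close>.\<close>

lemma nn_integral_radius:
  obtains C where "C \<ge> 0" "\<And>i. i \<ge> 1 \<Longrightarrow>
    (\<integral>\<^sup>+g. \<integral>\<^sup>+\<eta>. ennreal ((mixing_dens a b g / (1 + g)) * (1 / \<eta>) * decay i g \<eta>) \<partial>lpos \<partial>lpos)
      \<le> ennreal (C * i)"
proof -
  obtain C1 where C1: "C1 \<ge> 0" "\<And>c. c > 0 \<Longrightarrow>
    (\<integral>\<^sup>+g. ennreal (mixing_dens a b g / (1 + g) * (1 + ln (1 + g)) powr (- c - 1)) \<partial>lpos)
      \<le> ennreal (C1 * (1 + 1 / c))"
    using nn_integral_mixing_dens_ln_le[OF a b] by blast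
  show thesis
  proof (rule that)
    show "4 * C1 \<ge> 0" using C1 by simp
    fix i :: real assume i: "i \<ge> 1"
    have inner: "(\<integral>\<^sup>+\<eta>. ennreal ((mixing_dens a b g / (1 + g)) * (1 / \<eta>) * decay i g \<eta>) \<partial>lpos)
        \<le> ennreal 2 * ennreal (mixing_dens a b g / (1 + g) * (1 + ln (1 + g)) powr (- (1 / i) - 1))" if g: "g > 0" for g
    proof -
      let ?c = "1 + 1 / i"
      have "(\<integral>\<^sup>+\<eta>. ennreal ((mixing_dens a b g / (1 + g)) * (1 / \<eta>) * decay i g \<eta>) \<partial>lpos)
          = (\<integral>\<^sup>+\<eta>. ennreal (mixing_dens a b g / (1 + g)) * ennreal (1 / \<eta> * ((1 + ln (1 + g)) + \<bar>ln \<eta>\<bar>) powr (- ?c - 1)) \<partial>lpos)"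
        using g by (intro nn_integral_cong) (simp add: radius_def add.assoc flip: ennreal_mult)
      also have "\<dots> = ennreal (mixing_dens a b g / (1 + g)) * (\<integral>\<^sup>+\<eta>. ennreal (1 / \<eta> * ((1 + ln (1 + g)) + \<bar>ln \<eta>\<bar>) powr (- ?c - 1)) \<partial>lpos)"
        by (rule nn_integral_cmult) measurable
      also have "(\<integral>\<^sup>+\<eta>. ennreal (1 / \<eta> * ((1 + ln (1 + g)) + \<bar>ln \<eta>\<bar>) powr (- ?c - 1)) \<partial>lpos)
          = ennreal (2 * (1 + ln (1 + g)) powr (- ?c) / ?c)"
        using i g by (intro nn_integral_abs_ln) (auto simp: add_pos_nonneg)
      also have "ennreal (mixing_dens a b g / (1 + g)) * ennreal (2 * (1 + ln (1 + g)) powr (- ?c) / ?c)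
          \<le> ennreal (mixing_dens a b g / (1 + g)) * ennreal (2 * (1 + ln (1 + g)) powr (- (1 / i) - 1))"
      proof (intro mult_left_mono ennreal_leI)
        have "2 * (1 + ln (1 + g)) powr (- ?c) / ?c \<le> 2 * (1 + ln (1 + g)) powr (- ?c) / 1"
          using i by (intro divide_left_mono) (auto intro: add_pos_pos)
        moreover have "- ?c = - (1 / i) - 1" by simp
        ultimately show "2 * (1 + ln (1 + g)) powr (- ?c) / ?c \<le> 2 * (1 + ln (1 + g)) powr (- (1 / i) - 1)"
          by (simp only: div_by_1)
      qed simp
      also have "\<dots> = ennreal 2 * ennreal (mixing_dens a b g / (1 + g) * (1 + ln (1 + g)) powr (- (1 / i) - 1))"
        using g by (subst (1 2) ennreal_mult[symmetric]) (auto simp: mult_ac)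
      finally show ?thesis .
    qed
    have "(\<integral>\<^sup>+g. \<integral>\<^sup>+\<eta>. ennreal ((mixing_dens a b g / (1 + g)) * (1 / \<eta>) * decay i g \<eta>) \<partial>lpos \<partial>lpos)
      \<le> (\<integral>\<^sup>+g. ennreal 2 * ennreal (mixing_dens a b g / (1 + g) * (1 + ln (1 + g)) powr (- (1 / i) - 1)) \<partial>lpos)"
      by (intro nn_integral_mono inner) simp
    also have "\<dots> = ennreal 2 * (\<integral>\<^sup>+g. ennreal (mixing_dens a b g / (1 + g) * (1 + ln (1 + g)) powr (- (1 / i) - 1)) \<partial>lpos)"
      by (rule nn_integral_cmult) measurable
    also have "\<dots> \<le> ennreal 2 * ennreal (C1 * (1 + 1 / (1 / i)))"
      using i by (intro mult_left_mono C1) auto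
    also have "\<dots> = ennreal (2 * (C1 * (1 + i)))"
      using C1 i by (subst ennreal_mult) auto
    also have "\<dots> \<le> ennreal (4 * C1 * i)"
      using C1 i mult_left_mono[of 1 i C1] by (intro ennreal_leI) (simp add: algebra_simps)
    finally show "(\<integral>\<^sup>+g. \<integral>\<^sup>+\<eta>. ennreal ((mixing_dens a b g / (1 + g)) * (1 / \<eta>) * decay i g \<eta>) \<partial>lpos \<partial>lpos)
      \<le> ennreal (4 * C1 * i)" .
  qed
qed

end

subsection \<open>Integrated Dirichlet form\<close>

interpretation lpos_pair: pair_sigma_finite lpos lpos ..
interpretation obs_pair: pair_sigma_finite "lborel :: 'a::euclidean_space measure" lpos ..
interpretation par_par: pair_sigma_finite "lpos \<Otimes>\<^sub>M lpos" "lpos \<Otimes>\<^sub>M lpos" ..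
interpretation obs_par: pair_sigma_finite "(lborel :: 'a::euclidean_space measure) \<Otimes>\<^sub>M lpos" "lpos \<Otimes>\<^sub>M lpos" ..

abbreviation par :: "(real \<times> real) measure" where
  "par \<equiv> lpos \<Otimes>\<^sub>M lpos"

abbreviation obs :: "('a::euclidean_space \<times> real) measure" where
  "obs \<equiv> lborel \<Otimes>\<^sub>M lpos"

lemma space_par: "p \<in> space par \<longleftrightarrow> fst p > 0 \<and> snd p > 0"
  by (cases p) (simp add: space_pair_measure)

lemma space_obs: "z \<in> space obs \<longleftrightarrow> snd z > 0"
  by (cases z) (simp add: space_pair_measure)

lemma nn_integral_par:
  "f \<in> borel_measurable par \<Longrightarrow> (\<integral>\<^sup>+p. f p \<partial>par) = (\<integral>\<^sup>+g. \<integral>\<^sup>+\<eta>. f (g, \<eta>) \<partial>lpos \<partial>lpos)"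
  by (rule lpos.nn_integral_fst[symmetric])

lemma nn_integral_obs:
  "f \<in> borel_measurable obs \<Longrightarrow> (\<integral>\<^sup>+z. f z \<partial>obs) = (\<integral>\<^sup>+x. \<integral>\<^sup>+s. f (x, s) \<partial>lpos \<partial>lborel)"
  by (rule lpos.nn_integral_fst[symmetric])

lemma measurable_fst_par [measurable]: "fst \<in> borel_measurable par"
  and measurable_snd_par [measurable]: "snd \<in> borel_measurable par"
  and measurable_fst_obs [measurable]: "fst \<in> borel_measurable obs"
  and measurable_snd_obs [measurable]: "snd \<in> borel_measurable obs"
  using measurable_compose[OF measurable_fst measurable_ident_lpos]
    measurable_compose[OF measurable_snd measurable_ident_lpos]
  by (simp_all add: comp_def)

context shrinkage_prior
begin

lemma measurable_growth [measurable (raw)]: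
  assumes [measurable]: "f1 \<in> borel_measurable M" "f2 \<in> borel_measurable M" "f3 \<in> borel_measurable M" "f4 \<in> borel_measurable M"
  shows "(\<lambda>w. growth (f1 w) (f2 w) (f3 w) (f4 w)) \<in> borel_measurable M"
  unfolding growth_def by measurable

definition jt :: "(real ^ 'p) \<times> real \<Rightarrow> real \<times> real \<Rightarrow> real" where
  "jt z p = joint (fst z) (snd z) (fst p) (snd p)"

definition shrink :: "real \<times> real \<Rightarrow> real" where
  "shrink p = 1 / (1 + fst p)"

definition cutp :: "real \<Rightarrow> real \<times> real \<Rightarrow> real" where
  "cutp i p = hyper_cutoff i (fst p) (snd p)"

abbreviation sq_err :: "((real ^ 'p) \<times> real \<Rightarrow> real ^ 'p) \<Rightarrow> (real ^ 'p) \<times> real \<Rightarrow> real \<times> real \<Rightarrow> real" where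
  "sq_err \<delta> z p \<equiv> (norm (\<delta> z - (1 - shrink p) *\<^sub>R fst z))\<^sup>2"

text \<open>Both copies are weighted by the unnormalized posterior. The division by
  \<open>mass\<close> in \<open>norm_dirichlet\<close> normalizes only one of them; the other
  retains the marginal density of the observation, as required for integrating over
  \<open>obs\<close>.\<close>

definition dirichlet :: "real \<Rightarrow> (real ^ 'p) \<times> real \<Rightarrow> ennreal" where
  "dirichlet i z = (\<integral>\<^sup>+q. \<integral>\<^sup>+p. ennreal (jt z q) * (ennreal (jt z p)
      * ennreal ((shrink p - shrink q)\<^sup>2 * (cutp i p - cutp i q)\<^sup>2)) \<partial>par \<partial>par)"

abbreviation norm_dirichlet :: "real \<Rightarrow> (real ^ 'p) \<times> real \<Rightarrow> ennreal" where
  "norm_dirichlet i z \<equiv> ennreal (2 * (norm (fst z))\<^sup>2 / enn2real (mass (fst z) (snd z))) * dirichlet i z"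

lemma jt_nonneg [simp]: "0 \<le> jt z p"
  by (simp add: jt_def)

lemma measurable_jt [measurable (raw)]:
  assumes [measurable]: "f \<in> M \<rightarrow>\<^sub>M obs" "h \<in> M \<rightarrow>\<^sub>M par"
  shows "(\<lambda>w. jt (f w) (h w)) \<in> borel_measurable M"
  unfolding jt_def by measurable

lemma measurable_shrink [measurable]: "shrink \<in> borel_measurable par"
  unfolding shrink_def by measurable

lemma measurable_cutp [measurable]: "cutp i \<in> borel_measurable par"
  unfolding cutp_def by measurable

lemma nn_integral_jt: "snd z > 0 \<Longrightarrow> (\<integral>\<^sup>+p. ennreal (jt z p) \<partial>par) = mass (fst z) (snd z)"
  by (subst nn_integral_par) (auto simp: jt_def mass_def)

lemma shrink_01: "p \<in> space par \<Longrightarrow> 0 \<le> shrink p \<and> shrink p \<le> 1"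
  by (simp add: shrink_def space_par)

lemma cutp_01: "i > 0 \<Longrightarrow> p \<in> space par \<Longrightarrow> 0 \<le> cutp i p \<and> cutp i p \<le> 1"
  by (simp add: cutp_def hyper_cutoff_def space_par cutoff_nonneg cutoff_le_1 radius_nonneg)

text \<open>The factor \<open>2\<close> stands for the two orderings of the copies by
  \<open>g\<close>. In either of them \<open>(shrink p - shrink q)\<^sup>2\<close> is at most the
  square of the larger \<open>shrink\<close>, and integrating out the copy with the larger
  \<open>g\<close> leaves one factor \<open>mass\<close>.\<close>

lemma dirichlet_le:
  obtains C where "C \<ge> 0" "\<And>i z. i \<ge> 1 \<Longrightarrow> snd z > 0 \<Longrightarrow>
    dirichlet i z \<le> 2 * (\<integral>\<^sup>+p. ennreal (jt z p * (shrink p)\<^sup>2 * (C / i\<^sup>2 * decay i (fst p) (snd p)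
        * growth (fst z) (snd z) (fst p) (snd p))) \<partial>par) * mass (fst z) (snd z)"
proof -
  obtain C where C: "C \<ge> 0" "\<And>i x s g \<eta>. i \<ge> 1 \<Longrightarrow> s > 0 \<Longrightarrow> g > 0 \<Longrightarrow> \<eta> > 0 \<Longrightarrow>
    (\<integral>\<^sup>+g'. \<integral>\<^sup>+\<eta>'. ennreal (joint x s g' \<eta>' * (hyper_cutoff i g \<eta> - hyper_cutoff i g' \<eta>')\<^sup>2) * indicator {g..} g' \<partial>lpos \<partial>lpos)
      \<le> ennreal (C / i\<^sup>2 * decay i g \<eta> * growth x s g \<eta>) * mass x s"
    using nn_integral_joint_cut_diff by blast
  show thesis
  proof (rule that[OF C(1)])
    fix i :: real and z :: "(real ^ 'p) \<times> real" assume i: "i \<ge> 1" and s: "snd z > 0"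
    \<comment> \<open>In \<open>H q p\<close> the point \<open>q\<close> is the copy with the
      smaller \<open>g\<close>, which is kept; \<open>p\<close> is the one to be integrated
      out.\<close>
    define H where "H q p = ennreal (jt z q * (shrink q)\<^sup>2)
      * (ennreal (jt z p * (cutp i q - cutp i p)\<^sup>2) * indicator {fst q..} (fst p))" for q p
    have z: "z \<in> space obs" using s by (simp add: space_obs)
    then have [measurable]: "jt z \<in> borel_measurable par"
      by (intro measurable_jt) auto
    have ind [measurable]: "(\<lambda>w. indicator {fst (fst w)..} (fst (snd w)) :: ennreal) \<in> borel_measurable (par \<Otimes>\<^sub>M par)"
    proof -
      have "(\<lambda>w :: (real \<times> real) \<times> (real \<times> real). indicator {fst (fst w)..} (fst (snd w)) :: ennreal) = (\<lambda>w. if fst (fst w) \<le> fst (snd w) then 1 else 0)"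
        by (auto simp: fun_eq_iff indicator_def)
      then show ?thesis by simp
    qed
    have ind1 [measurable]: "(\<lambda>p. indicator {fst q..} (fst p) :: ennreal) \<in> borel_measurable par" for q :: "real \<times> real"
    proof -
      have "(\<lambda>p :: real \<times> real. indicator {fst q..} (fst p) :: ennreal) = (\<lambda>p. if fst q \<le> fst p then 1 else 0)"
        by (auto simp: fun_eq_iff indicator_def)
      then show ?thesis by simp
    qed
    have Hm [measurable]: "(\<lambda>(q, p). H q p) \<in> borel_measurable (par \<Otimes>\<^sub>M par)"
      unfolding H_def by (simp add: case_prod_beta')
    have pw: "ennreal (jt z q) * (ennreal (jt z p) * ennreal ((shrink p - shrink q)\<^sup>2 * (cutp i p - cutp i q)\<^sup>2)) \<le> H q p + H p q"
      if "q \<in> space par" "p \<in> space par" for q p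
    proof -
      have main: "ennreal (jt z q) * (ennreal (jt z p) * ennreal ((shrink p - shrink q)\<^sup>2 * (cutp i p - cutp i q)\<^sup>2)) \<le> H q p"
        if qp: "q \<in> space par" "p \<in> space par" and le: "fst q \<le> fst p" for q p
      proof -
        have "shrink p \<le> shrink q" "0 \<le> shrink p"
          using qp le by (auto simp: shrink_def space_par intro!: frac_le)
        then have "(shrink p - shrink q)\<^sup>2 \<le> (shrink q)\<^sup>2"
          by (subst power2_commute) (auto intro!: power_mono)
        then have "jt z q * (jt z p * ((shrink p - shrink q)\<^sup>2 * (cutp i p - cutp i q)\<^sup>2))
            \<le> jt z q * (jt z p * ((shrink q)\<^sup>2 * (cutp i p - cutp i q)\<^sup>2))"
          by (intro mult_left_mono mult_right_mono) auto
        then show ?thesis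
          using le unfolding H_def
          by (simp add: power2_commute[of "cutp i q"] ennreal_leI mult_ac flip: ennreal_mult)
      qed
      show ?thesis
      proof (cases "fst q \<le> fst p")
        case True
        then show ?thesis using main[OF that] by (simp add: add_increasing2)
      next
        case False
        then show ?thesis using main[OF that(2,1)]
          by (simp add: add_increasing power2_commute[of "shrink q"] power2_commute[of "cutp i q"] mult.left_commute)
      qed
    qed
    have "dirichlet i z \<le> (\<integral>\<^sup>+q. \<integral>\<^sup>+p. H q p + H p q \<partial>par \<partial>par)"
      unfolding dirichlet_def by (intro nn_integral_mono pw)
    also have "\<dots> = (\<integral>\<^sup>+q. (\<integral>\<^sup>+p. H q p \<partial>par) + (\<integral>\<^sup>+p. H p q \<partial>par) \<partial>par)"
      by (intro nn_integral_cong nn_integral_add) simp_all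
    also have "\<dots> = (\<integral>\<^sup>+q. \<integral>\<^sup>+p. H q p \<partial>par \<partial>par) + (\<integral>\<^sup>+q. \<integral>\<^sup>+p. H p q \<partial>par \<partial>par)"
      by (intro nn_integral_add) simp_all
    also have "(\<integral>\<^sup>+q. \<integral>\<^sup>+p. H p q \<partial>par \<partial>par) = (\<integral>\<^sup>+q. \<integral>\<^sup>+p. H q p \<partial>par \<partial>par)"
      by (rule par_par.Fubini') simp
    also have "(\<integral>\<^sup>+q. \<integral>\<^sup>+p. H q p \<partial>par \<partial>par) \<le> (\<integral>\<^sup>+p. ennreal (jt z p * (shrink p)\<^sup>2 * (C / i\<^sup>2 * decay i (fst p) (snd p)
        * growth (fst z) (snd z) (fst p) (snd p))) * mass (fst z) (snd z) \<partial>par)"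
    proof (rule nn_integral_mono)
      fix q assume q: "q \<in> space par"
      have "(\<integral>\<^sup>+p. H q p \<partial>par) = ennreal (jt z q * (shrink q)\<^sup>2)
          * (\<integral>\<^sup>+p. ennreal (jt z p * (cutp i q - cutp i p)\<^sup>2) * indicator {fst q..} (fst p) \<partial>par)"
        unfolding H_def by (rule nn_integral_cmult) simp
      also have "(\<integral>\<^sup>+p. ennreal (jt z p * (cutp i q - cutp i p)\<^sup>2) * indicator {fst q..} (fst p) \<partial>par)
         = (\<integral>\<^sup>+g'. \<integral>\<^sup>+\<eta>'. ennreal (joint (fst z) (snd z) g' \<eta>' * (hyper_cutoff i (fst q) (snd q) - hyper_cutoff i g' \<eta>')\<^sup>2) * indicator {fst q..} g' \<partial>lpos \<partial>lpos)"
        by (subst nn_integral_par) (simp_all add: jt_def cutp_def)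
      also have "\<dots> \<le> ennreal (C / i\<^sup>2 * decay i (fst q) (snd q) * growth (fst z) (snd z) (fst q) (snd q)) * mass (fst z) (snd z)"
        using q by (intro C i s) (auto simp: space_par)
      also have "ennreal (jt z q * (shrink q)\<^sup>2) * (ennreal (C / i\<^sup>2 * decay i (fst q) (snd q) * growth (fst z) (snd z) (fst q) (snd q)) * mass (fst z) (snd z))
         = ennreal (jt z q * (shrink q)\<^sup>2 * (C / i\<^sup>2 * decay i (fst q) (snd q) * growth (fst z) (snd z) (fst q) (snd q))) * mass (fst z) (snd z)"
        by (subst ennreal_mult'[of "jt z q * (shrink q)\<^sup>2"]) (simp_all add: mult.assoc)
      finally show "(\<integral>\<^sup>+p. H q p \<partial>par) \<le> ennreal (jt z q * (shrink q)\<^sup>2 * (C / i\<^sup>2 * decay i (fst q) (snd q) * growth (fst z) (snd z) (fst q) (snd q))) * mass (fst z) (snd z)"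
        by (simp add: mult_left_mono)
    qed
    also have "\<dots> = (\<integral>\<^sup>+p. ennreal (jt z p * (shrink p)\<^sup>2 * (C / i\<^sup>2 * decay i (fst p) (snd p)
        * growth (fst z) (snd z) (fst p) (snd p))) \<partial>par) * mass (fst z) (snd z)"
      by (rule nn_integral_multc) simp
    finally show "dirichlet i z \<le> 2 * (\<integral>\<^sup>+p. ennreal (jt z p * (shrink p)\<^sup>2 * (C / i\<^sup>2 * decay i (fst p) (snd p)
        * growth (fst z) (snd z) (fst p) (snd p))) \<partial>par) * mass (fst z) (snd z)"
      by (simp add: mult_2 distrib_right add_mono)
  qed
qed

text \<open>The division by \<open>mass\<close> cancels the factor left by the copy that was
  integrated out. After exchanging the integrals, averaging over the observations costs a constant
  and the hyperparameters contribute \<open>i\<close>, against \<open>1 / i\<^sup>2\<close> from the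
  cutoff.\<close>

lemma nn_integral_dirichlet_le:
  obtains C where "C \<ge> 0" "\<And>i. i \<ge> 1 \<Longrightarrow>
    (\<integral>\<^sup>+z. norm_dirichlet i z \<partial>obs) \<le> ennreal (C / i)"
proof -
  obtain C1 where C1: "C1 \<ge> 0" "\<And>i z. i \<ge> 1 \<Longrightarrow> snd z > 0 \<Longrightarrow>
    dirichlet i z \<le> 2 * (\<integral>\<^sup>+p. ennreal (jt z p * (shrink p)\<^sup>2 * (C1 / i\<^sup>2 * decay i (fst p) (snd p)
        * growth (fst z) (snd z) (fst p) (snd p))) \<partial>par) * mass (fst z) (snd z)"
    using dirichlet_le by blast
  obtain C2 where C2: "C2 \<ge> 0" "\<And>g \<eta>. g > 0 \<Longrightarrow> \<eta> > 0 \<Longrightarrow>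
    (\<integral>\<^sup>+x. \<integral>\<^sup>+s. ennreal ((norm x)\<^sup>2 * (1 / (1 + g))\<^sup>2 * joint x s g \<eta> * growth x s g \<eta>) \<partial>lpos \<partial>lborel)
      \<le> ennreal (C2 * (mixing_dens a b g / (1 + g)) * (1 / \<eta>))"
    using nn_integral_joint_growth by blast
  obtain C3 where C3: "C3 \<ge> 0" "\<And>i. i \<ge> 1 \<Longrightarrow>
    (\<integral>\<^sup>+g. \<integral>\<^sup>+\<eta>. ennreal ((mixing_dens a b g / (1 + g)) * (1 / \<eta>) * decay i g \<eta>) \<partial>lpos \<partial>lpos)
      \<le> ennreal (C3 * i)"
    using nn_integral_radius by blast
  have growth0: "0 \<le> growth x s g \<eta>" for x s g \<eta>
    by (simp add: growth_def)
  show thesis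
  proof (rule that)
    show "4 * C1 * C2 * C3 \<ge> 0" using C1 C2 C3 by simp
    fix i :: real assume i: "i \<ge> 1"
    \<comment> \<open>The \<open>4\<close> is the \<open>2\<close> in \<open>norm_dirichlet\<close>
      times the \<open>2\<close> for the two orderings.\<close>
    define K where "K p = 4 * C1 / i\<^sup>2 * decay i (fst p) (snd p)" for p
    have K: "K p \<ge> 0" for p using C1 by (simp add: K_def)
    have [measurable]: "K \<in> borel_measurable par" unfolding K_def by measurable
    define \<Phi> where "\<Phi> z p = (norm (fst z))\<^sup>2 * (shrink p)\<^sup>2 * jt z p * growth (fst z) (snd z) (fst p) (snd p)" for z p
    have \<Phi>: "\<Phi> z p \<ge> 0" for z p by (simp add: \<Phi>_def growth0)
    have \<Phi>_meas [measurable]: "(\<lambda>w. \<Phi> (fst w) (snd w)) \<in> borel_measurable (obs \<Otimes>\<^sub>M par)"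
      unfolding \<Phi>_def by measurable
    have \<Phi>z: "(\<lambda>z. \<Phi> z p) \<in> borel_measurable obs" if "p \<in> space par" for p
      using measurable_compose[OF measurable_Pair2'[OF that] \<Phi>_meas] by simp
    have pw: "norm_dirichlet i z
        \<le> (\<integral>\<^sup>+p. ennreal (K p * \<Phi> z p) \<partial>par)" if "z \<in> space obs" for z
    proof -
      have s: "snd z > 0" using that by (simp add: space_obs)
      from that have [measurable]: "jt z \<in> borel_measurable par"
        by (intro measurable_jt) auto
      define m where "m = enn2real (mass (fst z) (snd z))"
      have m: "mass (fst z) (snd z) = ennreal m" "m > 0"
        using mass_finite[OF s, of "fst z"] mass_pos[OF s, of "fst z"]
        by (auto simp: m_def enn2real_positive_iff)
      define J where "J p = jt z p * (shrink p)\<^sup>2 * (C1 / i\<^sup>2 * decay i (fst p) (snd p)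
        * growth (fst z) (snd z) (fst p) (snd p))" for p
      have J: "J p \<ge> 0" for p using C1 growth0 by (simp add: J_def)
      have [measurable]: "J \<in> borel_measurable par" unfolding J_def by measurable
      have "ennreal (2 * (norm (fst z))\<^sup>2 / m) * dirichlet i z \<le> ennreal (2 * (norm (fst z))\<^sup>2 / m) * (2 * (\<integral>\<^sup>+p. ennreal (J p) \<partial>par) * ennreal m)"
        unfolding J_def m(1)[symmetric] by (intro mult_left_mono C1 i s) simp
      also have "\<dots> = (ennreal (2 * (norm (fst z))\<^sup>2 / m) * (ennreal 2 * ennreal m)) * (\<integral>\<^sup>+p. ennreal (J p) \<partial>par)"
        by (simp add: mult_ac)
      also have "ennreal (2 * (norm (fst z))\<^sup>2 / m) * (ennreal 2 * ennreal m) = ennreal (4 * (norm (fst z))\<^sup>2)"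
      proof -
        have "ennreal (2 * (norm (fst z))\<^sup>2 / m) * (ennreal 2 * ennreal m) = ennreal (2 * (norm (fst z))\<^sup>2 / m * (2 * m))"
        proof -
          have "ennreal 2 * ennreal m = ennreal (2 * m)"
            using m(2) by (intro ennreal_mult[symmetric]) auto
          then show ?thesis
            using m(2) by (simp only:) (intro ennreal_mult[symmetric], auto)
        qed
        then show ?thesis using m(2) by simp
      qed
      also have "ennreal (4 * (norm (fst z))\<^sup>2) * (\<integral>\<^sup>+p. ennreal (J p) \<partial>par) = (\<integral>\<^sup>+p. ennreal (4 * (norm (fst z))\<^sup>2) * ennreal (J p) \<partial>par)"
        by (rule nn_integral_cmult[symmetric]) simp
      also have "\<dots> = (\<integral>\<^sup>+p. ennreal (K p * \<Phi> z p) \<partial>par)"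
        using J by (intro nn_integral_cong) (simp add: K_def \<Phi>_def J_def mult_ac flip: ennreal_mult)
      finally show ?thesis
        by (simp add: m_def)
    qed
    have "(\<integral>\<^sup>+z. norm_dirichlet i z \<partial>obs)
        \<le> (\<integral>\<^sup>+z. \<integral>\<^sup>+p. ennreal (K p * \<Phi> z p) \<partial>par \<partial>obs)"
      by (intro nn_integral_mono pw)
    also have "\<dots> = (\<integral>\<^sup>+p. \<integral>\<^sup>+z. ennreal (K p * \<Phi> z p) \<partial>obs \<partial>par)"
      by (rule obs_par.Fubini'[symmetric]) (simp add: case_prod_beta')
    also have "\<dots> = (\<integral>\<^sup>+p. ennreal (K p) * (\<integral>\<^sup>+z. ennreal (\<Phi> z p) \<partial>obs) \<partial>par)"
      using K \<Phi> \<Phi>z by (intro nn_integral_cong) (simp add: ennreal_mult nn_integral_cmult)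
    also have "\<dots> \<le> (\<integral>\<^sup>+p. ennreal (K p) * ennreal (C2 * (mixing_dens a b (fst p) / (1 + fst p)) * (1 / snd p)) \<partial>par)"
    proof (intro nn_integral_mono mult_left_mono)
      fix p assume p: "p \<in> space par"
      then have [measurable]: "(\<lambda>z. \<Phi> z p) \<in> borel_measurable obs"
        by (rule \<Phi>z)
      have "(\<integral>\<^sup>+z. ennreal (\<Phi> z p) \<partial>obs) = (\<integral>\<^sup>+x. \<integral>\<^sup>+s. ennreal ((norm x)\<^sup>2 * (1 / (1 + fst p))\<^sup>2 * joint x s (fst p) (snd p) * growth x s (fst p) (snd p)) \<partial>lpos \<partial>lborel)"
        by (subst nn_integral_obs) (simp_all add: \<Phi>_def shrink_def jt_def)
      also have "\<dots> \<le> ennreal (C2 * (mixing_dens a b (fst p) / (1 + fst p)) * (1 / snd p))"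
        using p by (intro C2) (auto simp: space_par)
      finally show "(\<integral>\<^sup>+z. ennreal (\<Phi> z p) \<partial>obs) \<le> ennreal (C2 * (mixing_dens a b (fst p) / (1 + fst p)) * (1 / snd p))" .
    qed simp
    also have "\<dots> = (\<integral>\<^sup>+p. ennreal (4 * C1 / i\<^sup>2 * C2) * ennreal (mixing_dens a b (fst p) / (1 + fst p) * (1 / snd p) * decay i (fst p) (snd p)) \<partial>par)"
      using K C1(1) C2(1) by (intro nn_integral_cong) (simp add: K_def space_par mult_ac flip: ennreal_mult)
    also have "\<dots> = ennreal (4 * C1 / i\<^sup>2 * C2) * (\<integral>\<^sup>+p. ennreal (mixing_dens a b (fst p) / (1 + fst p) * (1 / snd p) * decay i (fst p) (snd p)) \<partial>par)"
      by (rule nn_integral_cmult) simp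
    also have "(\<integral>\<^sup>+p. ennreal (mixing_dens a b (fst p) / (1 + fst p) * (1 / snd p) * decay i (fst p) (snd p)) \<partial>par)
       = (\<integral>\<^sup>+g. \<integral>\<^sup>+\<eta>. ennreal ((mixing_dens a b g / (1 + g)) * (1 / \<eta>) * decay i g \<eta>) \<partial>lpos \<partial>lpos)"
      by (subst nn_integral_par) simp_all
    also have "ennreal (4 * C1 / i\<^sup>2 * C2) * \<dots> \<le> ennreal (4 * C1 / i\<^sup>2 * C2) * ennreal (C3 * i)"
      by (intro mult_left_mono C3 i) simp
    also have "\<dots> = ennreal (4 * C1 / i\<^sup>2 * C2 * (C3 * i))"
      using C1(1) C2(1) C3(1) i by (intro ennreal_mult[symmetric]) auto
    also have "4 * C1 / i\<^sup>2 * C2 * (C3 * i) = 4 * C1 * C2 * C3 / i"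
      using i by (simp add: power2_eq_square)
    finally show "(\<integral>\<^sup>+z. norm_dirichlet i z \<partial>obs) \<le> ennreal (4 * C1 * C2 * C3 / i)" .
  qed
qed

end

subsection \<open>Bayes risks\<close>

lemma nn_integral_dens_S:
  assumes "n \<ge> 1" "\<eta> > 0"
  shows "(\<integral>\<^sup>+s. ennreal (dens_S n \<eta> s) \<partial>lpos) = 1"
proof -
  define k where "k = real n / 2"
  have k: "k > 0" using assms by (simp add: k_def)
  have G: "Gamma k > 0" using k by (rule Gamma_real_pos)
  define c where "c = \<eta> powr k / (Gamma k * 2 powr k)"
  have c: "c \<ge> 0" using G by (simp add: c_def)
  have "(\<integral>\<^sup>+s. ennreal (dens_S n \<eta> s) \<partial>lpos) = (\<integral>\<^sup>+s. ennreal c * ennreal (s powr (k - 1) * exp (- (\<eta> / 2) * s)) \<partial>lpos)"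
    using c by (intro nn_integral_cong) (simp add: dens_S_def k_def[symmetric] c_def mult.assoc flip: ennreal_mult)
  also have "\<dots> = ennreal c * (\<integral>\<^sup>+s. ennreal (s powr (k - 1) * exp (- (\<eta> / 2) * s)) \<partial>lpos)"
    by (rule nn_integral_cmult) simp
  also have "(\<integral>\<^sup>+s. ennreal (s powr (k - 1) * exp (- (\<eta> / 2) * s)) \<partial>lpos) = ennreal (Gamma k * (\<eta> / 2) powr (- k))"
    using k assms by (intro nn_integral_gamma) auto
  also have "ennreal c * \<dots> = ennreal (c * (Gamma k * (\<eta> / 2) powr (- k)))"
    using c G by (intro ennreal_mult[symmetric]) auto
  also have "c * (Gamma k * (\<eta> / 2) powr (- k)) = 1"
    using G assms by (simp add: c_def powr_divide powr_minus_divide)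
  finally show ?thesis by simp
qed

text \<open>All laws of the observation become densities with respect to the fixed measure
  \<open>obs\<close>. This allows risks to be integrated over the parameters, and makes estimators
  that agree almost everywhere in \<open>obs\<close> have the same risk.\<close>

lemma obs_law_eq:
  fixes \<theta> :: "real ^ 'p::finite"
  assumes "n \<ge> 1"
  shows "obs_law n \<theta> \<eta> = density obs (\<lambda>(x, s). ennreal (dens_X \<theta> \<eta> x) * ennreal (dens_S n \<eta> s))"
  unfolding obs_law_def
proof (rule pair_measure_density)
  show "sigma_finite_measure (density lpos (\<lambda>s. ennreal (dens_S n \<eta> s)))"
    by (subst lpos.sigma_finite_iff_density_finite) auto
qed (auto intro: sigma_finite_lpos)

lemma estimator_iff_obs: "estimator \<delta> \<longleftrightarrow> \<delta> \<in> borel_measurable (obs :: ((real ^ 'p::finite) \<times> real) measure)"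
proof -
  have "sets (borel \<Otimes>\<^sub>M restrict_space borel {0<..}) = sets (obs :: ((real ^ 'p) \<times> real) measure)"
    by (intro sets_pair_measure_cong sets_restrict_space_cong) auto
  then show ?thesis
    unfolding estimator_def by (simp cong: measurable_cong_sets)
qed

lemma risk_eq:
  fixes \<delta> :: "(real ^ 'p::finite) \<times> real \<Rightarrow> real ^ 'p"
  assumes "n \<ge> 1" and [measurable]: "\<delta> \<in> borel_measurable obs"
  shows "risk n \<delta> \<theta> \<eta> = (\<integral>\<^sup>+z. ennreal (dens_X \<theta> \<eta> (fst z)) * ennreal (dens_S n \<eta> (snd z))
      * ennreal (\<eta> * (norm (\<delta> z - \<theta>))\<^sup>2) \<partial>obs)"
  unfolding risk_def obs_law_eq[OF assms(1)]
  by (subst nn_integral_density) (auto simp: case_prod_beta')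

context shrinkage_prior
begin

section \<open>Decomposition of the Bayes risk by observation\<close>

lemma measurable_gauss_moment2 [measurable (raw)]:
  assumes [measurable]: "f \<in> borel_measurable M"
  shows "(\<lambda>w. gauss_moment2 TYPE('p) (f w)) \<in> borel_measurable M"
  unfolding gauss_moment2_def by measurable

text \<open>Given the hyperparameter and the observation, \<open>\<theta>\<close> has precision
  \<open>\<eta> * (1 + g) / g\<close>; this is its expected squared distance from its conditional
  mean. It does not involve the observation.\<close>

definition cond_moment :: "real \<times> real \<Rightarrow> ennreal" where
  "cond_moment p = gauss_moment2 TYPE('p) (snd p * (1 + fst p) / fst p)"

lemma measurable_cond_moment [measurable]: "cond_moment \<in> borel_measurable par"
  unfolding cond_moment_def by measurable

text \<open>Completing the square replaces prior times likelihood by the marginal density of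
  \<open>x\<close> times the conditional density of \<open>\<theta>\<close>, and the expected loss
  then splits into bias and variance. Only the bias involves \<open>\<delta>\<close>.\<close>

lemma integrated_risk:
  assumes \<delta> [measurable]: "\<delta> \<in> borel_measurable obs" and p: "p \<in> space par"
  shows "ennreal (mixing_dens a b (fst p) / snd p) * (\<integral>\<^sup>+\<theta>. ennreal (dens_X 0 (snd p / fst p) \<theta>) * risk n \<delta> \<theta> (snd p) \<partial>lborel)
    = (\<integral>\<^sup>+z. ennreal (jt z p) * (ennreal (sq_err \<delta> z p) + cond_moment p) \<partial>obs)"
proof -
  obtain g \<eta> where p_eq: "p = (g, \<eta>)" and g: "g > 0" and \<eta>: "\<eta> > 0"
    using p by (cases p) (auto simp: space_par)
  let ?m = "\<lambda>z :: (real ^ 'p) \<times> real. (g / (1 + g)) *\<^sub>R fst z"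
  let ?c = "\<eta> * (1 + g) / g"
  have c: "?c > 0" using g \<eta> by simp
  have "(\<integral>\<^sup>+\<theta>. ennreal (dens_X 0 (\<eta> / g) \<theta>) * risk n \<delta> \<theta> \<eta> \<partial>lborel)
      = (\<integral>\<^sup>+\<theta>. \<integral>\<^sup>+z. ennreal (dens_X 0 (\<eta> / (1 + g)) (fst z) * dens_S n \<eta> (snd z) * \<eta>)
          * ennreal (dens_X (?m z) ?c \<theta> * (norm (\<delta> z - \<theta>))\<^sup>2) \<partial>obs \<partial>lborel)"
  proof (rule nn_integral_cong)
    fix \<theta> :: "real ^ 'p"
    have "ennreal (dens_X 0 (\<eta> / g) \<theta>) * risk n \<delta> \<theta> \<eta> = (\<integral>\<^sup>+z. ennreal (dens_X 0 (\<eta> / g) \<theta>) *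
        (ennreal (dens_X \<theta> \<eta> (fst z)) * ennreal (dens_S n \<eta> (snd z)) * ennreal (\<eta> * (norm (\<delta> z - \<theta>))\<^sup>2)) \<partial>obs)"
      unfolding risk_eq[OF n \<delta>] by (rule nn_integral_cmult[symmetric]) measurable
    also have "\<dots> = (\<integral>\<^sup>+z. ennreal (dens_X 0 (\<eta> / (1 + g)) (fst z) * dens_S n \<eta> (snd z) * \<eta>)
          * ennreal (dens_X (?m z) ?c \<theta> * (norm (\<delta> z - \<theta>))\<^sup>2) \<partial>obs)"
    proof (rule nn_integral_cong)
      fix z :: "(real ^ 'p) \<times> real"
      have "dens_X 0 (\<eta> / g) \<theta> * (dens_X \<theta> \<eta> (fst z) * dens_S n \<eta> (snd z) * (\<eta> * (norm (\<delta> z - \<theta>))\<^sup>2))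
          = (dens_X 0 (\<eta> / g) \<theta> * dens_X \<theta> \<eta> (fst z)) * (dens_S n \<eta> (snd z) * (\<eta> * (norm (\<delta> z - \<theta>))\<^sup>2))"
        by simp
      also have "\<dots> = dens_X 0 (\<eta> / (1 + g)) (fst z) * dens_S n \<eta> (snd z) * \<eta>
          * (dens_X (?m z) ?c \<theta> * (norm (\<delta> z - \<theta>))\<^sup>2)"
        unfolding dens_X_mult_dens_X[OF g \<eta>] by (simp only: mult_ac)
      finally show "ennreal (dens_X 0 (\<eta> / g) \<theta>) * (ennreal (dens_X \<theta> \<eta> (fst z)) * ennreal (dens_S n \<eta> (snd z)) * ennreal (\<eta> * (norm (\<delta> z - \<theta>))\<^sup>2))
          = ennreal (dens_X 0 (\<eta> / (1 + g)) (fst z) * dens_S n \<eta> (snd z) * \<eta>) * ennreal (dens_X (?m z) ?c \<theta> * (norm (\<delta> z - \<theta>))\<^sup>2)"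
        using \<eta> dens_S_nonneg[OF n] by (simp add: ennreal_mult[symmetric])
    qed
    finally show "ennreal (dens_X 0 (\<eta> / g) \<theta>) * risk n \<delta> \<theta> \<eta> = \<dots>" .
  qed
  also have "\<dots> = (\<integral>\<^sup>+z. \<integral>\<^sup>+\<theta>. ennreal (dens_X 0 (\<eta> / (1 + g)) (fst z) * dens_S n \<eta> (snd z) * \<eta>)
          * ennreal (dens_X (?m z) ?c \<theta> * (norm (\<delta> z - \<theta>))\<^sup>2) \<partial>lborel \<partial>obs)"
  proof -
    interpret pair_sigma_finite "obs :: ((real ^ 'p) \<times> real) measure" "lborel :: (real ^ 'p) measure" ..
    show ?thesis
      by (rule Fubini') measurable
  qed
  also have "\<dots> = (\<integral>\<^sup>+z. ennreal (dens_X 0 (\<eta> / (1 + g)) (fst z) * dens_S n \<eta> (snd z) * \<eta>)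
          * (ennreal ((norm (\<delta> z - ?m z))\<^sup>2) + cond_moment p) \<partial>obs)"
    by (intro nn_integral_cong) (simp add: nn_integral_cmult nn_integral_dens_X_sq_dist[OF c] cond_moment_def p_eq)
  finally have "ennreal (mixing_dens a b g / \<eta>) * (\<integral>\<^sup>+\<theta>. ennreal (dens_X 0 (\<eta> / g) \<theta>) * risk n \<delta> \<theta> \<eta> \<partial>lborel)
     = (\<integral>\<^sup>+z. ennreal (mixing_dens a b g / \<eta>) * (ennreal (dens_X 0 (\<eta> / (1 + g)) (fst z) * dens_S n \<eta> (snd z) * \<eta>)
          * (ennreal ((norm (\<delta> z - ?m z))\<^sup>2) + cond_moment p)) \<partial>obs)"
    by (simp add: nn_integral_cmult)
  also have "\<dots> = (\<integral>\<^sup>+z. ennreal (jt z p) * (ennreal (sq_err \<delta> z p) + cond_moment p) \<partial>obs)"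
  proof (rule nn_integral_cong)
    fix z :: "(real ^ 'p) \<times> real"
    have "g / (1 + g) = 1 - shrink p"
      using g by (simp add: shrink_def p_eq field_simps)
    moreover have "ennreal (mixing_dens a b g / \<eta>) * ennreal (dens_X 0 (\<eta> / (1 + g)) (fst z) * dens_S n \<eta> (snd z) * \<eta>) = ennreal (jt z p)"
      using \<eta> dens_S_nonneg[OF n] by (simp add: jt_def joint_def p_eq flip: ennreal_mult)
    ultimately show "ennreal (mixing_dens a b g / \<eta>) * (ennreal (dens_X 0 (\<eta> / (1 + g)) (fst z) * dens_S n \<eta> (snd z) * \<eta>)
          * (ennreal ((norm (\<delta> z - ?m z))\<^sup>2) + cond_moment p))
        = ennreal (jt z p) * (ennreal (sq_err \<delta> z p) + cond_moment p)"
      by (simp flip: mult.assoc)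
  qed
  finally show ?thesis
    by (simp add: p_eq)
qed

text \<open>The unnormalized expected loss at an observation under the posterior weighted by the
  squared cutoff, without the conditional variance of \<open>\<theta>\<close>. That part is common
  to all estimators and is kept apart in \<open>post_moment\<close>.\<close>

definition post_risk :: "real \<Rightarrow> ((real ^ 'p) \<times> real \<Rightarrow> real ^ 'p) \<Rightarrow> (real ^ 'p) \<times> real \<Rightarrow> ennreal" where
  "post_risk i \<delta> z = (\<integral>\<^sup>+p. ennreal (jt z p) * ennreal (sq_err \<delta> z p * (cutp i p)\<^sup>2) \<partial>par)"

definition post_moment :: "real \<Rightarrow> (real ^ 'p) \<times> real \<Rightarrow> ennreal" where
  "post_moment i z = (\<integral>\<^sup>+p. ennreal (jt z p) * (cond_moment p * ennreal ((cutp i p)\<^sup>2)) \<partial>par)"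

definition post_mass :: "real \<Rightarrow> (real ^ 'p) \<times> real \<Rightarrow> ennreal" where
  "post_mass i z = (\<integral>\<^sup>+p. ennreal (jt z p) * ennreal ((cutp i p)\<^sup>2) \<partial>par)"

definition bayes_risk :: "real \<Rightarrow> ((real ^ 'p) \<times> real \<Rightarrow> real ^ 'p) \<Rightarrow> ennreal" where
  "bayes_risk i \<delta> = (\<integral>\<^sup>+p. ennreal ((cutp i p)\<^sup>2) * (ennreal (mixing_dens a b (fst p) / snd p)
     * (\<integral>\<^sup>+\<theta>. ennreal (dens_X 0 (snd p / fst p) \<theta>) * risk n \<delta> \<theta> (snd p) \<partial>lborel)) \<partial>par)"

lemma bayes_risk_mono:
  assumes "\<And>\<theta> \<eta>. \<eta> > 0 \<Longrightarrow> risk n \<delta>' \<theta> \<eta> \<le> risk n \<delta> \<theta> \<eta>"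
  shows "bayes_risk i \<delta>' \<le> bayes_risk i \<delta>"
  unfolding bayes_risk_def using assms
  by (intro nn_integral_mono mult_left_mono) (auto simp: space_par)

lemma measurable_jt_z: "z \<in> space obs \<Longrightarrow> jt z \<in> borel_measurable par"
  by (intro measurable_jt) auto

lemma measurable_jt_p: "p \<in> space par \<Longrightarrow> (\<lambda>z. jt z p) \<in> borel_measurable obs"
  by (intro measurable_jt) auto

lemma measurable_post_risk [measurable]:
  assumes [measurable]: "\<delta> \<in> borel_measurable obs"
  shows "post_risk i \<delta> \<in> borel_measurable obs"
  unfolding post_risk_def by measurable

lemma measurable_post_moment [measurable]: "post_moment i \<in> borel_measurable obs"
  unfolding post_moment_def by measurable

lemma measurable_post_mass [measurable]: "post_mass i \<in> borel_measurable obs"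
  unfolding post_mass_def by measurable

text \<open>The second summand is the same for every estimator, so Bayes risks can be compared
  through \<open>post_risk\<close>, one observation at a time.\<close>

lemma bayes_risk_eq:
  assumes \<delta> [measurable]: "\<delta> \<in> borel_measurable obs"
  shows "bayes_risk i \<delta> = (\<integral>\<^sup>+z. post_risk i \<delta> z \<partial>obs) + (\<integral>\<^sup>+z. post_moment i z \<partial>obs)"
proof -
  have "bayes_risk i \<delta> = (\<integral>\<^sup>+p. ennreal ((cutp i p)\<^sup>2)
     * (\<integral>\<^sup>+z. ennreal (jt z p) * (ennreal (sq_err \<delta> z p) + cond_moment p) \<partial>obs) \<partial>par)"
    unfolding bayes_risk_def by (intro nn_integral_cong) (simp add: integrated_risk[OF \<delta>])
  also have "\<dots> = (\<integral>\<^sup>+p. \<integral>\<^sup>+z. ennreal ((cutp i p)\<^sup>2)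
     * (ennreal (jt z p) * (ennreal (sq_err \<delta> z p) + cond_moment p)) \<partial>obs \<partial>par)"
  proof (rule nn_integral_cong, rule nn_integral_cmult[symmetric])
    fix p assume "p \<in> space par"
    note measurable_jt_p[OF this, measurable]
    show "(\<lambda>z. ennreal (jt z p) * (ennreal (sq_err \<delta> z p) + cond_moment p)) \<in> borel_measurable obs"
      by measurable
  qed
  also have "\<dots> = (\<integral>\<^sup>+z. \<integral>\<^sup>+p. ennreal ((cutp i p)\<^sup>2)
     * (ennreal (jt z p) * (ennreal (sq_err \<delta> z p) + cond_moment p)) \<partial>par \<partial>obs)"
    by (rule obs_par.Fubini') measurable
  also have "\<dots> = (\<integral>\<^sup>+z. post_risk i \<delta> z + post_moment i z \<partial>obs)"
  proof (rule nn_integral_cong)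
    fix z :: "(real ^ 'p) \<times> real" assume "z \<in> space obs"
    note measurable_jt_z[OF this, measurable]
    have "(\<integral>\<^sup>+p. ennreal ((cutp i p)\<^sup>2)
       * (ennreal (jt z p) * (ennreal (sq_err \<delta> z p) + cond_moment p)) \<partial>par)
      = (\<integral>\<^sup>+p. ennreal (jt z p) * ennreal (sq_err \<delta> z p * (cutp i p)\<^sup>2)
         + ennreal (jt z p) * (cond_moment p * ennreal ((cutp i p)\<^sup>2)) \<partial>par)"
      by (intro nn_integral_cong) (simp add: ennreal_mult distrib_left mult_ac)
    also have "\<dots> = post_risk i \<delta> z + post_moment i z"
      unfolding post_risk_def post_moment_def by (rule nn_integral_add) measurable
    finally show "(\<integral>\<^sup>+p. ennreal ((cutp i p)\<^sup>2)
       * (ennreal (jt z p) * (ennreal (sq_err \<delta> z p) + cond_moment p)) \<partial>par)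
      = post_risk i \<delta> z + post_moment i z" .
  qed
  also have "\<dots> = (\<integral>\<^sup>+z. post_risk i \<delta> z \<partial>obs) + (\<integral>\<^sup>+z. post_moment i z \<partial>obs)"
    by (rule nn_integral_add) measurable
  finally show ?thesis .
qed

text \<open>The posterior mean of \<open>shrink\<close> under the full posterior, without any
  cutoff. For \<open>s > 0\<close> both integrals are finite and \<open>mass\<close> is positive, so
  no default value of \<open>enn2real\<close> or of the division intervenes.\<close>

definition post_shrink :: "(real ^ 'p) \<times> real \<Rightarrow> real" where
  "post_shrink z = enn2real (\<integral>\<^sup>+p. ennreal (jt z p) * ennreal (shrink p) \<partial>par) / enn2real (mass (fst z) (snd z))"

text \<open>The form in which \<open>\<delta>\<^sub>*\<close> enters the risk comparison. Its
  agreement with the defining quotient of integrals over \<open>(\<theta>, \<eta>)\<close> for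
  \<open>s > 0\<close> is a separate matter, settled by Fubini.\<close>

definition bayes_est :: "(real ^ 'p) \<times> real \<Rightarrow> real ^ 'p" where
  "bayes_est z = (1 - post_shrink z) *\<^sub>R fst z"

lemma measurable_bayes_est [measurable]: "bayes_est \<in> borel_measurable obs"
  unfolding bayes_est_def post_shrink_def mass_def by measurable

lemma post_shrink_01:
  assumes "z \<in> space obs"
  shows "0 \<le> post_shrink z" "post_shrink z \<le> 1"
proof -
  have s: "snd z > 0" using assms by (simp add: space_obs)
  have "(\<integral>\<^sup>+p. ennreal (jt z p) * ennreal (shrink p) \<partial>par) \<le> (\<integral>\<^sup>+p. ennreal (jt z p) \<partial>par)"
    using shrink_01 by (intro nn_integral_mono) (auto simp: mult_left_le simp flip: ennreal_mult' intro!: ennreal_leI)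
  then have "enn2real (\<integral>\<^sup>+p. ennreal (jt z p) * ennreal (shrink p) \<partial>par) \<le> enn2real (mass (fst z) (snd z))"
    using mass_finite[OF s] by (simp add: nn_integral_jt[OF s] enn2real_mono)
  then show "0 \<le> post_shrink z" "post_shrink z \<le> 1"
    unfolding post_shrink_def by (auto simp: divide_le_eq_1 less_le)
qed

text \<open>The weighted comparison for the unnormalized posterior at \<open>z\<close>, with
  \<open>A\<close> the difference of the two estimators there. The first term on the left is the
  gain that penalizes every \<open>\<delta>\<close> different from \<open>bayes_est\<close>.\<close>

lemma post_risk_comparison:
  assumes z: "z \<in> space obs" and i: "i > 0"
  shows "ennreal ((norm (\<delta> z - bayes_est z))\<^sup>2 / 2) * post_mass i z + post_risk i bayes_est z
    \<le> post_risk i \<delta> z + norm_dirichlet i z"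
proof -
  have s: "snd z > 0" using z by (simp add: space_obs)
  note measurable_jt_z[OF z, measurable]
  define Q where "Q = density par (\<lambda>p. ennreal (jt z p))"
  define m where "m = enn2real (mass (fst z) (snd z))"
  have m: "mass (fst z) (snd z) = ennreal m" "m > 0"
    using mass_finite[OF s, of "fst z"] mass_pos[OF s, of "fst z"]
    by (auto simp: m_def enn2real_positive_iff)
  have emQ: "emeasure Q (space Q) = ennreal m"
  proof -
    have "emeasure Q (space Q) = (\<integral>\<^sup>+p. ennreal (jt z p) * indicator (space par) p \<partial>par)"
      unfolding Q_def space_density by (rule emeasure_density) simp_all
    also have "\<dots> = (\<integral>\<^sup>+p. ennreal (jt z p) \<partial>par)"
      by (intro nn_integral_cong) simp
    finally show ?thesis by (simp add: nn_integral_jt[OF s] m)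
  qed
  interpret Q: finite_measure Q
    by (rule finite_measureI) (simp add: emQ)
  have spQ: "space Q = space par" by (simp add: Q_def)
  have setsQ [measurable_cong]: "sets Q = sets par" by (simp add: Q_def)
  have nnQ: "(\<integral>\<^sup>+p. f p \<partial>Q) = (\<integral>\<^sup>+p. ennreal (jt z p) * f p \<partial>par)" if "f \<in> borel_measurable par" for f
    unfolding Q_def using that by (intro nn_integral_density) simp_all
  have mQ: "m = measure Q (space Q)"
    using m(2) by (simp add: measure_def emQ)
  have E: "post_shrink z = (LINT p|Q. shrink p) / m"
  proof -
    have "(LINT p|Q. shrink p) = enn2real (\<integral>\<^sup>+p. ennreal (shrink p) \<partial>Q)"
      using shrink_01 by (intro integral_eq_nn_integral) (auto simp: spQ)
    then show ?thesis
      by (simp add: post_shrink_def nnQ m_def)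
  qed
  let ?A = "\<delta> z - bayes_est z" and ?E = "post_shrink z"
  have bE: "bayes_est z - (1 - shrink p) *\<^sub>R fst z = (shrink p - ?E) *\<^sub>R fst z" for p
    by (simp add: bayes_est_def algebra_simps)
  have dE: "?A + (shrink p - ?E) *\<^sub>R fst z = \<delta> z - (1 - shrink p) *\<^sub>R fst z" for p
    by (simp add: bayes_est_def algebra_simps)
  have "ennreal ((norm ?A)\<^sup>2 / 2) * (\<integral>\<^sup>+p. ennreal ((cutp i p)\<^sup>2) \<partial>Q)
      + (\<integral>\<^sup>+p. ennreal ((norm ((shrink p - ?E) *\<^sub>R fst z))\<^sup>2 * (cutp i p)\<^sup>2) \<partial>Q)
    \<le> (\<integral>\<^sup>+p. ennreal ((norm (?A + (shrink p - ?E) *\<^sub>R fst z))\<^sup>2 * (cutp i p)\<^sup>2) \<partial>Q)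
      + ennreal (2 * (norm (fst z))\<^sup>2 / m)
        * (\<integral>\<^sup>+q. \<integral>\<^sup>+p. ennreal ((shrink p - shrink q)\<^sup>2 * (cutp i p - cutp i q)\<^sup>2) \<partial>Q \<partial>Q)"
    using shrink_01 cutp_01[OF i] mQ m(2) E
    by (intro Q.weighted_risk_comparison) (auto simp: spQ)
  moreover have "(\<integral>\<^sup>+q. \<integral>\<^sup>+p. ennreal ((shrink p - shrink q)\<^sup>2 * (cutp i p - cutp i q)\<^sup>2) \<partial>Q \<partial>Q) = dirichlet i z"
  proof -
    have "(\<integral>\<^sup>+q. \<integral>\<^sup>+p. ennreal ((shrink p - shrink q)\<^sup>2 * (cutp i p - cutp i q)\<^sup>2) \<partial>Q \<partial>Q)
        = (\<integral>\<^sup>+q. \<integral>\<^sup>+p. ennreal (jt z p) * ennreal ((shrink p - shrink q)\<^sup>2 * (cutp i p - cutp i q)\<^sup>2) \<partial>par \<partial>Q)"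
      by (intro nn_integral_cong nnQ) measurable
    also have "\<dots> = (\<integral>\<^sup>+q. ennreal (jt z q) * (\<integral>\<^sup>+p. ennreal (jt z p) * ennreal ((shrink p - shrink q)\<^sup>2 * (cutp i p - cutp i q)\<^sup>2) \<partial>par) \<partial>par)"
      by (rule nnQ) measurable
    also have "\<dots> = dirichlet i z"
      unfolding dirichlet_def by (intro nn_integral_cong nn_integral_cmult[symmetric]) measurable
    finally show ?thesis .
  qed
  ultimately show ?thesis
    unfolding post_mass_def post_risk_def bE m_def[symmetric] by (simp add: nnQ dE)
qed

end

text \<open>Connects the set integrals over \<open>(\<theta>, \<eta>)\<close> in the definition of
  the estimator with product measures. The measure \<open>obs\<close> thus serves both for
  \<open>(x, s)\<close> and for \<open>(\<theta>, \<eta>)\<close>.\<close>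

lemma restrict_lborel_halfspace:
  "restrict_space (lborel :: ('a::euclidean_space \<times> real) measure) (UNIV \<times> {0<..}) = obs"
proof (rule pair_measure_eqI[symmetric])
  show "sigma_finite_measure (lborel :: 'a measure)" "sigma_finite_measure lpos"
    by (rule sigma_finite_lborel sigma_finite_lpos)+
  have S: "UNIV \<times> {0<..} \<in> sets (borel :: ('a \<times> real) measure)"
    by (simp add: borel_prod[symmetric])
  show "sets (obs :: ('a \<times> real) measure) = sets (restrict_space lborel (UNIV \<times> {0<..}))"
  proof (rule antisym)
    show "sets (obs :: ('a \<times> real) measure) \<subseteq> sets (restrict_space lborel (UNIV \<times> {0<..}))"
    proof (rule sets_pair_in_sets)
      fix A B assume A: "A \<in> sets (lborel :: 'a measure)" and B: "B \<in> sets lpos"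
      then obtain B' where B': "B' \<in> sets borel" "B = {0<..} \<inter> B'"
        by (auto simp: sets_restrict_space)
      have "A \<times> B = (UNIV \<times> {0<..}) \<inter> (A \<times> B')"
        using B' by auto
      moreover have "A \<times> B' \<in> sets (borel :: ('a \<times> real) measure)"
        using A B' by (simp add: borel_prod[symmetric])
      ultimately show "A \<times> B \<in> sets (restrict_space lborel (UNIV \<times> {0<..}))"
        by (auto simp: sets_restrict_space)
    qed
    show "sets (restrict_space lborel (UNIV \<times> {0<..})) \<subseteq> sets (obs :: ('a \<times> real) measure)"
    proof
      fix X :: "('a \<times> real) set" assume "X \<in> sets (restrict_space lborel (UNIV \<times> {0<..}))"
      then obtain Y where Y: "Y \<in> sets (borel :: ('a \<times> real) measure)" "X = (UNIV \<times> {0<..}) \<inter> Y"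
        by (auto simp: sets_restrict_space)
      have "(\<lambda>z. (fst z, snd z)) \<in> obs \<rightarrow>\<^sub>M (borel :: ('a \<times> real) measure)"
        unfolding borel_prod[symmetric] by measurable
      from measurable_sets[OF this Y(1)] have "Y \<inter> space obs \<in> sets obs"
        by (simp add: vimage_def)
      moreover have "Y \<inter> space obs = X"
        using Y(2) by (auto simp: space_obs)
      ultimately show "X \<in> sets obs" by simp
    qed
  qed
  fix A B assume A: "A \<in> sets (lborel :: 'a measure)" and B: "B \<in> sets lpos"
  then have B': "B \<in> sets borel" "B \<subseteq> {0<..}"
    by (auto simp: sets_restrict_space)
  have "emeasure (restrict_space lborel (UNIV \<times> {0<..})) (A \<times> B) = emeasure lborel (A \<times> B)"
    using B' S by (intro emeasure_restrict_space) auto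
  also have "\<dots> = emeasure lborel A * emeasure lborel B"
    using A B' by (simp add: lborel_prod[symmetric] lborel.emeasure_pair_measure_Times)
  also have "emeasure lborel B = emeasure lpos B"
    using B' by (intro emeasure_restrict_space[symmetric]) auto
  finally show "emeasure lborel A * emeasure lpos B = emeasure (restrict_space lborel (UNIV \<times> {0<..})) (A \<times> B)" ..
qed

context shrinkage_prior
begin

text \<open>Where the cutoff is nonzero, \<open>radius < exp i\<close> and hence
  \<open>1 + g \<le> exp (exp i)\<close>, so any polynomial decay can be bought with a constant. Two
  powers of \<open>1 + g\<close> compensate the growth of the second moments, and the exponent
  \<open>- 3\<close> is that of \<open>decay\<close> at \<open>i = 1\<close>.\<close>

lemma cutp_sq_le:
  assumes "i > 0" "p \<in> space par"
  shows "(cutp i p)\<^sup>2 \<le> exp (2 * exp i) * (1 + exp i) ^ 3 / (1 + fst p)\<^sup>2 * (1 + radius (fst p) (snd p)) powr (- 3)"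
proof -
  let ?R = "exp i" and ?r = "radius (fst p) (snd p)"
  have g: "fst p > 0" using assms by (simp add: space_par)
  have r: "?r \<ge> 0" using g by (rule radius_nonneg)
  show ?thesis
  proof (cases "?r \<ge> ?R")
    case True
    then have "cutp i p = 0"
      using assms by (simp add: cutp_def hyper_cutoff_def cutoff_eq_0)
    then show ?thesis by simp
  next
    case False
    have "ln (1 + fst p) \<le> ?R"
      using False by (simp add: radius_def)
    then have "exp (ln (1 + fst p)) \<le> exp ?R"
      by simp
    then have "1 + fst p \<le> exp ?R"
      using g by simp
    then have "(1 + fst p)\<^sup>2 \<le> (exp ?R)\<^sup>2"
      using g by (intro power_mono) auto
    also have "\<dots> = exp (2 * ?R)" by (simp add: exp_double)
    finally have 1: "1 \<le> exp (2 * ?R) / (1 + fst p)\<^sup>2"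
      using g by (simp add: le_divide_eq)
    have "(1 + ?r) ^ 3 \<le> (1 + ?R) ^ 3"
      using False r by (intro power_mono) auto
    then have 2: "1 \<le> (1 + ?R) ^ 3 * (1 + ?r) powr (- 3)"
      using r by (simp add: powr_minus_divide powr_realpow le_divide_eq)
    have "(cutp i p)\<^sup>2 \<le> 1"
      using cutp_01[OF assms] by (simp add: power_le_one)
    also have "\<dots> \<le> exp (2 * ?R) / (1 + fst p)\<^sup>2 * ((1 + ?R) ^ 3 * (1 + ?r) powr (- 3))"
      using mult_mono[OF 1 2] by simp
    finally show ?thesis by simp
  qed
qed

lemma nn_integral_jt_norm_sq:
  assumes p: "p \<in> space par"
  shows "(\<integral>\<^sup>+z. ennreal (jt z p) * ennreal ((norm (fst z))\<^sup>2) \<partial>obs)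
      = ennreal (mixing_dens a b (fst p)) * gauss_moment2 TYPE('p) (snd p / (1 + fst p))"
    "(\<integral>\<^sup>+z. ennreal (jt z p) \<partial>obs) = ennreal (mixing_dens a b (fst p))"
proof -
  have pos: "fst p > 0" "snd p > 0" "snd p / (1 + fst p) > 0"
    using p by (auto simp: space_par)
  note measurable_jt_p[OF p, measurable]
  have S: "(\<integral>\<^sup>+s. ennreal (dens_S n (snd p) s) \<partial>lpos) = 1"
    using n pos by (intro nn_integral_dens_S)
  have "(\<integral>\<^sup>+z. ennreal (jt z p) * ennreal ((norm (fst z))\<^sup>2) \<partial>obs)
     = (\<integral>\<^sup>+x. \<integral>\<^sup>+s. ennreal (mixing_dens a b (fst p)) * ennreal (dens_X 0 (snd p / (1 + fst p)) x * (norm (x :: real ^ 'p))\<^sup>2) * ennreal (dens_S n (snd p) s) \<partial>lpos \<partial>lborel)"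
    using dens_S_nonneg[OF n]
    by (subst nn_integral_obs) (auto intro!: nn_integral_cong simp: jt_def joint_def mult_ac simp flip: ennreal_mult)
  then show "(\<integral>\<^sup>+z. ennreal (jt z p) * ennreal ((norm (fst z))\<^sup>2) \<partial>obs)
      = ennreal (mixing_dens a b (fst p)) * gauss_moment2 TYPE('p) (snd p / (1 + fst p))"
    by (simp add: nn_integral_cmult S gauss_moment2_def)
  have "(\<integral>\<^sup>+z. ennreal (jt z p) \<partial>obs)
     = (\<integral>\<^sup>+x. \<integral>\<^sup>+s. ennreal (mixing_dens a b (fst p)) * ennreal (dens_X 0 (snd p / (1 + fst p)) (x :: real ^ 'p)) * ennreal (dens_S n (snd p) s) \<partial>lpos \<partial>lborel)"
    using dens_S_nonneg[OF n]
    by (subst nn_integral_obs) (auto intro!: nn_integral_cong simp: jt_def joint_def mult_ac simp flip: ennreal_mult)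
  then show "(\<integral>\<^sup>+z. ennreal (jt z p) \<partial>obs) = ennreal (mixing_dens a b (fst p))"
    using pos by (simp add: nn_integral_cmult S nn_integral_dens_X)
qed

lemma cond_moment_le:
  assumes "p \<in> space par"
  shows "cond_moment p \<le> ennreal (4 * 2 powr half_p / snd p)"
proof -
  have pos: "fst p > 0" "snd p > 0"
    using assms by (auto simp: space_par)
  have "cond_moment p \<le> ennreal (4 / (snd p * (1 + fst p) / fst p) * 2 powr half_p)"
    unfolding cond_moment_def half_p_def using pos by (intro gauss_moment2_le) auto
  also have "\<dots> \<le> ennreal (4 * 2 powr half_p / snd p)"
  proof (rule ennreal_leI)
    have "4 / (snd p * (1 + fst p) / fst p) = 4 / snd p * (fst p / (1 + fst p))"
      by simp
    also have "\<dots> \<le> 4 / snd p * 1"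
      using pos by (intro mult_left_mono) auto
    finally have "4 / (snd p * (1 + fst p) / fst p) \<le> 4 / snd p" by simp
    then show "4 / (snd p * (1 + fst p) / fst p) * 2 powr half_p \<le> 4 * 2 powr half_p / snd p"
      using mult_right_mono[of "4 / (snd p * (1 + fst p) / fst p)" "4 / snd p" "2 powr half_p"] by simp
  qed
  finally show ?thesis .
qed

text \<open>Needed to cancel this Bayes risk from both sides of an inequality. The estimate differs
  from the conditional mean by at most \<open>norm x\<close>; the second moments are of order
  \<open>(1 + g) / \<eta>\<close>, and the cutoff makes their integral over the hyperparameters
  finite.\<close>

lemma bayes_risk_finite:
  assumes i: "i > 0"
  shows "bayes_risk i bayes_est < \<infinity>"
proof -
  define A where "A = 8 * 2 powr half_p * (exp (2 * exp i) * (1 + exp i) ^ 3)"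
  have A: "A \<ge> 0" by (simp add: A_def add_nonneg_nonneg)
  obtain C where C: "C \<ge> 0" "\<And>i. i \<ge> 1 \<Longrightarrow>
    (\<integral>\<^sup>+g. \<integral>\<^sup>+\<eta>. ennreal ((mixing_dens a b g / (1 + g)) * (1 / \<eta>) * decay i g \<eta>) \<partial>lpos \<partial>lpos)
      \<le> ennreal (C * i)"
    using nn_integral_radius by blast
  have "bayes_risk i bayes_est = (\<integral>\<^sup>+p. ennreal ((cutp i p)\<^sup>2)
     * (\<integral>\<^sup>+z. ennreal (jt z p) * (ennreal (sq_err bayes_est z p) + cond_moment p) \<partial>obs) \<partial>par)"
    unfolding bayes_risk_def by (intro nn_integral_cong) (simp add: integrated_risk)
  also have "\<dots> \<le> (\<integral>\<^sup>+p. ennreal A * ennreal ((mixing_dens a b (fst p) / (1 + fst p)) * (1 / snd p) * (1 + radius (fst p) (snd p)) powr (- 3)) \<partial>par)"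
  proof (rule nn_integral_mono)
    fix p assume p: "p \<in> space par"
    then have pos: "fst p > 0" "snd p > 0" by (auto simp: space_par)
    note measurable_jt_p[OF p, measurable]
    have "(\<integral>\<^sup>+z. ennreal (jt z p) * (ennreal (sq_err bayes_est z p) + cond_moment p) \<partial>obs)
        \<le> (\<integral>\<^sup>+z. ennreal (jt z p) * (ennreal ((norm (fst z))\<^sup>2) + cond_moment p) \<partial>obs)"
    proof (intro nn_integral_mono mult_left_mono add_right_mono ennreal_leI power_mono)
      fix z :: "(real ^ 'p) \<times> real" assume z: "z \<in> space obs"
      have "bayes_est z - (1 - shrink p) *\<^sub>R fst z = (shrink p - post_shrink z) *\<^sub>R fst z"
        by (simp add: bayes_est_def algebra_simps)
      moreover have "\<bar>shrink p - post_shrink z\<bar> \<le> 1"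
        using shrink_01[OF p] post_shrink_01[OF z] by auto
      ultimately show "norm (bayes_est z - (1 - shrink p) *\<^sub>R fst z) \<le> norm (fst z)"
        by (simp add: mult_left_le_one_le)
    qed auto
    also have "\<dots> = (\<integral>\<^sup>+z. ennreal (jt z p) * ennreal ((norm (fst z))\<^sup>2) \<partial>obs) + (\<integral>\<^sup>+z. ennreal (jt z p) \<partial>obs) * cond_moment p"
      unfolding distrib_left by (subst nn_integral_add) (simp_all add: nn_integral_multc)
    also have "\<dots> = ennreal (mixing_dens a b (fst p)) * (gauss_moment2 TYPE('p) (snd p / (1 + fst p)) + cond_moment p)"
      by (simp add: nn_integral_jt_norm_sq[OF p] distrib_left)
    also have "\<dots> \<le> ennreal (mixing_dens a b (fst p)) * (ennreal (4 * 2 powr half_p * (1 + fst p) / snd p) + ennreal (4 * 2 powr half_p * (1 + fst p) / snd p))"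
    proof (intro mult_left_mono add_mono)
      have "gauss_moment2 TYPE('p) (snd p / (1 + fst p)) \<le> ennreal (4 / (snd p / (1 + fst p)) * 2 powr half_p)"
        unfolding half_p_def using pos by (intro gauss_moment2_le) auto
      moreover have "4 / (h / G) * c = 4 * c * G / h" for h G c :: real
        by simp
      ultimately show "gauss_moment2 TYPE('p) (snd p / (1 + fst p)) \<le> ennreal (4 * 2 powr half_p * (1 + fst p) / snd p)"
        by (simp only:)
      have "4 * 2 powr half_p / snd p \<le> 4 * 2 powr half_p * (1 + fst p) / snd p"
        using pos by (intro divide_right_mono) auto
      then show "cond_moment p \<le> ennreal (4 * 2 powr half_p * (1 + fst p) / snd p)"
        using cond_moment_le[OF p] ennreal_leI order_trans by blast
    qed simp
    also have "\<dots> = ennreal (mixing_dens a b (fst p) * (8 * 2 powr half_p * (1 + fst p) / snd p))"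
      using pos by (simp add: flip: ennreal_plus ennreal_mult)
    finally have "ennreal ((cutp i p)\<^sup>2) * (\<integral>\<^sup>+z. ennreal (jt z p) * (ennreal (sq_err bayes_est z p) + cond_moment p) \<partial>obs)
        \<le> ennreal (exp (2 * exp i) * (1 + exp i) ^ 3 / (1 + fst p)\<^sup>2 * (1 + radius (fst p) (snd p)) powr (- 3))
          * ennreal (mixing_dens a b (fst p) * (8 * 2 powr half_p * (1 + fst p) / snd p))"
      by (intro mult_mono ennreal_leI cutp_sq_le i p) auto
    also have "\<dots> = ennreal (exp (2 * exp i) * (1 + exp i) ^ 3 / (1 + fst p)\<^sup>2 * (1 + radius (fst p) (snd p)) powr (- 3)
          * (mixing_dens a b (fst p) * (8 * 2 powr half_p * (1 + fst p) / snd p)))"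
      using pos by (intro ennreal_mult[symmetric]) (auto simp: add_nonneg_nonneg)
    also have "exp (2 * exp i) * (1 + exp i) ^ 3 / (1 + fst p)\<^sup>2 * (1 + radius (fst p) (snd p)) powr (- 3)
          * (mixing_dens a b (fst p) * (8 * 2 powr half_p * (1 + fst p) / snd p))
        = A * ((mixing_dens a b (fst p) / (1 + fst p)) * (1 / snd p) * (1 + radius (fst p) (snd p)) powr (- 3))"
    proof -
      have "E / G\<^sup>2 * P * (m * (c * G / h)) = c * E * (m / G * (1 / h) * P)" if "G \<noteq> 0" for E G P m c h :: real
        using that by (simp add: power2_eq_square)
      from this[of "1 + fst p"] show ?thesis
        using pos by (simp add: A_def)
    qed
    also have "ennreal \<dots> = ennreal A * ennreal ((mixing_dens a b (fst p) / (1 + fst p)) * (1 / snd p) * (1 + radius (fst p) (snd p)) powr (- 3))"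
      using A pos by (intro ennreal_mult) auto
    finally show "ennreal ((cutp i p)\<^sup>2) * (\<integral>\<^sup>+z. ennreal (jt z p) * (ennreal (sq_err bayes_est z p) + cond_moment p) \<partial>obs)
      \<le> ennreal A * ennreal ((mixing_dens a b (fst p) / (1 + fst p)) * (1 / snd p) * (1 + radius (fst p) (snd p)) powr (- 3))" .
  qed
  also have "\<dots> = ennreal A * (\<integral>\<^sup>+g. \<integral>\<^sup>+\<eta>. ennreal ((mixing_dens a b g / (1 + g)) * (1 / \<eta>) * (1 + radius g \<eta>) powr (- 3)) \<partial>lpos \<partial>lpos)"
    by (subst nn_integral_cmult) (simp_all add: nn_integral_par)
  also have "\<dots> \<le> ennreal A * ennreal (C * 1)"
    using C(2)[of 1] by (intro mult_left_mono) auto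
  also have "\<dots> < \<infinity>"
    by (simp add: ennreal_mult_less_top)
  finally show ?thesis .
qed

section \<open>Blyth's argument for a dominating estimator\<close>

lemma post_mass_mono:
  assumes "0 < i" "i \<le> j"
  shows "post_mass i z \<le> post_mass j z"
  unfolding post_mass_def
proof (intro nn_integral_mono mult_left_mono ennreal_leI power_mono)
  fix p assume p: "p \<in> space par"
  then show "cutp i p \<le> cutp j p"
    using assms by (auto simp: cutp_def hyper_cutoff_def space_par intro!: cutoff_mono radius_nonneg)
  show "0 \<le> cutp i p"
    using cutp_01[OF assms(1) p] by simp
qed simp

text \<open>On the box with \<open>0 < g < 1 / 2\<close> and \<open>1 < \<eta> < 3 / 2\<close> the
  radius is below \<open>1\<close>, and there the cutoff with \<open>i = 1\<close> is positive
  because \<open>1 + radius < 2 \<le> exp 1\<close>.\<close>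

lemma post_mass_pos:
  assumes z: "z \<in> space obs"
  shows "post_mass 1 z > 0"
proof (rule ccontr)
  assume "\<not> post_mass 1 z > 0"
  then have 0: "post_mass 1 z = 0" by simp
  note measurable_jt_z[OF z, measurable]
  define N where "N = {p \<in> space par. ennreal (jt z p) * ennreal ((cutp 1 p)\<^sup>2) \<noteq> 0}"
  have N: "N \<in> sets par" unfolding N_def by measurable
  have "emeasure par N = 0"
    using 0 unfolding post_mass_def N_def by (subst (asm) nn_integral_0_iff) simp_all
  have sub: "{0<..<1/2} \<times> {1<..<3/2} \<subseteq> N"
  proof
    fix p :: "real \<times> real" assume "p \<in> {0<..<1/2} \<times> {1<..<3/2}"
    then have p: "0 < fst p" "fst p < 1 / 2" "1 < snd p" "snd p < 3 / 2" by auto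
    have "ln (1 + fst p) \<le> fst p" "ln (snd p) \<le> snd p - 1"
      using p by (auto intro: ln_add_one_self_le_self ln_le_minus_one)
    moreover have "ln (snd p) \<ge> 0" using p by simp
    ultimately have r: "radius (fst p) (snd p) < 1" "radius (fst p) (snd p) \<ge> 0"
      using p by (auto simp: radius_def)
    then have "ln (1 + radius (fst p) (snd p)) < ln (exp 1)"
      using exp_ge_add_one_self[of 1] by (subst ln_less_cancel_iff) auto
    then have "cutp 1 p > 0"
      by (simp add: cutp_def hyper_cutoff_def cutoff_def)
    moreover have "jt z p > 0"
      using z p unfolding jt_def by (intro joint_pos) (auto simp: space_obs)
    ultimately show "p \<in> N"
      using p by (auto simp: N_def space_par)
  qed
  have "emeasure par ({0<..<1/2} \<times> {1<..<3/2}) = emeasure lpos {0<..<1/2} * emeasure lpos {1<..<3/2}"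
    by (intro lpos.emeasure_pair_measure_Times) (auto simp: sets_restrict_space_iff)
  also have "\<dots> = ennreal (1 / 2) * ennreal (1 / 2)"
    by (subst (1 2) emeasure_restrict_space) (auto simp: sets_restrict_space_iff)
  finally have "emeasure par ({0<..<1/2} \<times> {1<..<3/2}) > 0"
    by (simp only: ennreal_zero_less_mult_iff ennreal_less_zero_iff) simp
  moreover have "emeasure par ({0<..<1/2} \<times> {1<..<3/2}) \<le> emeasure par N"
    by (rule emeasure_mono[OF sub N])
  ultimately show False
    using \<open>emeasure par N = 0\<close> by simp
qed

text \<open>Let \<open>X i\<close> be the squared distance of the two estimators weighted by
  \<open>post_mass i\<close>. Dominance and the energy bound give \<open>X i \<le> C / i\<close>,
  while \<open>X i\<close> is nondecreasing in \<open>i\<close>; so \<open>X 1 = 0\<close>, and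
  \<open>post_mass 1\<close> is positive everywhere on \<open>obs\<close>.\<close>

lemma dominating_estimator_AE_eq:
  assumes \<delta> [measurable]: "\<delta> \<in> borel_measurable obs"
    and dom: "\<And>\<theta> \<eta>. \<eta> > 0 \<Longrightarrow> risk n \<delta> \<theta> \<eta> \<le> risk n bayes_est \<theta> \<eta>"
  shows "AE z in obs. \<delta> z = bayes_est z"
proof -
  obtain C where C: "C \<ge> 0" "\<And>i. i \<ge> 1 \<Longrightarrow>
    (\<integral>\<^sup>+z. norm_dirichlet i z \<partial>obs) \<le> ennreal (C / i)"
    using nn_integral_dirichlet_le by blast
  define X where "X i = (\<integral>\<^sup>+z. ennreal ((norm (\<delta> z - bayes_est z))\<^sup>2 / 2) * post_mass i z \<partial>obs)" for i
  have [measurable]: "dirichlet i \<in> borel_measurable obs" for i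
    unfolding dirichlet_def by measurable
  have [measurable]: "(\<lambda>z. mass (fst z) (snd z)) \<in> borel_measurable obs"
    unfolding mass_def by measurable
  have X: "X i \<le> ennreal (C / i)" if i: "i \<ge> 1" for i
  proof -
    have "X i + (\<integral>\<^sup>+z. post_risk i bayes_est z \<partial>obs)
        = (\<integral>\<^sup>+z. ennreal ((norm (\<delta> z - bayes_est z))\<^sup>2 / 2) * post_mass i z + post_risk i bayes_est z \<partial>obs)"
      unfolding X_def by (rule nn_integral_add[symmetric]) measurable
    also have "\<dots> \<le> (\<integral>\<^sup>+z. post_risk i \<delta> z
        + norm_dirichlet i z \<partial>obs)"
      using i by (intro nn_integral_mono post_risk_comparison) auto
    also have "\<dots> = (\<integral>\<^sup>+z. post_risk i \<delta> z \<partial>obs)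
        + (\<integral>\<^sup>+z. norm_dirichlet i z \<partial>obs)"
      by (rule nn_integral_add) measurable
    also have "\<dots> \<le> (\<integral>\<^sup>+z. post_risk i \<delta> z \<partial>obs) + ennreal (C / i)"
      by (intro add_left_mono C i)
    finally have "X i + (\<integral>\<^sup>+z. post_risk i bayes_est z \<partial>obs) + (\<integral>\<^sup>+z. post_moment i z \<partial>obs)
        \<le> (\<integral>\<^sup>+z. post_risk i \<delta> z \<partial>obs) + ennreal (C / i) + (\<integral>\<^sup>+z. post_moment i z \<partial>obs)"
      by (rule add_right_mono)
    then have "bayes_risk i bayes_est + X i \<le> bayes_risk i \<delta> + ennreal (C / i)"
      by (simp add: bayes_risk_eq add_ac)
    also have "\<dots> \<le> bayes_risk i bayes_est + ennreal (C / i)"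
      by (intro add_right_mono bayes_risk_mono dom)
    finally show ?thesis
      using bayes_risk_finite[of i] i by (auto simp: ennreal_add_left_cancel_le)
  qed
  have "X 1 \<le> ennreal (C / real (Suc k))" for k
  proof -
    have "X 1 \<le> X (real (Suc k))"
      unfolding X_def by (intro nn_integral_mono mult_left_mono post_mass_mono) auto
    also have "\<dots> \<le> ennreal (C / real (Suc k))"
      by (intro X) simp
    finally show ?thesis .
  qed
  moreover have "(\<lambda>k. ennreal (C / real (Suc k))) \<longlonglongrightarrow> ennreal 0"
    by (intro tendsto_ennrealI LIMSEQ_Suc[OF lim_const_over_n])
  ultimately have "X 1 \<le> ennreal 0"
    by (intro LIMSEQ_le_const) auto
  then have "AE z in obs. ennreal ((norm (\<delta> z - bayes_est z))\<^sup>2 / 2) * post_mass 1 z = 0"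
    unfolding X_def by (subst (asm) ennreal_0) (simp add: nn_integral_0_iff_AE)
  then show ?thesis
    using AE_space
  proof eventually_elim
    case (elim z)
    then have "ennreal ((norm (\<delta> z - bayes_est z))\<^sup>2 / 2) = 0"
      using post_mass_pos[OF elim(2)] by auto
    then show ?case by (simp add: ennreal_eq_0_iff)
  qed
qed

end

subsection \<open>The generalized Bayes estimator\<close>

context shrinkage_prior
begin

section \<open>Conditional law of \<open>\<theta>\<close> and integration over
  \<open>(\<theta>, \<eta>)\<close>\<close>

definition cond_mean :: "(real ^ 'p) \<times> real \<Rightarrow> real \<times> real \<Rightarrow> real ^ 'p" where
  "cond_mean z p = (fst p / (1 + fst p)) *\<^sub>R fst z"

definition cond_prec :: "real \<times> real \<Rightarrow> real" where
  "cond_prec p = snd p * (1 + fst p) / fst p"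

abbreviation cond_dens :: "(real ^ 'p) \<times> real \<Rightarrow> real \<times> real \<Rightarrow> real ^ 'p \<Rightarrow> real" where
  "cond_dens z p \<equiv> dens_X (cond_mean z p) (cond_prec p)"

lemma cond_prec_pos: "p \<in> space par \<Longrightarrow> cond_prec p > 0"
  by (simp add: cond_prec_def space_par)

text \<open>Completing the square under the integral over \<open>g\<close> that is hidden in the
  prior. The equation holds for every \<open>\<theta>\<close>: where that integral diverges, both
  sides take the default value \<open>0\<close>.\<close>

lemma prior_star_posterior:
  assumes "\<eta> > 0" "s > 0"
  shows "\<eta> * prior_star a b \<theta> \<eta> * dens_X \<theta> \<eta> x * dens_S n \<eta> s
    = (LINT g|lpos. jt (x, s) (g, \<eta>) * cond_dens (x, s) (g, \<eta>) \<theta>)"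
proof -
  let ?k = "real CARD('p) / 2"
  have "prior_star a b \<theta> \<eta> = 1 / \<eta> * (LINT g|lpos. dens_X 0 (\<eta> / g) \<theta> * mixing_dens a b g)"
  proof -
    have "(LINT g:{0<..}|lborel. \<eta> powr ?k / ((2 * pi) powr ?k * g powr ?k)
         * exp (- (\<eta> / (2 * g)) * (norm \<theta>)\<^sup>2) * mixing_dens a b g)
        = (LINT g|lpos. \<eta> powr ?k / ((2 * pi) powr ?k * g powr ?k)
         * exp (- (\<eta> / (2 * g)) * (norm \<theta>)\<^sup>2) * mixing_dens a b g)"
      unfolding set_lebesgue_integral_def by (subst integral_restrict_space) auto
    also have "\<dots> = (LINT g|lpos. dens_X 0 (\<eta> / g) \<theta> * mixing_dens a b g)"
    proof (rule Bochner_Integration.integral_cong)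
      fix g :: real
      have "- (\<eta> / (2 * g)) * (norm \<theta>)\<^sup>2 = - (\<eta> / g) * (norm \<theta>)\<^sup>2 / 2" by simp
      then show "\<eta> powr ?k / ((2 * pi) powr ?k * g powr ?k)
         * exp (- (\<eta> / (2 * g)) * (norm \<theta>)\<^sup>2) * mixing_dens a b g = dens_X 0 (\<eta> / g) \<theta> * mixing_dens a b g"
        by (simp only: dens_X_def powr_divide diff_zero) simp
    qed simp
    finally show ?thesis
      by (simp only: prior_star_def)
  qed
  then have "\<eta> * prior_star a b \<theta> \<eta> * dens_X \<theta> \<eta> x * dens_S n \<eta> s
      = (LINT g|lpos. dens_X 0 (\<eta> / g) \<theta> * mixing_dens a b g) * (dens_X \<theta> \<eta> x * dens_S n \<eta> s)"
    using assms by simp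
  also have "\<dots> = (LINT g|lpos. dens_X 0 (\<eta> / g) \<theta> * mixing_dens a b g * (dens_X \<theta> \<eta> x * dens_S n \<eta> s))"
    by simp
  also have "\<dots> = (LINT g|lpos. jt (x, s) (g, \<eta>) * cond_dens (x, s) (g, \<eta>) \<theta>)"
  proof (rule Bochner_Integration.integral_cong)
    fix g assume "g \<in> space lpos"
    then have g: "g > 0" by simp
    have "dens_X 0 (\<eta> / g) \<theta> * mixing_dens a b g * (dens_X \<theta> \<eta> x * dens_S n \<eta> s)
        = (dens_X 0 (\<eta> / g) \<theta> * dens_X \<theta> \<eta> x) * (mixing_dens a b g * dens_S n \<eta> s)"
      by simp
    also have "\<dots> = jt (x, s) (g, \<eta>) * cond_dens (x, s) (g, \<eta>) \<theta>"
      unfolding dens_X_mult_dens_X[OF g assms(1)] by (simp add: jt_def joint_def cond_mean_def cond_prec_def)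
    finally show "dens_X 0 (\<eta> / g) \<theta> * mixing_dens a b g * (dens_X \<theta> \<eta> x * dens_S n \<eta> s)
        = jt (x, s) (g, \<eta>) * cond_dens (x, s) (g, \<eta>) \<theta>" .
  qed simp
  finally show ?thesis .
qed

text \<open>At \<open>\<theta> = 0\<close> the inner integral may diverge; the equation between the inner integrals below
  therefore holds only almost everywhere.\<close>

lemma integral_posterior:
  fixes h :: "real ^ 'p \<Rightarrow> 'b::{banach, second_countable_topology}"
  assumes z: "z \<in> space obs" and h [measurable]: "h \<in> borel_measurable borel"
    and H: "\<And>p. p \<in> space par \<Longrightarrow> has_bochner_integral lborel (\<lambda>\<theta>. cond_dens z p \<theta> *\<^sub>R h \<theta>) (H p)"
    and fin: "(\<integral>\<^sup>+p. ennreal (jt z p) * (\<integral>\<^sup>+\<theta>. ennreal (cond_dens z p \<theta> * norm (h \<theta>)) \<partial>lborel) \<partial>par) < \<infinity>"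
    and int: "integrable par (\<lambda>p. jt z p *\<^sub>R H p)"
  shows "(LINT w|obs. (LINT g|lpos. jt z (g, snd w) * cond_dens z (g, snd w) (fst w)) *\<^sub>R h (fst w))
    = (LINT p|par. jt z p *\<^sub>R H p)"
proof -
  interpret og: pair_sigma_finite "obs :: ((real ^ 'p) \<times> real) measure" lpos ..
  note measurable_jt_z[OF z, measurable]
  have cm [measurable]: "cond_mean z \<in> borel_measurable par" "cond_prec \<in> borel_measurable par"
    unfolding cond_mean_def cond_prec_def by measurable
  define W where "W \<theta> p = jt z p * cond_dens z p \<theta>" for \<theta> p
  have W0: "W \<theta> p \<ge> 0" for \<theta> p by (simp add: W_def)
  have W_meas [measurable]: "(\<lambda>w. W (fst (fst w)) (snd w, snd (fst w))) \<in> borel_measurable ((obs :: ((real ^ 'p) \<times> real) measure) \<Otimes>\<^sub>M lpos)"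
    unfolding W_def by measurable
  have W_meas2 [measurable]: "(\<lambda>\<theta>. W \<theta> p) \<in> borel_measurable borel" if "p \<in> space par" for p
    unfolding W_def by measurable
  \<comment> \<open>Stated for general \<open>k\<close> because it is used with \<open>h\<close> and
    also with the constant \<open>1\<close>.\<close>
  have intG: "integrable (obs \<Otimes>\<^sub>M lpos) (\<lambda>(w, g). W (fst w) (g, snd w) *\<^sub>R k (fst w))"
    if k [measurable]: "k \<in> borel_measurable borel"
      and kfin: "(\<integral>\<^sup>+p. ennreal (jt z p) * (\<integral>\<^sup>+\<theta>. ennreal (cond_dens z p \<theta> * norm (k \<theta>)) \<partial>lborel) \<partial>par) < \<infinity>"
    for k :: "real ^ 'p \<Rightarrow> 'c::{banach, second_countable_topology}"
  proof (rule integrableI_bounded)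
    show "(\<lambda>(w, g). W (fst w) (g, snd w) *\<^sub>R k (fst w)) \<in> borel_measurable (obs \<Otimes>\<^sub>M lpos)"
      by (simp add: case_prod_beta')
    have "(\<integral>\<^sup>+y. ennreal (norm (case y of (w, g) \<Rightarrow> W (fst w) (g, snd w) *\<^sub>R k (fst w))) \<partial>(obs \<Otimes>\<^sub>M lpos))
        = (\<integral>\<^sup>+y. ennreal (W (fst (fst y)) (snd y, snd (fst y)) * norm (k (fst (fst y)))) \<partial>(obs \<Otimes>\<^sub>M lpos))"
      by (intro nn_integral_cong) (simp add: case_prod_beta' W0)
    also have "\<dots> = (\<integral>\<^sup>+g. \<integral>\<^sup>+w. ennreal (W (fst w) (g, snd w) * norm (k (fst w))) \<partial>obs \<partial>lpos)"
      by (subst og.nn_integral_snd[symmetric]) simp_all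
    also have "\<dots> = (\<integral>\<^sup>+g. \<integral>\<^sup>+\<eta>. \<integral>\<^sup>+\<theta>. ennreal (W \<theta> (g, \<eta>) * norm (k \<theta>)) \<partial>lborel \<partial>lpos \<partial>lpos)"
    proof (rule nn_integral_cong)
      fix g assume g: "g \<in> space lpos"
      have "(\<lambda>w. W (fst w) (g, snd w)) \<in> borel_measurable obs"
        using measurable_compose[OF measurable_Pair2'[OF g] W_meas] by simp
      then show "(\<integral>\<^sup>+w. ennreal (W (fst w) (g, snd w) * norm (k (fst w))) \<partial>obs)
          = (\<integral>\<^sup>+\<eta>. \<integral>\<^sup>+\<theta>. ennreal (W \<theta> (g, \<eta>) * norm (k \<theta>)) \<partial>lborel \<partial>lpos)"
        by (subst obs_pair.nn_integral_snd[symmetric]) simp_all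
    qed
    also have "\<dots> = (\<integral>\<^sup>+g. \<integral>\<^sup>+\<eta>. ennreal (jt z (g, \<eta>)) * (\<integral>\<^sup>+\<theta>. ennreal (cond_dens z (g, \<eta>) \<theta> * norm (k \<theta>)) \<partial>lborel) \<partial>lpos \<partial>lpos)"
      by (intro nn_integral_cong) (simp add: W_def mult.assoc ennreal_mult' nn_integral_cmult)
    also have "\<dots> = (\<integral>\<^sup>+p. ennreal (jt z p) * (\<integral>\<^sup>+\<theta>. ennreal (cond_dens z p \<theta> * norm (k \<theta>)) \<partial>lborel) \<partial>par)"
      by (subst nn_integral_par) simp_all
    finally show "(\<integral>\<^sup>+y. ennreal (norm (case y of (w, g) \<Rightarrow> W (fst w) (g, snd w) *\<^sub>R k (fst w))) \<partial>(obs \<Otimes>\<^sub>M lpos)) < \<infinity>"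
      using kfin by simp
  qed
  \<comment> \<open>This gives convergence of the integral over \<open>g\<close> for almost every
    \<open>(\<theta>, \<eta>)\<close>, which is what allows the vector \<open>h\<close> to be moved
    under that integral.\<close>
  have one: "integrable (obs \<Otimes>\<^sub>M lpos) (\<lambda>(w, g). W (fst w) (g, snd w) *\<^sub>R (1 :: real))"
  proof (rule intG)
    have "(\<integral>\<^sup>+p. ennreal (jt z p) * (\<integral>\<^sup>+\<theta>. ennreal (cond_dens z p \<theta> * norm (1 :: real)) \<partial>lborel) \<partial>par)
        = (\<integral>\<^sup>+p. ennreal (jt z p) \<partial>par)"
      by (intro nn_integral_cong) (simp add: nn_integral_dens_X cond_prec_pos)
    also have "\<dots> < \<infinity>"
      using z by (simp add: nn_integral_jt mass_finite[unfolded infinity_ennreal_def] space_obs)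
    finally show "(\<integral>\<^sup>+p. ennreal (jt z p) * (\<integral>\<^sup>+\<theta>. ennreal (cond_dens z p \<theta> * norm (1 :: real)) \<partial>lborel) \<partial>par) < \<infinity>" .
  qed simp
  have "(LINT w|obs. (LINT g|lpos. W (fst w) (g, snd w)) *\<^sub>R h (fst w))
      = (LINT w|obs. (LINT g|lpos. W (fst w) (g, snd w) *\<^sub>R h (fst w)))"
  proof (rule integral_cong_AE)
    show "AE w in obs. (LINT g|lpos. W (fst w) (g, snd w)) *\<^sub>R h (fst w) = (LINT g|lpos. W (fst w) (g, snd w) *\<^sub>R h (fst w))"
      using og.AE_integrable_fst'[OF one] by eventually_elim simp
  qed (simp_all add: case_prod_beta')
  also have "\<dots> = (LINT g|lpos. (LINT w|obs. W (fst w) (g, snd w) *\<^sub>R h (fst w)))"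
    using intG[OF h fin] by (intro og.Fubini_integral[symmetric]) simp
  also have "\<dots> = (LINT g|lpos. (LINT \<eta>|lpos. jt z (g, \<eta>) *\<^sub>R H (g, \<eta>)))"
  proof (rule integral_cong_AE)
    show "AE g in lpos. (LINT w|obs. W (fst w) (g, snd w) *\<^sub>R h (fst w)) = (LINT \<eta>|lpos. jt z (g, \<eta>) *\<^sub>R H (g, \<eta>))"
      using og.AE_integrable_snd[OF intG[OF h fin]] AE_space
    proof eventually_elim
      case (elim g)
      have "(LINT w|obs. W (fst w) (g, snd w) *\<^sub>R h (fst w)) = (LINT \<eta>|lpos. (LINT \<theta>|lborel. W \<theta> (g, \<eta>) *\<^sub>R h \<theta>))"
        using elim(1) by (subst obs_pair.integral_snd) (simp_all add: case_prod_beta')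
      also have "\<dots> = (LINT \<eta>|lpos. jt z (g, \<eta>) *\<^sub>R H (g, \<eta>))"
      proof (rule Bochner_Integration.integral_cong)
        fix \<eta> assume "\<eta> \<in> space lpos"
        then have "(g, \<eta>) \<in> space par" using elim(2) by (simp add: space_par)
        from H[OF this] show "(LINT \<theta>|lborel. W \<theta> (g, \<eta>) *\<^sub>R h \<theta>) = jt z (g, \<eta>) *\<^sub>R H (g, \<eta>)"
          by (simp add: W_def has_bochner_integral_iff flip: scaleR_scaleR)
      qed simp
      finally show ?case .
    qed
    show "(\<lambda>g. LINT w|obs. W (fst w) (g, snd w) *\<^sub>R h (fst w)) \<in> borel_measurable lpos"
      using og.integrable_snd[OF intG[OF h fin]] by (rule borel_measurable_integrable)
    show "(\<lambda>g. LINT \<eta>|lpos. jt z (g, \<eta>) *\<^sub>R H (g, \<eta>)) \<in> borel_measurable lpos"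
      using lpos_pair.integrable_fst'[OF int] by (intro borel_measurable_integrable) simp
  qed
  also have "\<dots> = (LINT p|par. jt z p *\<^sub>R H p)"
    using lpos_pair.integral_fst'[OF int] by simp
  finally show ?thesis
    by (simp add: W_def)
qed

text \<open>Since \<open>cond_moment\<close> is at most a constant over \<open>\<eta>\<close>, a
  moment of \<open>\<eta>\<close> of order \<open>- 1\<close> is required. It exists because
  \<open>shape > 1\<close>, and the conditional rate that it produces is bounded by its value at
  \<open>g = 0\<close>.\<close>

lemma nn_integral_jt_cond_moment:
  assumes z: "z \<in> space obs"
  shows "(\<integral>\<^sup>+p. ennreal (jt z p) * cond_moment p \<partial>par) < \<infinity>"
proof -
  note measurable_jt_z[OF z, measurable]
  obtain x s where zxs: "z = (x, s)" and s: "s > 0"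
    using z by (cases z) (auto simp: space_obs)
  define c where "c = 4 * 2 powr half_p"
  have c: "c \<ge> 0" by (simp add: c_def)
  define B where "B = scale_const s * (Gamma (shape + - 1) / Gamma shape) * (rate x s 0 / 2)"
  have G: "Gamma (shape + - 1) > 0" "Gamma shape > 0"
    using shape_ge by (auto intro!: Gamma_real_pos)
  have B: "B \<ge> 0"
    using G s scale_const_pos[OF s] by (simp add: B_def rate_def)
  have "(\<integral>\<^sup>+p. ennreal (jt z p) * cond_moment p \<partial>par) \<le> (\<integral>\<^sup>+p. ennreal c * ennreal (jt z p * snd p powr (- 1)) \<partial>par)"
  proof (rule nn_integral_mono)
    fix p assume p: "p \<in> space par"
    have "ennreal (jt z p) * cond_moment p \<le> ennreal (jt z p) * ennreal (4 * 2 powr half_p / snd p)"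
      by (intro mult_left_mono cond_moment_le p) simp
    also have "\<dots> = ennreal c * ennreal (jt z p * snd p powr (- 1))"
      using p c by (simp add: c_def space_par powr_minus_divide mult_ac flip: ennreal_mult)
    finally show "ennreal (jt z p) * cond_moment p \<le> ennreal c * ennreal (jt z p * snd p powr (- 1))" .
  qed
  also have "\<dots> = ennreal c * (\<integral>\<^sup>+g. \<integral>\<^sup>+\<eta>. ennreal (joint x s g \<eta> * \<eta> powr (- 1)) \<partial>lpos \<partial>lpos)"
    by (subst nn_integral_cmult) (simp_all add: nn_integral_par jt_def zxs)
  also have "\<dots> \<le> ennreal c * (\<integral>\<^sup>+g. ennreal B * ennreal (post_g x s g) \<partial>lpos)"
  proof (intro mult_left_mono nn_integral_mono)
    fix g assume "g \<in> space lpos"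
    then have g: "g > 0" by simp
    have "(\<integral>\<^sup>+\<eta>. ennreal (joint x s g \<eta> * \<eta> powr (- 1)) \<partial>lpos)
      = ennreal (scale_const s * (Gamma (shape + - 1) / Gamma shape) * (rate x s g / 2) powr (- (- 1))
        * post_g x s g)"
      using s g shape_ge by (intro nn_integral_joint_powr) auto
    also have "\<dots> \<le> ennreal (B * post_g x s g)"
    proof (intro ennreal_leI mult_right_mono)
      have "(norm x)\<^sup>2 / (1 + g) \<le> (norm x)\<^sup>2 / 1"
        using g by (intro divide_left_mono) auto
      then have "rate x s g \<le> rate x s 0"
        by (simp add: rate_def)
      moreover have "(rate x s g / 2) powr (- (- 1)) = rate x s g / 2"
        using rate_pos[OF s g, of x] by simp
      ultimately have "(rate x s g / 2) powr (- (- 1)) \<le> rate x s 0 / 2"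
        by simp
      then show "scale_const s * (Gamma (shape + - 1) / Gamma shape) * (rate x s g / 2) powr (- (- 1)) \<le> B"
        unfolding B_def using G scale_const_pos[OF s] by (intro mult_left_mono) auto
    qed simp
    also have "\<dots> = ennreal B * ennreal (post_g x s g)"
      using B by (intro ennreal_mult) auto
    finally show "(\<integral>\<^sup>+\<eta>. ennreal (joint x s g \<eta> * \<eta> powr (- 1)) \<partial>lpos) \<le> \<dots>" .
  qed simp
  also have "\<dots> = ennreal c * (ennreal B * (\<integral>\<^sup>+g. ennreal (post_g x s g) \<partial>lpos))"
    by (simp add: nn_integral_cmult)
  also have "\<dots> < \<infinity>"
    using nn_integral_mix_post_finite[of half_p shape b a "(norm x)\<^sup>2 / s"] half_p_nonneg shape_ge b pa s
    by (simp add: ennreal_mult_less_top half_p_def)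
  finally show ?thesis .
qed

text \<open>Numerator and denominator are both evaluated by \<open>integral_posterior\<close>, with
  \<open>h\<close> the identity and with \<open>h\<close> constant. Their quotient is the posterior
  mean of \<open>1 - shrink\<close>, applied to \<open>x\<close>.\<close>

lemma delta_star_eq_bayes_est:
  assumes z: "z \<in> space obs"
  shows "delta_star n a b z = bayes_est z"
proof -
  obtain x s where zxs: "z = (x, s)" and s: "s > 0"
    using z by (cases z) (auto simp: space_obs)
  have s': "snd z > 0" using zxs s by simp
  note measurable_jt_z[OF z, measurable]
  define m where "m = enn2real (mass (fst z) (snd z))"
  have m: "mass (fst z) (snd z) = ennreal m" "m > 0"
    using mass_finite[OF s', of "fst z"] mass_pos[OF s', of "fst z"]
    by (auto simp: m_def enn2real_positive_iff)
  have int_jt: "integrable par (jt z)"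
    using m by (intro integrableI_nonneg) (auto simp: nn_integral_jt[OF s'])
  have jt_1: "(LINT p|par. jt z p) = m"
    by (subst integral_eq_nn_integral) (auto simp: nn_integral_jt[OF s'] m_def)
  have int_sh: "integrable par (\<lambda>p. jt z p * shrink p)"
    using int_jt
  proof (rule Bochner_Integration.integrable_bound)
    show "AE p in par. norm (jt z p * shrink p) \<le> norm (jt z p)"
      using shrink_01 by (intro AE_I2) (simp add: mult_left_le)
  qed simp
  have jt_sh: "(LINT p|par. jt z p * shrink p) = m * post_shrink z"
  proof -
    have "(LINT p|par. jt z p * shrink p) = enn2real (\<integral>\<^sup>+p. ennreal (jt z p * shrink p) \<partial>par)"
      using shrink_01 by (intro integral_eq_nn_integral) auto
    also have "(\<integral>\<^sup>+p. ennreal (jt z p * shrink p) \<partial>par) = (\<integral>\<^sup>+p. ennreal (jt z p) * ennreal (shrink p) \<partial>par)"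
      by (intro nn_integral_cong) (simp add: ennreal_mult')
    finally show ?thesis
      using m(2) by (simp add: post_shrink_def m_def)
  qed
  have cond_mean_eq: "jt z p *\<^sub>R cond_mean z p = (jt z p - jt z p * shrink p) *\<^sub>R x" if "p \<in> space par" for p
  proof -
    have "fst p / (1 + fst p) = 1 - shrink p"
      using that by (simp add: shrink_def space_par field_simps)
    then show ?thesis
      by (simp add: cond_mean_def zxs right_diff_distrib)
  qed
  let ?W = "\<lambda>w. LINT g|lpos. jt z (g, snd w) * cond_dens z (g, snd w) (fst w)"
  let ?D = "\<lambda>w. case w of (\<theta>, \<eta>) \<Rightarrow> \<eta> * prior_star a b \<theta> \<eta> * dens_X \<theta> \<eta> x * dens_S n \<eta> s"
  have DW: "?D w = ?W w" if "w \<in> space obs" for w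
    using that prior_star_posterior[of "snd w" s "fst w" x] s zxs
    by (simp add: case_prod_beta' space_obs)
  have S: "UNIV \<times> {0<..} \<in> sets (borel :: ((real ^ 'p) \<times> real) measure)"
    by (simp add: borel_prod[symmetric])
  have set_int: "(LINT w:UNIV \<times> {0<..}|lborel. f w) = (LINT w|obs. f w)"
    for f :: "(real ^ 'p) \<times> real \<Rightarrow> 'c::{banach, second_countable_topology}"
    using S unfolding set_lebesgue_integral_def restrict_lborel_halfspace[symmetric]
    by (subst integral_restrict_space) auto
  have den: "(LINT w:UNIV \<times> {0<..}|lborel. ?D w) = m"
  proof -
    have "(LINT w:UNIV \<times> {0<..}|lborel. ?D w) = (LINT w|obs. ?W w *\<^sub>R (1 :: real))"
      unfolding set_int by (intro Bochner_Integration.integral_cong) (simp_all add: DW)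
    also have "\<dots> = (LINT p|par. jt z p *\<^sub>R (1 :: real))"
    proof (rule integral_posterior[OF z])
      show "has_bochner_integral lborel (\<lambda>\<theta>. cond_dens z p \<theta> *\<^sub>R (1 :: real)) 1"
        if "p \<in> space par" for p
        using nn_integral_dens_X[OF cond_prec_pos[OF that], of "cond_mean z p"]
        by (intro has_bochner_integral_nn_integral) auto
      have "(\<integral>\<^sup>+p. ennreal (jt z p) * (\<integral>\<^sup>+\<theta>. ennreal (cond_dens z p \<theta> * norm (1 :: real)) \<partial>lborel) \<partial>par)
          = (\<integral>\<^sup>+p. ennreal (jt z p) \<partial>par)"
        by (intro nn_integral_cong) (simp add: nn_integral_dens_X cond_prec_pos)
      then show "(\<integral>\<^sup>+p. ennreal (jt z p) * (\<integral>\<^sup>+\<theta>. ennreal (cond_dens z p \<theta> * norm (1 :: real)) \<partial>lborel) \<partial>par) < \<infinity>"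
        by (simp add: nn_integral_jt[OF s'] m)
    qed (use int_jt in simp_all)
    finally show ?thesis by (simp add: jt_1)
  qed
  have num: "(LINT w:UNIV \<times> {0<..}|lborel. case w of (\<theta>, \<eta>) \<Rightarrow>
      (\<eta> * prior_star a b \<theta> \<eta> * dens_X \<theta> \<eta> x * dens_S n \<eta> s) *\<^sub>R \<theta>) = (m - m * post_shrink z) *\<^sub>R x"
  proof -
    have "(LINT w:UNIV \<times> {0<..}|lborel. case w of (\<theta>, \<eta>) \<Rightarrow>
        (\<eta> * prior_star a b \<theta> \<eta> * dens_X \<theta> \<eta> x * dens_S n \<eta> s) *\<^sub>R \<theta>) = (LINT w|obs. ?W w *\<^sub>R fst w)"
      unfolding set_int by (intro Bochner_Integration.integral_cong refl) (auto simp: DW[symmetric] case_prod_beta')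
    also have "\<dots> = (LINT p|par. jt z p *\<^sub>R cond_mean z p)"
    proof (rule integral_posterior[OF z])
      show "has_bochner_integral lborel (\<lambda>\<theta>. cond_dens z p \<theta> *\<^sub>R \<theta>) (cond_mean z p)"
        if "p \<in> space par" for p
        by (rule has_bochner_integral_dens_X_mean[OF cond_prec_pos[OF that]])
      have "(\<integral>\<^sup>+p. ennreal (jt z p) * (\<integral>\<^sup>+\<theta>. ennreal (cond_dens z p \<theta> * norm \<theta>) \<partial>lborel) \<partial>par)
          \<le> (\<integral>\<^sup>+p. ennreal (jt z p) * ennreal (1 + (norm x)\<^sup>2) + ennreal (jt z p) * cond_moment p \<partial>par)"
      proof (rule nn_integral_mono)
        fix p assume p: "p \<in> space par"
        let ?d = "cond_dens z p"
        \<comment> \<open>The square is written with \<open>0 - \<theta>\<close> so that the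
          splitting into bias and variance applies at the estimate \<open>0\<close>.\<close>
        have "(\<integral>\<^sup>+\<theta>. ennreal (?d \<theta> * norm \<theta>) \<partial>lborel) \<le> (\<integral>\<^sup>+\<theta>. ennreal (?d \<theta>) + ennreal (?d \<theta> * (norm (0 - \<theta>))\<^sup>2) \<partial>lborel)"
        proof (rule nn_integral_mono)
          fix \<theta> :: "real ^ 'p"
          have "norm \<theta> \<le> 1 + (norm \<theta>)\<^sup>2"
            using zero_le_power2[of "norm \<theta> - 1 / 2"] by (simp add: power2_eq_square algebra_simps)
          then have "?d \<theta> * norm \<theta> \<le> ?d \<theta> * (1 + (norm \<theta>)\<^sup>2)"
            by (intro mult_left_mono) auto
          then show "ennreal (?d \<theta> * norm \<theta>) \<le> ennreal (?d \<theta>) + ennreal (?d \<theta> * (norm (0 - \<theta>))\<^sup>2)"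
            by (simp add: distrib_left ennreal_leI flip: ennreal_plus)
        qed
        also have "\<dots> = 1 + (ennreal ((norm (cond_mean z p))\<^sup>2) + cond_moment p)"
          using cond_prec_pos[OF p]
          by (subst nn_integral_add) (simp_all only: nn_integral_dens_X nn_integral_dens_X_sq_dist, simp_all add: cond_moment_def cond_prec_def)
        also have "\<dots> \<le> 1 + (ennreal ((norm x)\<^sup>2) + cond_moment p)"
        proof (intro add_left_mono add_right_mono ennreal_leI power_mono)
          have "\<bar>fst p / (1 + fst p)\<bar> \<le> 1"
            using p by (simp add: space_par)
          then show "norm (cond_mean z p) \<le> norm x"
            using mult_right_mono[of "\<bar>fst p / (1 + fst p)\<bar>" 1 "norm x"] by (simp add: cond_mean_def zxs)
        qed simp
        finally have "ennreal (jt z p) * (\<integral>\<^sup>+\<theta>. ennreal (?d \<theta> * norm \<theta>) \<partial>lborel)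
            \<le> ennreal (jt z p) * (1 + (ennreal ((norm x)\<^sup>2) + cond_moment p))"
          by (intro mult_left_mono) auto
        also have "\<dots> = ennreal (jt z p) * ennreal (1 + (norm x)\<^sup>2) + ennreal (jt z p) * cond_moment p"
          by (simp add: distrib_left add.assoc ennreal_plus)
        finally show "ennreal (jt z p) * (\<integral>\<^sup>+\<theta>. ennreal (?d \<theta> * norm \<theta>) \<partial>lborel)
            \<le> ennreal (jt z p) * ennreal (1 + (norm x)\<^sup>2) + ennreal (jt z p) * cond_moment p" .
      qed
      also have "\<dots> = ennreal m * ennreal (1 + (norm x)\<^sup>2) + (\<integral>\<^sup>+p. ennreal (jt z p) * cond_moment p \<partial>par)"
        by (subst nn_integral_add) (simp_all add: nn_integral_multc nn_integral_jt[OF s'] m)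
      also have "\<dots> < \<infinity>"
        using nn_integral_jt_cond_moment[OF z] by (simp add: ennreal_mult_less_top)
      finally show "(\<integral>\<^sup>+p. ennreal (jt z p) * (\<integral>\<^sup>+\<theta>. ennreal (cond_dens z p \<theta> * norm \<theta>) \<partial>lborel) \<partial>par) < \<infinity>" .
      have "integrable par (\<lambda>p. (jt z p - jt z p * shrink p) *\<^sub>R x)"
        using int_jt int_sh by simp
      then show "integrable par (\<lambda>p. jt z p *\<^sub>R cond_mean z p)"
      proof (subst Bochner_Integration.integrable_cong[OF refl])
        fix p assume p: "p \<in> space par"
        show "jt z p *\<^sub>R cond_mean z p = (jt z p - jt z p * shrink p) *\<^sub>R x"
          using cond_mean_eq[OF p] by simp
      qed
    qed simp
    also have "\<dots> = (LINT p|par. (jt z p - jt z p * shrink p) *\<^sub>R x)"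
      by (intro Bochner_Integration.integral_cong refl) (simp add: cond_mean_eq)
    also have "\<dots> = (m - m * post_shrink z) *\<^sub>R x"
      using int_jt int_sh by (simp add: jt_1 jt_sh)
    finally show ?thesis .
  qed
  have "delta_star n a b z = ((m - m * post_shrink z) *\<^sub>R x) /\<^sub>R m"
    unfolding delta_star_def gen_Bayes_def zxs using num den by (simp add: zxs)
  also have "\<dots> = bayes_est z"
    using m(2) by (simp add: bayes_est_def zxs right_diff_distrib)
  finally show ?thesis .
qed

text \<open>A dominating estimator agrees with \<open>bayes_est\<close> almost everywhere in
  \<open>obs\<close>. All laws of the observation have densities with respect to \<open>obs\<close>,
  so the two risks coincide at every parameter and strict improvement is impossible.\<close>

lemma admissible_delta_star: "admissible n (delta_star n a b :: (real ^ 'p) \<times> real \<Rightarrow> real ^ 'p)"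
proof -
  let ?\<delta> = "delta_star n a b :: (real ^ 'p) \<times> real \<Rightarrow> real ^ 'p"
  have meas: "?\<delta> \<in> borel_measurable obs"
    using measurable_bayes_est by (subst measurable_cong[OF delta_star_eq_bayes_est]) auto
  have risk: "risk n ?\<delta> \<theta> \<eta> = risk n bayes_est \<theta> \<eta>" for \<theta> \<eta>
    unfolding risk_eq[OF n meas] risk_eq[OF n measurable_bayes_est]
    by (intro nn_integral_cong) (simp add: delta_star_eq_bayes_est)
  have "\<not> risk n \<delta>' \<theta> \<eta> < risk n ?\<delta> \<theta> \<eta>"
    if est: "estimator \<delta>'" and dom: "\<And>\<theta> \<eta>. 0 < \<eta> \<Longrightarrow> risk n \<delta>' \<theta> \<eta> \<le> risk n ?\<delta> \<theta> \<eta>"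
    for \<delta>' :: "(real ^ 'p) \<times> real \<Rightarrow> real ^ 'p" and \<theta> \<eta>
  proof -
    have \<delta>': "\<delta>' \<in> borel_measurable obs"
      using est by (simp add: estimator_iff_obs)
    have "AE z in obs. \<delta>' z = bayes_est z"
      using dom by (intro dominating_estimator_AE_eq \<delta>') (simp add: risk)
    then have "risk n \<delta>' \<theta> \<eta> = risk n bayes_est \<theta> \<eta>"
      unfolding risk_eq[OF n \<delta>'] risk_eq[OF n measurable_bayes_est]
      by (intro nn_integral_cong_AE) (auto elim!: eventually_mono)
    then show ?thesis by (simp add: risk)
  qed
  then show ?thesis
    unfolding admissible_def estimator_iff_obs using meas by blast
qed

end

theorem theorem1p1:
  fixes n :: nat and a b :: real
  assumes "n \<ge> 1"
    and "(CARD('p::finite) \<ge> 1 \<and> max (- real CARD('p) / 2 - 1) (- 2) < a \<and> a \<le> - 1 \<and> b > - 1)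
       \<or> (CARD('p) \<ge> 3 \<and> a = - 2 \<and> b \<ge> 0)"
  shows "admissible n (delta_star n a b :: (real ^ 'p) \<times> real \<Rightarrow> real ^ 'p)"
proof -
  \<comment> \<open>Positivity of \<open>p / 2 + a + 1\<close> is the bound
    \<open>a > - p / 2 - 1\<close> in the first case; in the second it reads
    \<open>p / 2 - 1 > 0\<close> and follows from \<open>p \<ge> 3\<close>.\<close>
  interpret shrinkage_prior n a b "TYPE('p)"
    using assms by unfold_locales auto
  show ?thesis
    by (rule admissible_delta_star)
qed

end
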